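(* Let $k$ be a field and let $u>v$ be squarefree monomials of degree $2$ in $k[x_1,\dots,x_n]$, with $u=x_ix_j$, $i<j$. Let $\Delta$ be the simplicial complex on $[n]$ with Stanley-Reisner ideal $I_\Delta=(L(u,v))$. Let $\Delta_1$ be the simplex on $[i-1]=\{1,\dots,i-1\}$ and let $\Delta_2$ be the simplicial complex on $\{i,\dots,n\}$ whose Stanley-Reisner ideal is the ideal generated by $L(u,v)$ in $k[x_i,\dots,x_n]$, so that $\Delta=\Delta_1\ast\Delta_2$. Let $t\ge2$ and assume that $\Delta$ is not $\mathrm{CM}_{t-1}$. Then the following are equivalent: (i) $\Delta$ is $\mathrm{CM}_t$; (ii) one of the following conditions holds: (a) $u=x_tx_{n-2}$, $v=x_{n-2}x_{n-1}$, $n>4$; (b) $u=x_tx_{n-1}$, $v=x_{n-2}x_n$, $n>3$; (iii) $\Delta_1$ is of dimension $t-2$ and $\Delta_2$ is pure; (iv) $\Delta_1$ is of dimension $t-2$ and $\Delta_2$ is Buchsbaum.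
   Context: $R=k[x_1,\dots,x_n]$ is a polynomial ring over the field $k$ with standard grading, $M_2$ is the set of all squarefree monomials of degree $2$ in $R$, and monomials are ordered lexicographically with $x_1>x_2>\cdots>x_n$. For $u\ge v$ in $M_2$, $L(u,v)=\{w\in M_2 : u\ge w\ge v\}$, and $(L(u,v))$ is the ideal of $R$ it generates. For a simplicial complex $\Delta$, $I_\Delta$ is its Stanley-Reisner ideal and $k[\Delta]$ its Stanley-Reisner ring; $\Delta$ is Cohen-Macaulay, respectively Buchsbaum (over $k$), if $k[\Delta]$ is. For $F\in\Delta$, $\mathrm{lk}_\Delta(F)=\{G\in\Delta : G\cup F\in\Delta,\ G\cap F=\varnothing\}$. For an integer $t$ with $0\le t\le\dim(\Delta)-1$, a pure complex $\Delta$ is called $\mathrm{CM}_t$, or Cohen-Macaulay in codimension $t$, over $k$ if $\mathrm{lk}_\Delta(F)$ is Cohen-Macaulay over $k$ for all $F\in\Delta$ with $\#F\ge t$. $\mathrm{CM}_0$ is the same as Cohen-Macaulayness and $\mathrm{CM}_1$ is identical with the Buchsbaum property. $\ast$ denotes the join of simplicial complexes. The simplex on $[i-1]$ has dimension $i-2$ (for $i=1$ it has no vertices and $\Delta=\Delta_2$).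
   Formalization: Condition (ii)(a) additionally requires n>t+3 and (ii)(b) requires n>t+2, since as printed (ii) fails for n=t+3 resp. n=t+2 (e.g. n=5, t=2, u=x_2x_3, v=x_3x_4: Δ_2 is not pure); CM_t is used for all t, without the bound t≤dim(Δ)-1. *)

theory Defs
  imports "HOL-Library.Poly_Mapping" "HOL-Library.Extended_Nat" "HOL-Algebra.QuotRing"
begin

section \<open>Commutative algebra\<close>

definition krull_dim :: "('a, 'b) ring_scheme \<Rightarrow> enat" where
  "krull_dim R = Sup {enat l | l. \<exists>P. (\<forall>i\<le>l. primeideal (P i) R) \<and> (\<forall>i<l. P i \<subset> P (Suc i))}"

definition regular_sequence :: "('a, 'b) ring_scheme \<Rightarrow> 'a list \<Rightarrow> bool" where
  "regular_sequence R xs \<longleftrightarrow>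
     set xs \<subseteq> carrier R \<and> Idl\<^bsub>R\<^esub> (set xs) \<noteq> carrier R \<and>
     (\<forall>r<length xs. \<forall>a\<in>carrier R. xs ! r \<otimes>\<^bsub>R\<^esub> a \<in> Idl\<^bsub>R\<^esub> (set (take r xs))
        \<longrightarrow> a \<in> Idl\<^bsub>R\<^esub> (set (take r xs)))"

definition depth :: "('a, 'b) ring_scheme \<Rightarrow> 'a set \<Rightarrow> enat" where
  "depth R I = Sup {enat (length xs) | xs. regular_sequence R xs \<and> set xs \<subseteq> I}"

definition colon :: "('a, 'b) ring_scheme \<Rightarrow> 'a set \<Rightarrow> 'a set \<Rightarrow> 'a set" where
  "colon R I S = {a \<in> carrier R. \<forall>s\<in>S. s \<otimes>\<^bsub>R\<^esub> a \<in> I}"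

text \<open>A system of parameters of a Noetherian local ring \<open>R\<close> with maximal ideal \<open>m\<close>:
  \<open>dim R\<close> elements of \<open>m\<close> generating an \<open>m\<close>-primary ideal.\<close>

definition system_of_parameters :: "('a, 'b) ring_scheme \<Rightarrow> 'a set \<Rightarrow> 'a list \<Rightarrow> bool" where
  "system_of_parameters R m xs \<longleftrightarrow>
     set xs \<subseteq> m \<and> enat (length xs) = krull_dim R \<and>
     (\<forall>a\<in>m. \<exists>e::nat. a [^]\<^bsub>R\<^esub> e \<in> Idl\<^bsub>R\<^esub> (set xs))"

definition weak_sequence :: "('a, 'b) ring_scheme \<Rightarrow> 'a set \<Rightarrow> 'a list \<Rightarrow> bool" where
  "weak_sequence R m xs \<longleftrightarrow>
     (\<forall>r<length xs. colon R (Idl\<^bsub>R\<^esub> (set (take r xs))) {xs ! r} =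
        colon R (Idl\<^bsub>R\<^esub> (set (take r xs))) m)"

definition buchsbaum_local :: "('a, 'b) ring_scheme \<Rightarrow> 'a set \<Rightarrow> bool" where
  "buchsbaum_local R m \<longleftrightarrow> (\<forall>xs. system_of_parameters R m xs \<longrightarrow> weak_sequence R m xs)"

definition frac_rel :: "('a, 'b) ring_scheme \<Rightarrow> 'a set \<Rightarrow> (('a \<times> 'a) \<times> ('a \<times> 'a)) set" where
  "frac_rel R S = {((a, s), (b, t)). a \<in> carrier R \<and> b \<in> carrier R \<and> s \<in> S \<and> t \<in> S \<and>
     (\<exists>w\<in>S. w \<otimes>\<^bsub>R\<^esub> (t \<otimes>\<^bsub>R\<^esub> a) = w \<otimes>\<^bsub>R\<^esub> (s \<otimes>\<^bsub>R\<^esub> b))}"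

definition frac :: "('a, 'b) ring_scheme \<Rightarrow> 'a set \<Rightarrow> 'a \<Rightarrow> 'a \<Rightarrow> ('a \<times> 'a) set" where
  "frac R S a s = frac_rel R S `` {(a, s)}"

text \<open>The ring of fractions of \<open>R\<close> with denominators in the multiplicative set \<open>S\<close>.  On
  classes the operations are unions over all representatives; each union is over equal sets.\<close>

definition localization :: "('a, 'b) ring_scheme \<Rightarrow> 'a set \<Rightarrow> ('a \<times> 'a) set ring" where
  "localization R S =
     \<lparr>carrier = (carrier R \<times> S) // frac_rel R S,
      mult = (\<lambda>X Y. \<Union>(a, s)\<in>X. \<Union>(b, t)\<in>Y. frac R S (a \<otimes>\<^bsub>R\<^esub> b) (s \<otimes>\<^bsub>R\<^esub> t)),
      one = frac R S \<one>\<^bsub>R\<^esub> \<one>\<^bsub>R\<^esub>,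
      zero = frac R S \<zero>\<^bsub>R\<^esub> \<one>\<^bsub>R\<^esub>,
      add = (\<lambda>X Y. \<Union>(a, s)\<in>X. \<Union>(b, t)\<in>Y.
        frac R S ((t \<otimes>\<^bsub>R\<^esub> a) \<oplus>\<^bsub>R\<^esub> (s \<otimes>\<^bsub>R\<^esub> b)) (s \<otimes>\<^bsub>R\<^esub> t))\<rparr>"

definition local_max_ideal :: "('a, 'b) ring_scheme \<Rightarrow> 'a set \<Rightarrow> ('a \<times> 'a) set set" where
  "local_max_ideal R P = {frac R (carrier R - P) a s | a s. a \<in> P \<and> s \<in> carrier R - P}"

text \<open>In the next two definitions \<open>A\<close> is a standard graded algebra over a field and \<open>m\<close> its
  graded maximal ideal \<open>A\<^sub>+\<close>: such an \<open>A\<close> is Cohen-Macaulay if \<open>depth A = dim A\<close>, where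
  \<open>depth A\<close> is the maximal length of a regular sequence in \<open>m\<close>, and it is Buchsbaum if its
  localization at \<open>m\<close> is a Buchsbaum local ring.\<close>

definition cohen_macaulay_graded :: "('a, 'b) ring_scheme \<Rightarrow> 'a set \<Rightarrow> bool" where
  "cohen_macaulay_graded A m \<longleftrightarrow> depth A m = krull_dim A"

definition buchsbaum_graded :: "('a, 'b) ring_scheme \<Rightarrow> 'a set \<Rightarrow> bool" where
  "buchsbaum_graded A m \<longleftrightarrow>
     buchsbaum_local (localization A (carrier A - m)) (local_max_ideal A m)"


section \<open>Monomials and polynomial rings\<close>

text \<open>A monomial is its exponent function, so the product of monomials is the sum \<open>+\<close>.  The
  order \<open>\<le>\<close> on \<open>nat \<Rightarrow>\<^sub>0 nat\<close> provided by \<^theory>\<open>HOL-Library.Poly_Mapping\<close> compares the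
  exponents at the smallest index where they differ; it is the lexicographic order with
  \<open>x\<^sub>1 > x\<^sub>2 > \<dots>\<close>.\<close>

type_synonym monomial = "nat \<Rightarrow>\<^sub>0 nat"
type_synonym 'k mpoly = "monomial \<Rightarrow>\<^sub>0 'k"

definition var :: "nat \<Rightarrow> monomial" where
  "var i = Poly_Mapping.single i 1"

definition M2 :: "nat \<Rightarrow> monomial set" where
  "M2 n = {w. Poly_Mapping.keys w \<subseteq> {1..n} \<and> (\<forall>i. Poly_Mapping.lookup w i \<le> 1) \<and> (\<Sum>i\<in>Poly_Mapping.keys w. Poly_Mapping.lookup w i) = 2}"

definition L :: "nat \<Rightarrow> monomial \<Rightarrow> monomial \<Rightarrow> monomial set" where
  "L n u v = {w \<in> M2 n. v \<le> w \<and> w \<le> u}"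

text \<open>The argument of type \<open>'k itself\<close>, here and below, only serves to name the field.\<close>

definition poly_ring :: "'k::field itself \<Rightarrow> nat set \<Rightarrow> 'k mpoly ring" where
  "poly_ring k V =
     \<lparr>carrier = {p. \<forall>w\<in>Poly_Mapping.keys p. Poly_Mapping.keys w \<subseteq> V}, mult = (*), one = 1, zero = 0, add = (+)\<rparr>"

definition monomial_ideal :: "'k::field itself \<Rightarrow> nat set \<Rightarrow> monomial set \<Rightarrow> 'k mpoly set" where
  "monomial_ideal k V W = Idl\<^bsub>poly_ring k V\<^esub> ((\<lambda>w. Poly_Mapping.single w 1) ` W)"


section \<open>Simplicial complexes\<close>

text \<open>Elements of the ground set \<open>V\<close> need not be vertices of the complex.\<close>

definition simplicial_complex :: "nat set \<Rightarrow> nat set set \<Rightarrow> bool" where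
  "simplicial_complex V \<Delta> \<longleftrightarrow>
     finite V \<and> \<Delta> \<subseteq> Pow V \<and> {} \<in> \<Delta> \<and> (\<forall>F\<in>\<Delta>. \<forall>G. G \<subseteq> F \<longrightarrow> G \<in> \<Delta>)"

definition cdim :: "nat set set \<Rightarrow> int" where
  "cdim \<Delta> = int (Max (card ` \<Delta>)) - 1"

definition facets :: "nat set set \<Rightarrow> nat set set" where
  "facets \<Delta> = {F \<in> \<Delta>. \<forall>G\<in>\<Delta>. F \<subseteq> G \<longrightarrow> G = F}"

definition pure :: "nat set set \<Rightarrow> bool" where
  "pure \<Delta> \<longleftrightarrow> (\<forall>F\<in>facets \<Delta>. \<forall>G\<in>facets \<Delta>. card F = card G)"

definition link :: "nat set set \<Rightarrow> nat set \<Rightarrow> nat set set" where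
  "link \<Delta> F = {G \<in> \<Delta>. G \<union> F \<in> \<Delta> \<and> G \<inter> F = {}}"

definition sr_ideal :: "'k::field itself \<Rightarrow> nat set \<Rightarrow> nat set set \<Rightarrow> 'k mpoly set" where
  "sr_ideal k V \<Delta> = monomial_ideal k V {\<Sum>i\<in>F. var i | F. F \<subseteq> V \<and> F \<notin> \<Delta>}"

definition sr_ring :: "'k::field itself \<Rightarrow> nat set \<Rightarrow> nat set set \<Rightarrow> 'k mpoly set ring" where
  "sr_ring k V \<Delta> = poly_ring k V Quot sr_ideal k V \<Delta>"

text \<open>The graded maximal ideal of the Stanley-Reisner ring, generated by the residue classes
  of the variables.\<close>

definition sr_max_ideal :: "'k::field itself \<Rightarrow> nat set \<Rightarrow> nat set set \<Rightarrow> 'k mpoly set set" where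
  "sr_max_ideal k V \<Delta> = Idl\<^bsub>sr_ring k V \<Delta>\<^esub>
     ((\<lambda>i. sr_ideal k V \<Delta> +>\<^bsub>poly_ring k V\<^esub> Poly_Mapping.single (var i) 1) ` V)"

definition cohen_macaulay :: "'k::field itself \<Rightarrow> nat set \<Rightarrow> nat set set \<Rightarrow> bool" where
  "cohen_macaulay k V \<Delta> \<longleftrightarrow> cohen_macaulay_graded (sr_ring k V \<Delta>) (sr_max_ideal k V \<Delta>)"

definition buchsbaum :: "'k::field itself \<Rightarrow> nat set \<Rightarrow> nat set set \<Rightarrow> bool" where
  "buchsbaum k V \<Delta> \<longleftrightarrow> buchsbaum_graded (sr_ring k V \<Delta>) (sr_max_ideal k V \<Delta>)"

definition CM :: "'k::field itself \<Rightarrow> nat set \<Rightarrow> nat \<Rightarrow> nat set set \<Rightarrow> bool" where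
  "CM k V t \<Delta> \<longleftrightarrow>
     pure \<Delta> \<and> (\<forall>F\<in>\<Delta>. t \<le> card F \<longrightarrow> cohen_macaulay k (V - F) (link \<Delta> F))"

end

theory Submission
  imports Defs
begin

text \<open>
  Both ideals are generated by squarefree quadrics, so the complexes are clique complexes of
  graphs, and the lexicographic order makes the graph explicit.  Write \<open>v = x\<^sub>p x\<^sub>q\<close>.  A pair
  \<open>a < b\<close> is a non-edge iff \<open>(i, j) \<le> (a, b) \<le> (p, q)\<close> lexicographically; hence the vertices below \<open>i\<close> are
  cone points, and within \<open>{i..n}\<close> a vertex strictly between \<open>i\<close> and \<open>p\<close> is adjacent to at most \<open>i\<close>,
  while the vertices above \<open>p\<close> form a clique.  Comparing the sizes of a few visible facets leaves three
  possibilities for a pure \<open>\<Delta>\<^sub>2\<close> (\<open>pure_classification\<close>): a set of points, a simplex joined with a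
  connected graph, or one of two disconnected graphs, which are the shapes (a) and (b) with \<open>i\<close>
  in place of \<open>t\<close>.

  In the first two cases every link in \<open>\<Delta>\<close> is a simplex, possibly joined with points or with a
  connected graph.  Such complexes are Cohen-Macaulay (\<open>cohen_macaulay_join_points\<close>,
  \<open>cohen_macaulay_join_connected\<close>), so \<open>\<Delta>\<close> would be \<open>CM\<close> in codimension \<open>t - 1\<close>, contrary to
  hypothesis.  In the third case \<open>\<Delta>\<close> is the join of the simplex on \<open>i - 1\<close> vertices with a disconnected graph.
  The link of that simplex is the graph itself, which is not Cohen-Macaulay
  (\<open>disconnected_not_cohen_macaulay\<close>), whereas a face with at least \<open>i\<close> vertices contains a
  vertex of the graph and has a simplex joined with points, or a simplex, as its link.  So \<open>\<Delta>\<close> is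
  Cohen-Macaulay in codimension \<open>s\<close> exactly for \<open>s \<ge> i\<close>; since it is not for \<open>s = t - 1\<close>, it is for
  \<open>s = t\<close> exactly when \<open>i = t\<close>.  Finally, Buchsbaum complexes are pure (\<open>buchsbaum_imp_pure\<close>)
  and pure graphs are Buchsbaum (\<open>pure_graph_buchsbaum\<close>), so purity of \<open>\<Delta>\<^sub>2\<close> may be replaced by
  the Buchsbaum property.

  The algebra rests on three ideas.  First, setting the variables outside a face \<open>F\<close> to zero is a
  ring homomorphism \<open>res F\<close> into a domain, and the Stanley-Reisner ideal consists of the polynomials
  that all these maps kill; so zero divisors in the Stanley-Reisner ring are tested face by face.
  Second, its dimension is the largest number of vertices of a face: a longer chain of primes would
  produce too many algebraically independent elements, which a count of monomials excludes
  (\<open>prime_chain_length_le\<close>).  Third, regular sequences are built by coning and by gluing along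
  intersections (\<open>regular_mod_join\<close>, \<open>regular_mod_Un\<close>); the depth never exceeds the dimension, since
  a nonzerodivisor lies in no minimal prime (\<open>depth_le_krull_dim\<close>).
\<close>

section \<open>Ideals and chains of primes\<close>

definition prime_chain where
  "prime_chain R l P \<longleftrightarrow> (\<forall>i\<le>l. primeideal (P i) R) \<and> (\<forall>i<l. P i \<subset> P (Suc i))"

lemma krull_dim_eqI:
  assumes "prime_chain R d P" and "\<And>l Q. prime_chain R l Q \<Longrightarrow> l \<le> d"
  shows "krull_dim R = enat d"
proof (rule antisym)
  show "krull_dim R \<le> enat d"
    unfolding krull_dim_def using assms(2) by (intro Sup_least) (auto simp: prime_chain_def)
  show "enat d \<le> krull_dim R"
    unfolding krull_dim_def using assms(1) by (intro Sup_upper) (auto simp: prime_chain_def)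
qed

lemma prime_chain_le_krull_dim:
  assumes "prime_chain R l P" shows "enat l \<le> krull_dim R"
  unfolding krull_dim_def using assms by (intro Sup_upper) (auto simp: prime_chain_def)

lemma (in ring) Idl_Idl_Un:
  assumes "X \<subseteq> carrier R" "Y \<subseteq> carrier R"
  shows "Idl (Idl X \<union> Y) = Idl (X \<union> Y)"
proof
  have c: "Idl X \<subseteq> carrier R"
    using ideal.Icarr[OF genideal_ideal[OF assms(1)]] by (rule subsetI)
  have XY: "X \<union> Y \<subseteq> carrier R" using assms by blast
  show "Idl (Idl X \<union> Y) \<subseteq> Idl (X \<union> Y)"
  proof (rule genideal_minimal)
    show "ideal (Idl (X \<union> Y)) R" using XY by (rule genideal_ideal)
    show "Idl X \<union> Y \<subseteq> Idl (X \<union> Y)"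
      using subset_Idl_subset[of "X \<union> Y" X] genideal_self[OF XY] XY by blast
  qed
  show "Idl (X \<union> Y) \<subseteq> Idl (Idl X \<union> Y)"
    using c assms genideal_self[OF assms(1)] genideal_self[of "Idl X \<union> Y"]
    by (intro genideal_minimal genideal_ideal) auto
qed

lemma (in ring) Idl_ideal_eq: "ideal J R \<Longrightarrow> Idl J = J"
  using genideal_minimal[of J J] genideal_self[of J] ideal.Icarr[of J R] by blast

lemma (in cring) Idl_insert_iff:
  assumes I: "ideal I R" and x: "x \<in> carrier R"
  shows "a \<in> Idl (insert x I) \<longleftrightarrow> (\<exists>i\<in>I. \<exists>b\<in>carrier R. a = i \<oplus> b \<otimes> x)"
proof -
  interpret I: ideal I R by (rule I)
  interpret P: ideal "PIdl x" R using x by (rule cgenideal_ideal)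
  have "Idl (insert x I) = I <+> PIdl x"
  proof -
    have "Idl (insert x I) = Idl (I \<union> {x})" by simp
    also have "\<dots> = Idl (I \<union> PIdl x)"
    proof -
      have "Idl (Idl {x} \<union> I) = Idl ({x} \<union> I)"
        using x I.Icarr by (intro Idl_Idl_Un) auto
      thus ?thesis using cgenideal_eq_genideal[OF x] by (simp add: Un_commute)
    qed
    also have "\<dots> = I <+> PIdl x" using union_genideal[OF I P.is_ideal] by simp
    finally show ?thesis .
  qed
  thus ?thesis unfolding set_add_def' cgenideal_def by auto
qed

section \<open>Depth and dimension\<close>

text \<open>
  Krull's separation lemma.  An ideal maximal among those that contain \<open>J\<close> and miss \<open>T\<close> is prime:
  enlarging it by either factor of a product would meet \<open>T\<close>, and multiplying the two witnesses
  would put an element of \<open>T\<close> into the ideal.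
\<close>

lemma (in cring) prime_avoiding:
  assumes J: "ideal J R" and T: "T \<subseteq> carrier R" "\<one> \<in> T" "\<And>s t. s \<in> T \<Longrightarrow> t \<in> T \<Longrightarrow> s \<otimes> t \<in> T"
    and JT: "J \<inter> T = {}"
  shows "\<exists>Q. primeideal Q R \<and> J \<subseteq> Q \<and> Q \<inter> T = {}"
proof -
  let ?A = "{Q. ideal Q R \<and> J \<subseteq> Q \<and> Q \<inter> T = {}}"
  have "\<exists>M\<in>?A. \<forall>X\<in>?A. M \<subseteq> X \<longrightarrow> X = M"
  proof (rule subset_Zorn_nonempty)
    show "?A \<noteq> {}" using J JT by auto
    fix \<C> assume ne: "\<C> \<noteq> {}" and ch: "subset.chain ?A \<C>"
    have sub: "\<C> \<subseteq> ?A" and tot: "\<And>X Y. X \<in> \<C> \<Longrightarrow> Y \<in> \<C> \<Longrightarrow> X \<subseteq> Y \<or> Y \<subseteq> X"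
      using ch unfolding subset_chain_def by auto
    have idl: "\<And>X. X \<in> \<C> \<Longrightarrow> ideal X R" using sub by auto
    have "ideal (\<Union>\<C>) R"
    proof (rule idealI)
      show "ring R" by (rule ring_axioms)
      show "subgroup (\<Union>\<C>) (add_monoid R)"
      proof (rule add.subgroupI)
        show "\<Union>\<C> \<subseteq> carrier R" using ideal.Icarr[OF idl] by (intro Union_least subsetI)
        show "\<Union>\<C> \<noteq> {}"
          using ne additive_subgroup.zero_closed[OF ideal.axioms(1)[OF idl]] by blast
        show "\<ominus> a \<in> \<Union>\<C>" if "a \<in> \<Union>\<C>" for a
          using that additive_subgroup.a_inv_closed[OF ideal.axioms(1)[OF idl]] by blast
        show "a \<oplus> b \<in> \<Union>\<C>" if ab: "a \<in> \<Union>\<C>" "b \<in> \<Union>\<C>" for a b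
        proof -
          obtain X Y where XY: "X \<in> \<C>" "a \<in> X" "Y \<in> \<C>" "b \<in> Y" using ab by auto
          then obtain Z where "Z \<in> \<C>" "a \<in> Z" "b \<in> Z" using tot by blast
          thus ?thesis using additive_subgroup.a_closed[OF ideal.axioms(1)[OF idl]] by blast
        qed
      qed
      show "\<And>a x. a \<in> \<Union>\<C> \<Longrightarrow> x \<in> carrier R \<Longrightarrow> x \<otimes> a \<in> \<Union>\<C>"
        using ideal.I_l_closed[OF idl] by blast
      show "\<And>a x. a \<in> \<Union>\<C> \<Longrightarrow> x \<in> carrier R \<Longrightarrow> a \<otimes> x \<in> \<Union>\<C>"
        using ideal.I_r_closed[OF idl] by blast
    qed
    thus "\<Union>\<C> \<in> ?A" using sub ne by auto
  qed
  then obtain M where M: "ideal M R" "J \<subseteq> M" "M \<inter> T = {}"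
    and max: "\<And>X. ideal X R \<Longrightarrow> M \<subseteq> X \<Longrightarrow> X \<inter> T = {} \<Longrightarrow> X = M" by (auto 0 3)
  interpret M: ideal M R by (rule M(1))
  have "primeideal M R"
  proof (rule primeidealI[OF M(1) cring_axioms])
    show "carrier R \<noteq> M" using M(3) T by auto
    fix a b assume ab: "a \<in> carrier R" "b \<in> carrier R" "a \<otimes> b \<in> M"
    show "a \<in> M \<or> b \<in> M"
    proof (rule ccontr)
      assume n: "\<not> (a \<in> M \<or> b \<in> M)"
      have *: "\<exists>m\<in>M. \<exists>r\<in>carrier R. m \<oplus> r \<otimes> x \<in> T" if "x \<in> carrier R" "x \<notin> M" for x
      proof -
        have "insert x M \<subseteq> carrier R" using that M.Icarr by auto
        then have "ideal (Idl (insert x M)) R" "insert x M \<subseteq> Idl (insert x M)"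
          using genideal_ideal genideal_self by blast+
        then have "Idl (insert x M) \<inter> T \<noteq> {}" using max that by blast
        then obtain y where y: "y \<in> Idl (insert x M)" "y \<in> T" by auto
        thus ?thesis using Idl_insert_iff[OF M(1) that(1), of y] by auto
      qed
      obtain m r where 1: "m \<in> M" "r \<in> carrier R" "m \<oplus> r \<otimes> a \<in> T" using * ab n by blast
      obtain m' r' where 2: "m' \<in> M" "r' \<in> carrier R" "m' \<oplus> r' \<otimes> b \<in> T" using * ab n by blast
      have mc: "m \<in> carrier R" "m' \<in> carrier R" using 1 2 M.Icarr by auto
      have "(m \<oplus> r \<otimes> a) \<otimes> (m' \<oplus> r' \<otimes> b)
          = m \<otimes> (m' \<oplus> r' \<otimes> b) \<oplus> ((r \<otimes> a) \<otimes> m' \<oplus> (r \<otimes> r') \<otimes> (a \<otimes> b))"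
        using mc 1 2 ab by (simp add: l_distr r_distr m_ac a_ac)
      also have "\<dots> \<in> M"
        using 1(2) 2(2) ab(1,2) mc M.I_r_closed[OF 1(1), of "m' \<oplus> r' \<otimes> b"]
          M.I_l_closed[OF 2(1), of "r \<otimes> a"] M.I_l_closed[OF ab(3), of "r \<otimes> r'"]
        by (intro M.a_closed) auto
      finally show False using T(3)[OF 1(3) 2(3)] M(3) by auto
    qed
  qed
  thus ?thesis using M by blast
qed

text \<open>
  A nonzerodivisor modulo \<open>J\<close> lies in no minimal prime of \<open>J\<close>.  The products \<open>x\<^sup>n s\<close> with \<open>s \<notin> P\<close> form
  a multiplicative set that misses \<open>J\<close>; a prime avoiding it lies inside \<open>P\<close> and omits \<open>x\<close>.
\<close>

lemma (in cring) prime_below_nonzerodivisor: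
  assumes J: "ideal J R" and P: "primeideal P R" and JP: "J \<subseteq> P" and x: "x \<in> P"
    and reg: "\<And>a. a \<in> carrier R \<Longrightarrow> x \<otimes> a \<in> J \<Longrightarrow> a \<in> J"
  shows "\<exists>Q. primeideal Q R \<and> J \<subseteq> Q \<and> Q \<subset> P"
proof -
  interpret P: primeideal P R by (rule P)
  have xc: "x \<in> carrier R" using x P.Icarr by auto
  let ?T = "{x [^] (n::nat) \<otimes> s | n s. s \<in> carrier R - P}"
  have one: "\<one> \<notin> P" using P.one_imp_carrier P.I_notcarr by auto
  have pw: "x [^] (n::nat) \<otimes> s \<in> J \<Longrightarrow> s \<in> carrier R \<Longrightarrow> s \<in> J" for n s
  proof (induction n)
    case 0 thus ?case by simp
  next
    case (Suc n)
    have "x [^] Suc n \<otimes> s = x \<otimes> (x [^] n \<otimes> s)" using xc Suc.prems by (simp add: m_ac)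
    then show ?case using Suc reg[of "x [^] n \<otimes> s"] xc by auto
  qed
  have "\<exists>Q. primeideal Q R \<and> J \<subseteq> Q \<and> Q \<inter> ?T = {}"
  proof (rule prime_avoiding[OF J])
    show "?T \<subseteq> carrier R" using xc by auto
    show "\<one> \<in> ?T" using one by (intro CollectI exI[of _ "0::nat"] exI[of _ \<one>]) auto
    show "J \<inter> ?T = {}" using pw JP by auto
    fix s t assume "s \<in> ?T" "t \<in> ?T"
    then obtain n s' m t' where st: "s = x [^] (n::nat) \<otimes> s'" "t = x [^] (m::nat) \<otimes> t'" "s' \<in> carrier R - P"
      "t' \<in> carrier R - P" by auto
    have "s \<otimes> t = x [^] (n + m) \<otimes> (s' \<otimes> t')"
      using st xc by (simp add: m_ac nat_pow_mult[symmetric])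
    moreover have "s' \<otimes> t' \<in> carrier R - P" using st P.I_prime by auto
    ultimately show "s \<otimes> t \<in> ?T" by blast
  qed
  then obtain Q where Q: "primeideal Q R" "J \<subseteq> Q" "Q \<inter> ?T = {}" by auto
  interpret Q: primeideal Q R by (rule Q(1))
  have "Q \<subseteq> P"
  proof
    fix s assume s: "s \<in> Q"
    show "s \<in> P"
    proof (rule ccontr)
      assume "s \<notin> P"
      then have "x [^] (0::nat) \<otimes> s \<in> ?T" using s Q.Icarr by blast
      thus False using Q(3) s Q.Icarr by auto
    qed
  qed
  moreover have "x \<notin> Q"
  proof -
    have "x [^] (1::nat) \<otimes> \<one> \<in> ?T" using one by blast
    then have "x \<in> ?T" using xc by simp
    thus ?thesis using Q(3) by blast
  qed
  ultimately show ?thesis using Q x by blast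
qed

text \<open>
  Starting from \<open>P\<close> and removing the elements of the sequence from the end, each removal yields a
  strictly smaller prime.
\<close>

lemma (in cring) regular_sequence_prime_chain:
  assumes "set xs \<subseteq> P" and "primeideal P R"
    and "\<And>r a. r < length xs \<Longrightarrow> a \<in> carrier R \<Longrightarrow> xs ! r \<otimes> a \<in> Idl (set (take r xs)) \<Longrightarrow>
            a \<in> Idl (set (take r xs))"
  shows "\<exists>Q. prime_chain R (length xs) Q \<and> Q (length xs) = P"
  using assms
proof (induction xs arbitrary: P rule: rev_induct)
  case Nil
  show ?case using Nil by (intro exI[of _ "\<lambda>_. P"]) (auto simp: prime_chain_def)
next
  case (snoc x xs)
  interpret P: primeideal P R by (rule snoc.prems(2))
  have sc: "set xs \<subseteq> carrier R" using snoc.prems(1) P.Icarr by auto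
  have "\<exists>Q. primeideal Q R \<and> Idl (set xs) \<subseteq> Q \<and> Q \<subset> P"
  proof (rule prime_below_nonzerodivisor)
    show "ideal (Idl (set xs)) R" by (rule genideal_ideal[OF sc])
    show "primeideal P R" by fact
    show "Idl (set xs) \<subseteq> P" using snoc.prems(1) by (intro genideal_minimal P.is_ideal) auto
    show "x \<in> P" using snoc.prems by auto
    show "\<And>a. a \<in> carrier R \<Longrightarrow> x \<otimes> a \<in> Idl (set xs) \<Longrightarrow> a \<in> Idl (set xs)"
      using snoc.prems(3)[of "length xs"] by simp
  qed
  then obtain P' where P': "primeideal P' R" "Idl (set xs) \<subseteq> P'" "P' \<subset> P" by auto
  have "\<exists>Q. prime_chain R (length xs) Q \<and> Q (length xs) = P'"
  proof (rule snoc.IH)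
    show "set xs \<subseteq> P'" using P' genideal_self[OF sc] by auto
    show "primeideal P' R" by fact
    fix r a assume "r < length xs" "a \<in> carrier R" "xs ! r \<otimes> a \<in> Idl (set (take r xs))"
    thus "a \<in> Idl (set (take r xs))" using snoc.prems(3)[of r a] by (simp add: nth_append)
  qed
  then obtain Q where Q: "prime_chain R (length xs) Q" "Q (length xs) = P'" by auto
  show ?case
  proof (intro exI[of _ "Q(Suc (length xs) := P)"] conjI)
    show "prime_chain R (length (xs @ [x])) (Q(Suc (length xs) := P))"
      using Q P' snoc.prems(2) unfolding prime_chain_def
      by (auto simp: less_Suc_eq le_Suc_eq)
  qed simp
qed

theorem (in cring) depth_le_krull_dim: "depth R I \<le> krull_dim R"
  unfolding depth_def
proof (rule Sup_least, clarify)
  fix xs assume r: "regular_sequence R xs"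
  have sc: "set xs \<subseteq> carrier R" and proper: "Idl (set xs) \<noteq> carrier R"
    using r by (auto simp: regular_sequence_def)
  have J: "ideal (Idl (set xs)) R" using sc by (rule genideal_ideal)
  have "\<one> \<notin> Idl (set xs)" using proper ideal.one_imp_carrier[OF J] by auto
  then have "\<exists>P. primeideal P R \<and> Idl (set xs) \<subseteq> P \<and> P \<inter> {\<one>} = {}"
    by (intro prime_avoiding[OF J]) auto
  then obtain P where P: "primeideal P R" "Idl (set xs) \<subseteq> P" by auto
  have "\<exists>Q. prime_chain R (length xs) Q \<and> Q (length xs) = P"
    using r P genideal_self[OF sc] unfolding regular_sequence_def
    by (intro regular_sequence_prime_chain) auto
  thus "enat (length xs) \<le> krull_dim R" using prime_chain_le_krull_dim by blast
qed

section \<open>Residue class rings\<close>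

lemma (in ideal) rcos_eq_iff:
  assumes "x \<in> carrier R" "y \<in> carrier R"
  shows "I +> x = I +> y \<longleftrightarrow> x \<ominus> y \<in> I"
  using quotient_eq_iff_same_a_r_cos[OF is_ideal assms] by auto

lemma (in ideal) carrier_Quot: "carrier (R Quot I) = (\<lambda>x. I +> x) ` carrier R"
  by (auto simp: FactRing_def A_RCOSETS_def')

lemma (in cring) Quot_prime_vimage:
  assumes I: "ideal I R" and P: "primeideal P (R Quot I)"
  shows "primeideal {x \<in> carrier R. I +> x \<in> P} R" "I \<subseteq> {x \<in> carrier R. I +> x \<in> P}"
proof -
  interpret I: ideal I R by (rule I)
  interpret P: primeideal P "R Quot I" by (rule P)
  interpret h: ring_hom_ring R "R Quot I" "(+>) I" by (rule I.rcos_ring_hom_ring)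
  show "primeideal {x \<in> carrier R. I +> x \<in> P} R"
    by (rule h.primeideal_vimage[OF cring_axioms P])
  show "I \<subseteq> {x \<in> carrier R. I +> x \<in> P}"
  proof
    fix x assume x: "x \<in> I"
    then have "I +> x = I" by (rule a_rcos_zero[OF I])
    also have "\<dots> = \<zero>\<^bsub>R Quot I\<^esub>" unfolding FactRing_def by (rule ring.simps(1)[symmetric])
    finally have "I +> x = \<zero>\<^bsub>R Quot I\<^esub>" .
    then have "I +> x \<in> P"
      using additive_subgroup.zero_closed[OF ideal.axioms(1)[OF P.is_ideal]] by (simp only:)
    thus "x \<in> {x \<in> carrier R. I +> x \<in> P}" using x I.Icarr by blast
  qed
qed

lemma (in cring) Quot_prime_image:
  assumes I: "ideal I R" and P: "primeideal P R" and IP: "I \<subseteq> P"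
  shows "primeideal ((+>) I ` P) (R Quot I)"
    and "x \<in> carrier R \<Longrightarrow> I +> x \<in> (+>) I ` P \<longleftrightarrow> x \<in> P"
proof -
  interpret I: ideal I R by (rule I)
  interpret P: primeideal P R by (rule P)
  interpret h: ring_hom_ring R "R Quot I" "(+>) I" by (rule I.rcos_ring_hom_ring)
  have mem: "I +> x \<in> (+>) I ` P \<longleftrightarrow> x \<in> P" if x: "x \<in> carrier R" for x
  proof
    assume "I +> x \<in> (+>) I ` P"
    then obtain y where y: "y \<in> P" "I +> x = I +> y" by auto
    then have "x \<ominus> y \<in> P" using I.rcos_eq_iff x P.Icarr IP by blast
    then have "(x \<ominus> y) \<oplus> y \<in> P" using y by auto
    moreover have "(x \<ominus> y) \<oplus> y = x" using x y P.Icarr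
      by (simp add: a_minus_def a_assoc l_neg)
    ultimately show "x \<in> P" by simp
  qed auto
  show "x \<in> carrier R \<Longrightarrow> I +> x \<in> (+>) I ` P \<longleftrightarrow> x \<in> P" by (rule mem)
  show "primeideal ((+>) I ` P) (R Quot I)"
  proof (rule primeidealI)
    show "ideal ((+>) I ` P) (R Quot I)"
      by (rule ring_ideal_imp_quot_ideal[OF I P.is_ideal])
    show "cring (R Quot I)" by (rule I.quotient_is_cring[OF cring_axioms])
    have "\<one> \<notin> P" using P.one_imp_carrier P.I_notcarr by auto
    then have "I +> \<one> \<notin> (+>) I ` P" using mem[OF one_closed] by simp
    thus "carrier (R Quot I) \<noteq> (+>) I ` P" unfolding I.carrier_Quot using one_closed by blast
    fix a b assume ab: "a \<in> carrier (R Quot I)" "b \<in> carrier (R Quot I)"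
      "a \<otimes>\<^bsub>R Quot I\<^esub> b \<in> (+>) I ` P"
    then obtain x y where xy: "x \<in> carrier R" "y \<in> carrier R" "a = I +> x" "b = I +> y"
      using I.carrier_Quot by auto
    then have "I +> (x \<otimes> y) \<in> (+>) I ` P"
      using ab(3) h.hom_mult[OF xy(1,2)] by (simp del: h.hom_mult)
    then have "x \<otimes> y \<in> P" using mem[of "x \<otimes> y"] xy by blast
    then have "x \<in> P \<or> y \<in> P" using P.I_prime xy by blast
    thus "a \<in> (+>) I ` P \<or> b \<in> (+>) I ` P" using xy by auto
  qed
qed

lemma (in cring) Quot_prime_chain_vimage:
  assumes I: "ideal I R" and Q: "prime_chain (R Quot I) l Q"
  shows "\<exists>P. prime_chain R l P \<and> I \<subseteq> P 0"
proof (intro exI conjI)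
  interpret I: ideal I R by (rule I)
  let ?P = "\<lambda>i. {x \<in> carrier R. I +> x \<in> Q i}"
  show "I \<subseteq> ?P 0" using Q by (intro Quot_prime_vimage[OF I]) (auto simp: prime_chain_def)
  have "?P i \<subset> ?P (Suc i)" if "i < l" for i
  proof -
    have s: "Q i \<subset> Q (Suc i)" "primeideal (Q (Suc i)) (R Quot I)"
      using Q that by (auto simp: prime_chain_def)
    then obtain a where a: "a \<in> Q (Suc i)" "a \<notin> Q i" by auto
    have "a \<in> carrier (R Quot I)" using ideal.Icarr[OF primeideal.axioms(1)[OF s(2)] a(1)] .
    then obtain x where "x \<in> carrier R" "a = I +> x" using I.carrier_Quot by auto
    thus ?thesis using s(1) a by auto
  qed
  thus "prime_chain R l ?P"
    using Q Quot_prime_vimage(1)[OF I] by (auto simp: prime_chain_def)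
qed

lemma (in cring) Quot_prime_chain_image:
  assumes I: "ideal I R" and Q: "prime_chain R l Q" and IQ: "I \<subseteq> Q 0"
  shows "prime_chain (R Quot I) l (\<lambda>i. (+>) I ` Q i)"
proof -
  have IQi: "I \<subseteq> Q i" if "i \<le> l" for i
    using that
  proof (induction i)
    case (Suc i)
    then have "Q i \<subset> Q (Suc i)" using Q by (simp add: prime_chain_def)
    thus ?case using Suc by auto
  qed (use IQ in simp)
  have p: "i \<le> l \<Longrightarrow> primeideal (Q i) R" for i using Q by (auto simp: prime_chain_def)
  have "(+>) I ` Q i \<subset> (+>) I ` Q (Suc i)" if "i < l" for i
  proof -
    have s: "Q i \<subset> Q (Suc i)" using Q that by (auto simp: prime_chain_def)
    then obtain a where a: "a \<in> Q (Suc i)" "a \<notin> Q i" by auto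
    have "a \<in> carrier R" using ideal.Icarr[OF primeideal.axioms(1)[OF p] a(1)] that by auto
    then have "I +> a \<notin> (+>) I ` Q i" using Quot_prime_image(2)[OF I p IQi] that a by auto
    thus ?thesis using a s by blast
  qed
  thus ?thesis using Quot_prime_image(1)[OF I p IQi] by (auto simp: prime_chain_def)
qed

lemma (in cring) Idl_Quot_iff:
  assumes I: "ideal I R" and X: "X \<subseteq> carrier R" and a: "a \<in> carrier R"
  shows "I +> a \<in> Idl\<^bsub>R Quot I\<^esub> ((+>) I ` X) \<longleftrightarrow> a \<in> Idl (I \<union> X)"
proof -
  interpret I: ideal I R by (rule I)
  interpret h: ring_hom_ring R "R Quot I" "(+>) I" by (rule I.rcos_ring_hom_ring)
  let ?J = "Idl (I \<union> X)" and ?K = "Idl\<^bsub>R Quot I\<^esub> ((+>) I ` X)"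
  have IX: "I \<union> X \<subseteq> carrier R" using X I.Icarr by auto
  have J: "ideal ?J R" by (rule genideal_ideal[OF IX])
  interpret J: ideal ?J R by (rule J)
  have IJ: "I \<subseteq> ?J" "X \<subseteq> ?J" using genideal_self[OF IX] by auto
  have Xc: "(+>) I ` X \<subseteq> carrier (R Quot I)" using X I.carrier_Quot by auto
  have K: "ideal ?K (R Quot I)" by (rule h.S.genideal_ideal[OF Xc])
  show ?thesis
  proof
    assume "I +> a \<in> ?K"
    moreover have "?K \<subseteq> (+>) I ` ?J"
      using IJ by (intro h.S.genideal_minimal ring_ideal_imp_quot_ideal[OF I J]) auto
    ultimately obtain y where y: "y \<in> ?J" "I +> a = I +> y" by auto
    then have "a \<ominus> y \<in> ?J" using I.rcos_eq_iff a J.Icarr IJ by blast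
    then have "(a \<ominus> y) \<oplus> y \<in> ?J" using y by auto
    moreover have "(a \<ominus> y) \<oplus> y = a" using a y J.Icarr
      by (simp add: a_minus_def a_assoc l_neg)
    ultimately show "a \<in> ?J" by simp
  next
    assume aJ: "a \<in> ?J"
    have "?J \<subseteq> {x \<in> carrier R. I +> x \<in> ?K}"
    proof (rule genideal_minimal)
      show "ideal {x \<in> carrier R. I +> x \<in> ?K} R" by (rule h.ideal_vimage[OF K])
      have "I +> x \<in> ?K" if "x \<in> I" for x
      proof -
        have "I +> x = I" using that by (rule a_rcos_zero[OF I])
        also have "\<dots> = \<zero>\<^bsub>R Quot I\<^esub>" unfolding FactRing_def by (rule ring.simps(1)[symmetric])
        finally have "I +> x = \<zero>\<^bsub>R Quot I\<^esub>" .
        thus ?thesis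
          using additive_subgroup.zero_closed[OF ideal.axioms(1)[OF K]] by (simp only:)
      qed
      thus "I \<union> X \<subseteq> {x \<in> carrier R. I +> x \<in> ?K}"
        using IX h.S.genideal_self[OF Xc] by auto
    qed
    thus "I +> a \<in> ?K" using aJ by auto
  qed
qed

section \<open>Localization\<close>

locale mult_set = cring R for R (structure) +
  fixes S
  assumes S_sub: "S \<subseteq> carrier R" and one_S: "\<one> \<in> S"
    and mult_S: "s \<in> S \<Longrightarrow> t \<in> S \<Longrightarrow> s \<otimes> t \<in> S"
begin

lemma S_carr: "s \<in> S \<Longrightarrow> s \<in> carrier R" using S_sub by auto

abbreviation "Loc \<equiv> localization R S"
abbreviation "fr \<equiv> frac R S"

lemma frac_rel_equiv: "equiv (carrier R \<times> S) (frac_rel R S)"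
proof (rule equivI)
  show "frac_rel R S \<subseteq> (carrier R \<times> S) \<times> carrier R \<times> S" by (auto simp: frac_rel_def)
  show "refl_on (carrier R \<times> S) (frac_rel R S)"
    using one_S by (auto simp: refl_on_def frac_rel_def)
  show "sym (frac_rel R S)" unfolding sym_def frac_rel_def by (auto, metis)
  show "trans (frac_rel R S)"
  proof (rule transI)
    fix x y z assume "(x, y) \<in> frac_rel R S" "(y, z) \<in> frac_rel R S"
    then obtain a s b t c r w w' where e: "x = (a, s)" "y = (b, t)" "z = (c, r)"
      and m: "a \<in> carrier R" "b \<in> carrier R" "c \<in> carrier R" "s \<in> S" "t \<in> S" "r \<in> S" "w \<in> S" "w' \<in> S"
      and w: "w \<otimes> (t \<otimes> a) = w \<otimes> (s \<otimes> b)" "w' \<otimes> (r \<otimes> b) = w' \<otimes> (t \<otimes> c)"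
      unfolding frac_rel_def by fast
    have mc: "s \<in> carrier R" "t \<in> carrier R" "r \<in> carrier R" "w \<in> carrier R" "w' \<in> carrier R"
      using m S_carr by auto
    have "(w \<otimes> w' \<otimes> t) \<otimes> (r \<otimes> a) = (w' \<otimes> r) \<otimes> (w \<otimes> (t \<otimes> a))"
      using m(1-3) mc by (simp add: m_ac)
    also have "\<dots> = (w \<otimes> s) \<otimes> (w' \<otimes> (r \<otimes> b))"
      unfolding w(1) using m(1-3) mc by (simp add: m_ac)
    also have "\<dots> = (w \<otimes> w' \<otimes> t) \<otimes> (s \<otimes> c)"
      unfolding w(2) using m(1-3) mc by (simp add: m_ac)
    finally show "(x, z) \<in> frac_rel R S" using m mult_S e unfolding frac_rel_def by blast
  qed
qed

lemma frac_rel_iff: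
  "((a, s), (b, t)) \<in> frac_rel R S \<longleftrightarrow> a \<in> carrier R \<and> b \<in> carrier R \<and> s \<in> S \<and> t \<in> S \<and>
     (\<exists>w\<in>S. w \<otimes> (t \<otimes> a) = w \<otimes> (s \<otimes> b))"
  by (auto simp: frac_rel_def)

lemma fr_eq_iff:
  assumes "a \<in> carrier R" "b \<in> carrier R" "s \<in> S" "t \<in> S"
  shows "fr a s = fr b t \<longleftrightarrow> (\<exists>w\<in>S. w \<otimes> (t \<otimes> a) = w \<otimes> (s \<otimes> b))"
  unfolding frac_def using eq_equiv_class_iff[OF frac_rel_equiv, of "(a, s)" "(b, t)"] assms
  by (simp add: frac_rel_iff)

lemma fr_eqI:
  assumes "a \<in> carrier R" "b \<in> carrier R" "s \<in> S" "t \<in> S" "t \<otimes> a = s \<otimes> b"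
  shows "fr a s = fr b t"
  unfolding fr_eq_iff[OF assms(1-4)] using assms(5) one_S by auto

lemma fr_self: "a \<in> carrier R \<Longrightarrow> s \<in> S \<Longrightarrow> (a, s) \<in> fr a s"
  unfolding frac_def using equiv_class_self[OF frac_rel_equiv] by simp

lemma fr_memD:
  assumes "(a', s') \<in> fr a s"
  shows "a \<in> carrier R" "s \<in> S" "a' \<in> carrier R" "s' \<in> S"
    and "\<exists>w\<in>S. w \<otimes> (s' \<otimes> a) = w \<otimes> (s \<otimes> a')"
  using assms by (auto simp: frac_def frac_rel_iff)

lemma loc_carrier: "carrier Loc = {fr a s | a s. a \<in> carrier R \<and> s \<in> S}"
proof -
  have "carrier Loc = (carrier R \<times> S) // frac_rel R S"
    unfolding localization_def by (rule partial_object.simps(1))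
  also have "\<dots> = (\<lambda>p. frac_rel R S `` {p}) ` (carrier R \<times> S)" unfolding quotient_def by blast
  also have "\<dots> = (\<lambda>(a, s). fr a s) ` (carrier R \<times> S)" by (intro image_cong) (auto simp: frac_def)
  also have "\<dots> = {fr a s | a s. a \<in> carrier R \<and> s \<in> S}" by (auto simp: image_def)
  finally show ?thesis .
qed

lemma UN_const_pairs:
  assumes "x \<in> X" "y \<in> Y" and "\<And>a s b t. (a, s) \<in> X \<Longrightarrow> (b, t) \<in> Y \<Longrightarrow> f a s b t = C"
  shows "(\<Union>(a, s)\<in>X. \<Union>(b, t)\<in>Y. f a s b t) = C"
proof -
  have "(case q of (b, t) \<Rightarrow> f a s b t) = C" if "(a, s) \<in> X" "q \<in> Y" for a s q
    using that assms(3) by (cases q) auto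
  then have "(\<Union>(b, t)\<in>Y. f a s b t) = C" if "(a, s) \<in> X" for a s
    using that assms(2) by (intro SUP_eq_const) auto
  then have "(case p of (a, s) \<Rightarrow> \<Union>(b, t)\<in>Y. f a s b t) = C" if "p \<in> X" for p
    using that by (cases p) auto
  thus ?thesis using assms(1) by (intro SUP_eq_const) auto
qed

lemma loc_mult:
  assumes "a \<in> carrier R" "b \<in> carrier R" "s \<in> S" "t \<in> S"
  shows "fr a s \<otimes>\<^bsub>Loc\<^esub> fr b t = fr (a \<otimes> b) (s \<otimes> t)"
proof -
  have "(\<Union>(a', s')\<in>fr a s. \<Union>(b', t')\<in>fr b t. fr (a' \<otimes> b') (s' \<otimes> t')) = fr (a \<otimes> b) (s \<otimes> t)"
  proof (rule UN_const_pairs[OF fr_self[OF assms(1,3)] fr_self[OF assms(2,4)]])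
    fix a' s' b' t' assume A: "(a', s') \<in> fr a s" and B: "(b', t') \<in> fr b t"
    obtain w where w: "w \<in> S" "w \<otimes> (s' \<otimes> a) = w \<otimes> (s \<otimes> a')" using fr_memD(5)[OF A] by auto
    obtain w' where w': "w' \<in> S" "w' \<otimes> (t' \<otimes> b) = w' \<otimes> (t \<otimes> b')" using fr_memD(5)[OF B] by auto
    note c = assms fr_memD(3,4)[OF A] fr_memD(3,4)[OF B] w(1) w'(1)
    have "(w \<otimes> w') \<otimes> ((s \<otimes> t) \<otimes> (a' \<otimes> b')) = (w \<otimes> (s \<otimes> a')) \<otimes> (w' \<otimes> (t \<otimes> b'))"
      using c S_carr by (simp add: m_ac)
    also have "\<dots> = (w \<otimes> w') \<otimes> ((s' \<otimes> t') \<otimes> (a \<otimes> b))"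
      unfolding w(2)[symmetric] w'(2)[symmetric] using c S_carr by (simp add: m_ac)
    finally show "fr (a' \<otimes> b') (s' \<otimes> t') = fr (a \<otimes> b) (s \<otimes> t)"
      using c mult_S by (subst fr_eq_iff) auto
  qed
  thus ?thesis by (simp add: localization_def)
qed

lemma loc_add:
  assumes "a \<in> carrier R" "b \<in> carrier R" "s \<in> S" "t \<in> S"
  shows "fr a s \<oplus>\<^bsub>Loc\<^esub> fr b t = fr (t \<otimes> a \<oplus> s \<otimes> b) (s \<otimes> t)"
proof -
  have "(\<Union>(a', s')\<in>fr a s. \<Union>(b', t')\<in>fr b t. fr (t' \<otimes> a' \<oplus> s' \<otimes> b') (s' \<otimes> t'))
      = fr (t \<otimes> a \<oplus> s \<otimes> b) (s \<otimes> t)"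
  proof (rule UN_const_pairs[OF fr_self[OF assms(1,3)] fr_self[OF assms(2,4)]])
    fix a' s' b' t' assume A: "(a', s') \<in> fr a s" and B: "(b', t') \<in> fr b t"
    obtain w where w: "w \<in> S" "w \<otimes> (s' \<otimes> a) = w \<otimes> (s \<otimes> a')" using fr_memD(5)[OF A] by auto
    obtain w' where w': "w' \<in> S" "w' \<otimes> (t' \<otimes> b) = w' \<otimes> (t \<otimes> b')" using fr_memD(5)[OF B] by auto
    note c = assms(1,2) S_carr[OF assms(3)] S_carr[OF assms(4)] fr_memD(3)[OF A]
      S_carr[OF fr_memD(4)[OF A]] fr_memD(3)[OF B] S_carr[OF fr_memD(4)[OF B]]
      S_carr[OF w(1)] S_carr[OF w'(1)]
    have "(w \<otimes> w') \<otimes> ((s \<otimes> t) \<otimes> (t' \<otimes> a' \<oplus> s' \<otimes> b'))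
        = (w' \<otimes> t \<otimes> t') \<otimes> (w \<otimes> (s \<otimes> a')) \<oplus> (w \<otimes> s \<otimes> s') \<otimes> (w' \<otimes> (t \<otimes> b'))"
      using c by (simp add: m_ac r_distr)
    also have "\<dots> = (w \<otimes> w') \<otimes> ((s' \<otimes> t') \<otimes> (t \<otimes> a \<oplus> s \<otimes> b))"
      unfolding w(2)[symmetric] w'(2)[symmetric] using c by (simp add: m_ac r_distr)
    finally show "fr (t' \<otimes> a' \<oplus> s' \<otimes> b') (s' \<otimes> t') = fr (t \<otimes> a \<oplus> s \<otimes> b) (s \<otimes> t)"
      using c mult_S w(1) w'(1) assms(3,4) fr_memD(4)[OF A] fr_memD(4)[OF B]
      by (subst fr_eq_iff) auto
  qed
  thus ?thesis by (simp add: localization_def)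
qed

lemma loc_one: "\<one>\<^bsub>Loc\<^esub> = fr \<one> \<one>" and loc_zero: "\<zero>\<^bsub>Loc\<^esub> = fr \<zero> \<one>"
  by (simp_all add: localization_def)

lemma fr_closed: "a \<in> carrier R \<Longrightarrow> s \<in> S \<Longrightarrow> fr a s \<in> carrier Loc"
  using loc_carrier by auto

lemma loc_cases:
  assumes "x \<in> carrier Loc"
  obtains a s where "a \<in> carrier R" "s \<in> S" "x = fr a s"
  using assms loc_carrier by auto

lemma loc_cring: "cring Loc"
proof (rule cringI)
  show "abelian_group Loc"
  proof (rule abelian_groupI)
    fix x y z assume "x \<in> carrier Loc" "y \<in> carrier Loc" "z \<in> carrier Loc"
    then obtain a s b t c r where x: "a \<in> carrier R" "s \<in> S" "x = fr a s"
      and y: "b \<in> carrier R" "t \<in> S" "y = fr b t" and z: "c \<in> carrier R" "r \<in> S" "z = fr c r"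
      by (elim loc_cases)
    note k = x(1) y(1) z(1) S_carr[OF x(2)] S_carr[OF y(2)] S_carr[OF z(2)]
    show "x \<oplus>\<^bsub>Loc\<^esub> y \<in> carrier Loc" using x y k mult_S by (simp add: loc_add fr_closed)
    show "x \<oplus>\<^bsub>Loc\<^esub> y = y \<oplus>\<^bsub>Loc\<^esub> x"
      using x y k mult_S by (simp add: loc_add a_comm m_comm)
    show "x \<oplus>\<^bsub>Loc\<^esub> y \<oplus>\<^bsub>Loc\<^esub> z = x \<oplus>\<^bsub>Loc\<^esub> (y \<oplus>\<^bsub>Loc\<^esub> z)"
      using x y z k mult_S by (simp add: loc_add) (simp add: r_distr m_ac a_ac)
    show "\<zero>\<^bsub>Loc\<^esub> \<oplus>\<^bsub>Loc\<^esub> x = x" using x k one_S by (simp add: loc_zero loc_add)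
    show "\<exists>y\<in>carrier Loc. y \<oplus>\<^bsub>Loc\<^esub> x = \<zero>\<^bsub>Loc\<^esub>"
    proof (rule bexI)
      have "fr (s \<otimes> (\<ominus> a) \<oplus> s \<otimes> a) (s \<otimes> s) = fr \<zero> \<one>"
        using x k one_S mult_S by (intro fr_eqI) (auto simp: r_distr[symmetric] l_neg)
      then show "fr (\<ominus> a) s \<oplus>\<^bsub>Loc\<^esub> x = \<zero>\<^bsub>Loc\<^esub>" using x k by (simp add: loc_zero loc_add)
      show "fr (\<ominus> a) s \<in> carrier Loc" using x by (simp add: fr_closed)
    qed
  qed (use one_S in \<open>simp add: loc_zero fr_closed\<close>)
  show "comm_monoid Loc"
  proof (rule comm_monoidI)
    fix x y z assume "x \<in> carrier Loc" "y \<in> carrier Loc" "z \<in> carrier Loc"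
    then obtain a s b t c r where x: "a \<in> carrier R" "s \<in> S" "x = fr a s"
      and y: "b \<in> carrier R" "t \<in> S" "y = fr b t" and z: "c \<in> carrier R" "r \<in> S" "z = fr c r"
      by (elim loc_cases)
    note k = x(1) y(1) z(1) S_carr[OF x(2)] S_carr[OF y(2)] S_carr[OF z(2)]
    show "x \<otimes>\<^bsub>Loc\<^esub> y \<in> carrier Loc" using x y k mult_S by (simp add: loc_mult fr_closed)
    show "x \<otimes>\<^bsub>Loc\<^esub> y = y \<otimes>\<^bsub>Loc\<^esub> x" using x y k mult_S by (simp add: loc_mult m_comm)
    show "x \<otimes>\<^bsub>Loc\<^esub> y \<otimes>\<^bsub>Loc\<^esub> z = x \<otimes>\<^bsub>Loc\<^esub> (y \<otimes>\<^bsub>Loc\<^esub> z)"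
      using x y z k mult_S by (simp add: loc_mult m_ac)
    show "\<one>\<^bsub>Loc\<^esub> \<otimes>\<^bsub>Loc\<^esub> x = x" using x k one_S by (simp add: loc_one loc_mult)
  qed (use one_S in \<open>simp add: loc_one fr_closed\<close>)
  fix x y z assume "x \<in> carrier Loc" "y \<in> carrier Loc" "z \<in> carrier Loc"
  then obtain a s b t c r where x: "a \<in> carrier R" "s \<in> S" "x = fr a s"
    and y: "b \<in> carrier R" "t \<in> S" "y = fr b t" and z: "c \<in> carrier R" "r \<in> S" "z = fr c r"
    by (elim loc_cases)
  note k = x(1) y(1) z(1) S_carr[OF x(2)] S_carr[OF y(2)] S_carr[OF z(2)]
  have "fr ((t \<otimes> a \<oplus> s \<otimes> b) \<otimes> c) (s \<otimes> t \<otimes> r)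
      = fr (t \<otimes> r \<otimes> (a \<otimes> c) \<oplus> s \<otimes> r \<otimes> (b \<otimes> c)) (s \<otimes> r \<otimes> (t \<otimes> r))"
    using x y z k mult_S by (intro fr_eqI) (auto simp: l_distr r_distr m_ac)
  then show "(x \<oplus>\<^bsub>Loc\<^esub> y) \<otimes>\<^bsub>Loc\<^esub> z = x \<otimes>\<^bsub>Loc\<^esub> z \<oplus>\<^bsub>Loc\<^esub> y \<otimes>\<^bsub>Loc\<^esub> z"
    using x y z k mult_S by (simp add: loc_add loc_mult)
qed

sublocale Loc: cring Loc by (rule loc_cring)

lemma loc_pow: "a \<in> carrier R \<Longrightarrow> s \<in> S \<Longrightarrow> fr a s [^]\<^bsub>Loc\<^esub> (n::nat) = fr (a [^] n) (s [^] n)"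
  and S_pow: "s \<in> S \<Longrightarrow> s [^] (n::nat) \<in> S"
proof -
  show p: "s \<in> S \<Longrightarrow> s [^] (n::nat) \<in> S" for n s
    by (induction n) (auto simp: one_S mult_S)
  show "a \<in> carrier R \<Longrightarrow> s \<in> S \<Longrightarrow> fr a s [^]\<^bsub>Loc\<^esub> (n::nat) = fr (a [^] n) (s [^] n)"
    by (induction n) (auto simp: loc_one loc_mult p)
qed

lemma fr_hom: "(\<lambda>a. fr a \<one>) \<in> ring_hom R Loc"
  by (rule ring_hom_memI) (auto simp: loc_one loc_mult loc_add fr_closed one_S)

lemma fr_split: "a \<in> carrier R \<Longrightarrow> s \<in> S \<Longrightarrow> fr a s = fr \<one> s \<otimes>\<^bsub>Loc\<^esub> fr a \<one>"
  using S_carr one_S by (simp add: loc_mult)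

lemma fr_clear: "a \<in> carrier R \<Longrightarrow> s \<in> S \<Longrightarrow> fr a \<one> = fr s \<one> \<otimes>\<^bsub>Loc\<^esub> fr a s"
  using S_carr one_S mult_S by (simp add: loc_mult) (intro fr_eqI, auto)

definition ext where "ext J = {fr a s | a s. a \<in> J \<and> s \<in> S}"

lemma fr_in_ext_iff:
  assumes J: "ideal J R" and b: "b \<in> carrier R" "t \<in> S"
  shows "fr b t \<in> ext J \<longleftrightarrow> (\<exists>w\<in>S. w \<otimes> b \<in> J)"
proof -
  interpret J: ideal J R by (rule J)
  show ?thesis
  proof
    assume "fr b t \<in> ext J"
    then obtain a s where as: "a \<in> J" "s \<in> S" "fr b t = fr a s" by (auto simp: ext_def)
    then obtain w where w: "w \<in> S" "w \<otimes> (s \<otimes> b) = w \<otimes> (t \<otimes> a)"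
      using fr_eq_iff[of b a t s] b J.Icarr by auto
    have "(w \<otimes> s) \<otimes> b = (w \<otimes> t) \<otimes> a" using w as b S_carr J.Icarr by (simp add: m_ac)
    also have "\<dots> \<in> J" using w as b S_carr by (intro J.I_l_closed) auto
    finally show "\<exists>w\<in>S. w \<otimes> b \<in> J" using w as mult_S by blast
  next
    assume "\<exists>w\<in>S. w \<otimes> b \<in> J"
    then obtain w where w: "w \<in> S" "w \<otimes> b \<in> J" by auto
    have "fr b t = fr (w \<otimes> b) (w \<otimes> t)"
      using w b S_carr mult_S by (intro fr_eqI) (auto simp: m_ac)
    thus "fr b t \<in> ext J" using w(2) mult_S[OF w(1) b(2)] unfolding ext_def by blast
  qed
qed

lemma ext_ideal:
  assumes J: "ideal J R" shows "ideal (ext J) Loc"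
proof -
  interpret J: ideal J R by (rule J)
  have sub: "ext J \<subseteq> carrier Loc" using J.Icarr by (auto simp: ext_def fr_closed)
  have l: "x \<otimes>\<^bsub>Loc\<^esub> y \<in> ext J" if xl: "x \<in> carrier Loc" and yl: "y \<in> ext J" for x y
  proof -
    obtain a s where x: "a \<in> carrier R" "s \<in> S" "x = fr a s" using loc_cases[OF xl] .
    obtain b t where y: "b \<in> J" "t \<in> S" "y = fr b t" using yl by (auto simp: ext_def)
    have "x \<otimes>\<^bsub>Loc\<^esub> y = fr (a \<otimes> b) (s \<otimes> t)" using x y J.Icarr by (simp add: loc_mult)
    thus ?thesis using x y mult_S J.I_l_closed unfolding ext_def by blast
  qed
  show ?thesis
  proof (rule idealI)
    show "ring Loc" by (rule Loc.ring_axioms)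
    show "subgroup (ext J) (add_monoid Loc)"
    proof (rule Loc.add.subgroupI)
      show "ext J \<subseteq> carrier Loc" by (rule sub)
      show "ext J \<noteq> {}" 
        using one_S additive_subgroup.zero_closed[OF J.additive_subgroup_axioms]
        unfolding ext_def by blast
      fix x y assume xx: "x \<in> ext J" and yy: "y \<in> ext J"
      have "\<ominus>\<^bsub>Loc\<^esub> x = (\<ominus>\<^bsub>Loc\<^esub> \<one>\<^bsub>Loc\<^esub>) \<otimes>\<^bsub>Loc\<^esub> x" using sub xx by (auto simp: Loc.l_minus)
      thus "\<ominus>\<^bsub>Loc\<^esub> x \<in> ext J" using l[OF _ xx, of "\<ominus>\<^bsub>Loc\<^esub> \<one>\<^bsub>Loc\<^esub>"] by simp
      obtain a s where x: "a \<in> J" "s \<in> S" "x = fr a s" using xx by (auto simp: ext_def)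
      obtain b t where y: "b \<in> J" "t \<in> S" "y = fr b t" using yy by (auto simp: ext_def)
      have "x \<oplus>\<^bsub>Loc\<^esub> y = fr (t \<otimes> a \<oplus> s \<otimes> b) (s \<otimes> t)" using x y J.Icarr by (simp add: loc_add)
      moreover have "t \<otimes> a \<oplus> s \<otimes> b \<in> J"
        using x y J.I_l_closed[OF x(1)] J.I_l_closed[OF y(1)] S_carr by (intro J.a_closed) auto
      ultimately show "x \<oplus>\<^bsub>Loc\<^esub> y \<in> ext J" using x y mult_S unfolding ext_def by blast
    qed
    show "\<And>a x. a \<in> ext J \<Longrightarrow> x \<in> carrier Loc \<Longrightarrow> x \<otimes>\<^bsub>Loc\<^esub> a \<in> ext J" using l by blast
    fix a x assume h: "a \<in> ext J" "x \<in> carrier Loc"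
    then have "a \<otimes>\<^bsub>Loc\<^esub> x = x \<otimes>\<^bsub>Loc\<^esub> a" using sub by (intro Loc.m_comm) auto
    thus "a \<otimes>\<^bsub>Loc\<^esub> x \<in> ext J" using l h by simp
  qed
qed

definition contr where "contr K = {a \<in> carrier R. fr a \<one> \<in> K}"

lemma contr_ideal: assumes K: "ideal K Loc" shows "ideal (contr K) R"
proof -
  interpret h: ring_hom_ring R Loc "\<lambda>a. fr a \<one>"
    by (rule ring_hom_ringI2[OF ring_axioms Loc.ring_axioms fr_hom])
  show ?thesis unfolding contr_def by (rule h.ideal_vimage[OF K])
qed

lemma fr_in_iff_contr:
  assumes K: "ideal K Loc" and a: "a \<in> carrier R" "s \<in> S"
  shows "fr a s \<in> K \<longleftrightarrow> a \<in> contr K"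
proof
  assume "fr a s \<in> K"
  then have "fr s \<one> \<otimes>\<^bsub>Loc\<^esub> fr a s \<in> K"
    using S_carr[OF a(2)] one_S by (intro ideal.I_l_closed[OF K]) (auto intro: fr_closed)
  thus "a \<in> contr K" using a fr_clear[of a s] by (simp add: contr_def)
next
  assume "a \<in> contr K"
  then have "fr \<one> s \<otimes>\<^bsub>Loc\<^esub> fr a \<one> \<in> K"
    using a by (intro ideal.I_l_closed[OF K]) (auto intro: fr_closed simp: contr_def)
  thus "fr a s \<in> K" using a fr_split[of a s] by simp
qed

text \<open>
  All computations in the local ring reduce to \<open>R\<close> through this criterion: denominators are units, so
  the ideal generated by fractions is the extension of the ideal generated by their numerators, and
  membership in an extension is membership up to a factor from \<open>S\<close>.
\<close>

lemma Idl_loc_iff: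
  assumes A: "A \<subseteq> carrier R \<times> S" and b: "b \<in> carrier R" "t \<in> S"
  shows "fr b t \<in> Idl\<^bsub>Loc\<^esub> ((\<lambda>(a, s). fr a s) ` A) \<longleftrightarrow> (\<exists>w\<in>S. w \<otimes> b \<in> Idl (fst ` A))"
proof -
  let ?K = "Idl\<^bsub>Loc\<^esub> ((\<lambda>(a, s). fr a s) ` A)" and ?J = "Idl (fst ` A)"
  have A1: "fst ` A \<subseteq> carrier R" using A by auto
  have AL: "(\<lambda>(a, s). fr a s) ` A \<subseteq> carrier Loc" using A by (auto intro: fr_closed)
  have J: "ideal ?J R" by (rule genideal_ideal[OF A1])
  have K: "ideal ?K Loc" by (rule Loc.genideal_ideal[OF AL])
  have "?K \<subseteq> ext ?J"
    using genideal_self[OF A1] A by (intro Loc.genideal_minimal ext_ideal J) (force simp: ext_def)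
  moreover have "?J \<subseteq> contr ?K"
  proof (intro genideal_minimal contr_ideal K subsetI)
    fix a assume "a \<in> fst ` A"
    then obtain s where s: "(a, s) \<in> A" by auto
    then have "fr a s \<in> ?K" using Loc.genideal_self[OF AL] by auto
    thus "a \<in> contr ?K" using s A fr_in_iff_contr[OF K, of a s] by auto
  qed
  then have "ext ?J \<subseteq> ?K"
    using fr_in_iff_contr[OF K] ideal.Icarr[OF J] by (auto simp: ext_def)
  ultimately have "?K = ext ?J" by auto
  thus ?thesis using fr_in_ext_iff[OF J b] by simp
qed

lemma ext_prime:
  assumes P: "primeideal P R" and d: "P \<inter> S = {}"
  shows "primeideal (ext P) Loc" and "a \<in> carrier R \<Longrightarrow> s \<in> S \<Longrightarrow> fr a s \<in> ext P \<longleftrightarrow> a \<in> P"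
proof -
  interpret P: primeideal P R by (rule P)
  have mem: "fr a s \<in> ext P \<longleftrightarrow> a \<in> P" if "a \<in> carrier R" "s \<in> S" for a s
  proof -
    have "w \<otimes> a \<in> P \<longleftrightarrow> a \<in> P" if "w \<in> S" for w
      using P.I_prime[of w a] P.I_l_closed[of a w] d that \<open>a \<in> carrier R\<close> S_carr[OF that] by auto
    thus ?thesis using fr_in_ext_iff[OF P.is_ideal that] one_S by auto
  qed
  show "a \<in> carrier R \<Longrightarrow> s \<in> S \<Longrightarrow> fr a s \<in> ext P \<longleftrightarrow> a \<in> P" by (rule mem)
  show "primeideal (ext P) Loc"
  proof (rule primeidealI[OF ext_ideal[OF P.is_ideal] loc_cring])
    have "fr \<one> \<one> \<notin> ext P" using mem[of \<one> \<one>] one_S d by auto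
    thus "carrier Loc \<noteq> ext P" using fr_closed[of \<one> \<one>] one_S by auto
    fix x y assume h: "x \<in> carrier Loc" "y \<in> carrier Loc" "x \<otimes>\<^bsub>Loc\<^esub> y \<in> ext P"
    then obtain a s b t where x: "a \<in> carrier R" "s \<in> S" "x = fr a s"
      and y: "b \<in> carrier R" "t \<in> S" "y = fr b t" by (elim loc_cases)
    then have "a \<otimes> b \<in> P" using h(3) mem mult_S by (simp add: loc_mult)
    thus "x \<in> ext P \<or> y \<in> ext P" using P.I_prime x y mem by blast
  qed
qed

lemma contr_prime:
  assumes P: "primeideal P Loc" shows "primeideal (contr P) R"
proof -
  interpret h: ring_hom_ring R Loc "\<lambda>a. fr a \<one>"
    by (rule ring_hom_ringI2[OF ring_axioms Loc.ring_axioms fr_hom])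
  show ?thesis unfolding contr_def by (rule h.primeideal_vimage[OF cring_axioms P])
qed

lemma contr_prime_chain:
  assumes Q: "prime_chain Loc l Q" shows "prime_chain R l (\<lambda>i. contr (Q i))"
proof -
  have p: "i \<le> l \<Longrightarrow> primeideal (Q i) Loc" for i using Q by (auto simp: prime_chain_def)
  have "contr (Q i) \<subset> contr (Q (Suc i))" if "i < l" for i
  proof -
    have s: "Q i \<subset> Q (Suc i)" using Q that by (auto simp: prime_chain_def)
    have id: "ideal (Q i) Loc" "ideal (Q (Suc i)) Loc"
      using p that primeideal.axioms(1) by (auto intro: primeideal.axioms(1))
    obtain x where x: "x \<in> Q (Suc i)" "x \<notin> Q i" using s by auto
    obtain a t where a: "a \<in> carrier R" "t \<in> S" "x = fr a t"
      using loc_cases[OF ideal.Icarr[OF id(2) x(1)]] .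
    then have "a \<in> contr (Q (Suc i))" "a \<notin> contr (Q i)" using x fr_in_iff_contr id by auto
    moreover have "contr (Q i) \<subseteq> contr (Q (Suc i))" using s by (auto simp: contr_def)
    ultimately show ?thesis by blast
  qed
  thus ?thesis using p contr_prime by (auto simp: prime_chain_def)
qed

lemma ext_prime_chain:
  assumes Q: "prime_chain R l Q" and d: "\<And>i. i \<le> l \<Longrightarrow> Q i \<inter> S = {}"
  shows "prime_chain Loc l (\<lambda>i. ext (Q i))"
proof -
  have p: "i \<le> l \<Longrightarrow> primeideal (Q i) R" for i using Q by (auto simp: prime_chain_def)
  have "ext (Q i) \<subset> ext (Q (Suc i))" if "i < l" for i
  proof -
    have s: "Q i \<subset> Q (Suc i)" using Q that by (auto simp: prime_chain_def)
    obtain x where x: "x \<in> Q (Suc i)" "x \<notin> Q i" using s by auto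
    have "x \<in> carrier R" using ideal.Icarr[OF primeideal.axioms(1)[OF p] x(1)] that by auto
    then have "fr x \<one> \<in> ext (Q (Suc i))" "fr x \<one> \<notin> ext (Q i)"
      using ext_prime(2)[OF p d] that x one_S by auto
    moreover have "ext (Q i) \<subseteq> ext (Q (Suc i))" using s by (auto simp: ext_def)
    ultimately show ?thesis by blast
  qed
  thus ?thesis using ext_prime(1)[OF p d] by (auto simp: prime_chain_def)
qed

end

section \<open>Polynomials\<close>

abbreviation (input) keys where "keys \<equiv> Poly_Mapping.keys"
abbreviation (input) lookup where "lookup \<equiv> Poly_Mapping.lookup"
abbreviation (input) single where "single \<equiv> Poly_Mapping.single"

abbreviation "polys k V \<equiv> carrier (poly_ring k V)"

lemma carrier_poly_ring: "p \<in> polys k V \<longleftrightarrow> (\<forall>w\<in>keys p. keys w \<subseteq> V)"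
  and mult_poly_ring [simp]: "p \<otimes>\<^bsub>poly_ring k V\<^esub> q = p * q"
  and add_poly_ring [simp]: "p \<oplus>\<^bsub>poly_ring k V\<^esub> q = p + q"
  and one_poly_ring [simp]: "\<one>\<^bsub>poly_ring k V\<^esub> = 1"
  and zero_poly_ring [simp]: "\<zero>\<^bsub>poly_ring k V\<^esub> = 0"
  by (simp_all add: poly_ring_def)

lemma keys_monomial_add: "keys (a + b) = keys a \<union> keys (b :: monomial)"
  by (auto simp: in_keys_iff lookup_add)

lemma keys_multE:
  assumes "w \<in> keys (p * q)"
  obtains a b where "w = a + b" "a \<in> keys p" "b \<in> keys q"
  using subsetD[OF keys_mult assms] by (auto simp: mem_Collect_eq)

lemma poly_closed:
  shows poly_add_closed: "p \<in> polys k V \<Longrightarrow> q \<in> polys k V \<Longrightarrow> p + q \<in> polys k V"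
    and poly_mult_closed: "p \<in> polys k V \<Longrightarrow> q \<in> polys k V \<Longrightarrow> p * q \<in> polys k V"
    and poly_uminus_closed: "p \<in> polys k V \<Longrightarrow> - p \<in> polys k V"
    and poly_one_closed: "1 \<in> polys k V"
    and poly_zero_closed: "0 \<in> polys k V"
    and poly_const_closed: "single 0 c \<in> polys k V"
proof -
  show "p \<in> polys k V \<Longrightarrow> q \<in> polys k V \<Longrightarrow> p + q \<in> polys k V"
    unfolding carrier_poly_ring using Poly_Mapping.keys_add[of p q] by blast
  show "p * q \<in> polys k V"
    if "p \<in> polys k V" "q \<in> polys k V"
    unfolding carrier_poly_ring
  proof
    fix w assume "w \<in> keys (p * q)"
    then obtain a b where "w = a + b" "a \<in> keys p" "b \<in> keys q"
      by (rule keys_multE)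
    thus "keys w \<subseteq> V" using that by (simp add: carrier_poly_ring keys_monomial_add)
  qed
qed (auto simp: carrier_poly_ring in_keys_iff lookup_single when_def)

lemma poly_minus_closed:
  "p \<in> polys k V \<Longrightarrow> q \<in> polys k V \<Longrightarrow> p - q \<in> polys k V"
  using poly_add_closed[of p k V "- q"] poly_uminus_closed[of q k V] by simp

lemma poly_power_closed: "p \<in> polys k V \<Longrightarrow> p ^ e \<in> polys k V"
  by (induction e) (auto intro: poly_mult_closed poly_one_closed)

lemma poly_sum_closed:
  "(\<And>a. a \<in> A \<Longrightarrow> f a \<in> polys k V) \<Longrightarrow> sum f A \<in> polys k V"
  by (induction A rule: infinite_finite_induct) (auto intro: poly_add_closed poly_zero_closed)

lemma poly_cring: "cring (poly_ring k V)"
proof (rule cringI)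
  show "abelian_group (poly_ring k V)"
  proof (rule abelian_groupI)
    show "\<exists>y\<in>polys k V. y \<oplus>\<^bsub>poly_ring k V\<^esub> x = \<zero>\<^bsub>poly_ring k V\<^esub>"
      if "x \<in> polys k V" for x
      using poly_uminus_closed[OF that] by (intro bexI[of _ "- x"]) auto
  qed (auto intro: poly_closed simp: add.assoc add.commute)
  show "comm_monoid (poly_ring k V)"
    by (rule comm_monoidI) (auto intro: poly_closed simp: mult.assoc mult.commute)
qed (auto simp: distrib_right)

lemma poly_idealI:
  assumes "J \<subseteq> polys k V" "0 \<in> J" "\<And>p q. p \<in> J \<Longrightarrow> q \<in> J \<Longrightarrow> p + q \<in> J"
    and "\<And>p q. p \<in> polys k V \<Longrightarrow> q \<in> J \<Longrightarrow> p * q \<in> J"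
  shows "ideal J (poly_ring k V)"
proof -
  interpret R: cring "poly_ring k V" by (rule poly_cring)
  have um: "\<ominus>\<^bsub>poly_ring k V\<^esub> q = - q" if "q \<in> J" for q
    using R.minus_equality[of "- q" q] assms(1) that poly_uminus_closed by auto
  have "- q \<in> J" if "q \<in> J" for q
    using assms(4)[OF poly_uminus_closed[OF poly_one_closed] that] by simp
  then have "subgroup J (add_monoid (poly_ring k V))"
    using assms um by (intro R.add.subgroupI) (auto simp: a_inv_def[symmetric])
  moreover have "q * p \<in> J" if "p \<in> polys k V" "q \<in> J" for p q
    using assms(4)[OF that] by (simp add: mult.commute)
  ultimately show ?thesis using assms
    by (intro idealI R.ring_axioms) auto
qed

lemma poly_idealD:
  assumes "ideal J (poly_ring k V)"
  shows "p \<in> J \<Longrightarrow> p \<in> polys k V" "0 \<in> J" "p \<in> J \<Longrightarrow> q \<in> J \<Longrightarrow> p + q \<in> J"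
    "p \<in> polys k V \<Longrightarrow> q \<in> J \<Longrightarrow> p * q \<in> J"
    "p \<in> polys k V \<Longrightarrow> q \<in> J \<Longrightarrow> q * p \<in> J"
    "p \<in> J \<Longrightarrow> q \<in> J \<Longrightarrow> p - q \<in> J" "p \<in> J \<Longrightarrow> - p \<in> J"
proof -
  interpret J: ideal J "poly_ring k V" by (rule assms)
  interpret R: cring "poly_ring k V" by (rule poly_cring)
  show c: "p \<in> J \<Longrightarrow> p \<in> polys k V" for p by (rule J.Icarr)
  show "0 \<in> J" using additive_subgroup.zero_closed[OF J.additive_subgroup_axioms] by simp
  show a: "p \<in> J \<Longrightarrow> q \<in> J \<Longrightarrow> p + q \<in> J" for p q 
    using additive_subgroup.a_closed[OF J.additive_subgroup_axioms, of p q] by simp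
  show l: "p \<in> polys k V \<Longrightarrow> q \<in> J \<Longrightarrow> p * q \<in> J" for p q
    using J.I_l_closed[of q p] by simp
  then show "p \<in> polys k V \<Longrightarrow> q \<in> J \<Longrightarrow> q * p \<in> J" by (simp add: mult.commute)
  have m: "q \<in> J \<Longrightarrow> - q \<in> J" for q
    using l[OF poly_uminus_closed[OF poly_one_closed], of q] by simp
  then show "p \<in> J \<Longrightarrow> - p \<in> J" .
  show "p \<in> J \<Longrightarrow> q \<in> J \<Longrightarrow> p - q \<in> J" using a[of p "- q"] m by simp
qed

lemma poly_ideal_sum:
  assumes "ideal J (poly_ring k V)" and "\<And>a. a \<in> A \<Longrightarrow> f a \<in> J" shows "sum f A \<in> J"
  using assms(2)
  by (induction A rule: infinite_finite_induct) (auto intro: poly_idealD(2,3)[OF assms(1)])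

lemma poly_primeD:
  assumes "primeideal P (poly_ring k V)"
  shows "ideal P (poly_ring k V)" "1 \<notin> P"
    "p \<in> polys k V \<Longrightarrow> q \<in> polys k V \<Longrightarrow> p * q \<in> P \<Longrightarrow> p \<in> P \<or> q \<in> P"
    "p \<in> polys k V \<Longrightarrow> p ^ e \<in> P \<Longrightarrow> p \<in> P"
proof -
  interpret P: primeideal P "poly_ring k V" by (rule assms)
  show "ideal P (poly_ring k V)" by (rule P.is_ideal)
  show one: "1 \<notin> P" using P.one_imp_carrier P.I_notcarr by auto
  show pr: "p \<in> polys k V \<Longrightarrow> q \<in> polys k V \<Longrightarrow> p * q \<in> P \<Longrightarrow> p \<in> P \<or> q \<in> P"
    for p q using P.I_prime[of p q] by simp
  show "p \<in> polys k V \<Longrightarrow> p ^ e \<in> P \<Longrightarrow> p \<in> P"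
  proof (induction e)
    case (Suc e)
    thus ?case using pr[of p "p ^ e"] poly_power_closed[of p k V e] by auto
  qed (use one in simp)
qed

lemma poly_eq_sum: "p = (\<Sum>w\<in>keys p. single w (lookup p w))"
  by (rule poly_mapping_eqI)
     (auto simp: lookup_sum lookup_single when_def in_keys_iff sum.delta)

lemma monomial_split:
  assumes "\<And>i. lookup g i \<le> lookup w i"
  shows "w = g + (w - g :: monomial)"
  by (rule poly_mapping_eqI) (use assms in \<open>simp add: lookup_add lookup_minus\<close>)

lemma monomial_le_iff: "(\<exists>h. w = g + h) \<longleftrightarrow> (\<forall>i. lookup g i \<le> lookup (w :: monomial) i)"
  using monomial_split[of g w] by (auto simp: lookup_add)

lemma divide_by_monomial:
  assumes p: "p \<in> polys k V" and d: "\<And>w. w \<in> keys p \<Longrightarrow> \<exists>h. w = g + h"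
  shows "\<exists>q\<in>polys k V. p = single g 1 * q"
proof
  let ?q = "\<Sum>w\<in>keys p. single (w - g) (lookup p w)"
  have e: "w = g + (w - g)" if "w \<in> keys p" for w
    using monomial_split d[OF that] monomial_le_iff by blast
  have "single g 1 * ?q
      = (\<Sum>w\<in>keys p. single (g + (w - g)) (lookup p w))"
    by (simp add: sum_distrib_left mult_single)
  also have "\<dots> = p" by (subst (5) poly_eq_sum) (intro sum.cong, auto simp: e[symmetric])
  finally show "p = single g 1 * ?q" by simp
  show "?q \<in> polys k V"
  proof (intro poly_sum_closed)
    fix w assume w: "w \<in> keys p"
    have "keys w = keys (g + (w - g))" using e[OF w] by simp
    then have "keys (w - g) \<subseteq> keys w" unfolding keys_monomial_add by blast
    also have "\<dots> \<subseteq> V" using p w by (simp add: carrier_poly_ring)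
    finally show "single (w - g) (lookup p w) \<in> polys k V"
      by (simp add: carrier_poly_ring)
  qed
qed

lemma poly_mem_idealI:
  assumes I: "ideal J (poly_ring k V)" and p: "p \<in> polys k V"
    and d: "\<And>w. w \<in> keys p \<Longrightarrow> \<exists>g h. w = g + h \<and> single g 1 \<in> J"
  shows "p \<in> J"
proof -
  have "single w (lookup p w) \<in> J" if w: "w \<in> keys p" for w
  proof -
    obtain g h where g: "w = g + h" "single g 1 \<in> J" using d[OF w] by blast
    have "keys w \<subseteq> V" using p w by (auto simp: carrier_poly_ring)
    then have "keys h \<subseteq> V" using g by (simp add: keys_monomial_add)
    then have h: "single h (lookup p w) \<in> polys k V"
      by (simp add: carrier_poly_ring)
    from poly_idealD(4)[OF I h g(2)] show ?thesis using g by (simp add: mult_single add.commute)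
  qed
  then have "(\<Sum>w\<in>keys p. single w (lookup p w)) \<in> J"
    by (intro poly_ideal_sum[OF I]) auto
  thus ?thesis using poly_eq_sum[of p] by simp
qed

lemma monomial_ideal_iff:
  assumes W: "\<And>g. g \<in> W \<Longrightarrow> keys g \<subseteq> V"
  shows "p \<in> monomial_ideal k V W \<longleftrightarrow>
    p \<in> polys k V \<and> (\<forall>w\<in>keys p. \<exists>g\<in>W. \<exists>h. w = g + h)"
proof -
  interpret R: cring "poly_ring k V" by (rule poly_cring)
  let ?J = "{p \<in> polys k V. \<forall>w\<in>keys p. \<exists>g\<in>W. \<exists>h. w = g + h}"
  let ?G = "(\<lambda>w. single w 1) ` W"
  have G: "?G \<subseteq> polys k V" using W by (auto simp: carrier_poly_ring)
  have J: "ideal ?J (poly_ring k V)"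
  proof (rule poly_idealI)
    fix p q :: "'a mpoly"
    show "p + q \<in> ?J" if "p \<in> ?J" "q \<in> ?J"
      using that Poly_Mapping.keys_add[of p q] poly_add_closed[of p k V q] by blast
    show "p * q \<in> ?J" if p: "p \<in> polys k V" and q: "q \<in> ?J"
    proof -
      have "\<exists>g\<in>W. \<exists>h. w = g + h" if w: "w \<in> keys (p * q)" for w
      proof -
        obtain a b where ab: "w = a + b" "b \<in> keys q" using keys_multE[OF w] .
        then obtain g h where "g \<in> W" "b = g + h" using q by blast
        then have "g \<in> W \<and> w = g + (a + h)" using ab by (simp add: ac_simps)
        thus ?thesis by blast
      qed
      thus ?thesis using p q poly_mult_closed by blast
    qed
  qed (auto simp: poly_zero_closed)
  have I: "ideal (monomial_ideal k V W) (poly_ring k V)"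
    unfolding monomial_ideal_def by (rule R.genideal_ideal[OF G])
  have "monomial_ideal k V W \<subseteq> ?J"
    unfolding monomial_ideal_def using J
  proof (rule R.genideal_minimal)
    have "\<exists>g\<in>W. \<exists>h. w = g + h" if "w \<in> W" for w
      using that by (intro bexI[of _ w] exI[of _ 0]) auto
    thus "?G \<subseteq> ?J" using G by auto
  qed
  moreover have "p \<in> monomial_ideal k V W" if p: "p \<in> ?J" for p
  proof (rule poly_mem_idealI[OF I])
    fix w assume "w \<in> keys p"
    then obtain g h where g: "g \<in> W" "w = g + h" using p by blast
    then have "single g 1 \<in> monomial_ideal k V W"
      unfolding monomial_ideal_def using R.genideal_self[OF G] by auto
    thus "\<exists>g h. w = g + h \<and> single g 1 \<in> monomial_ideal k V W" using g by blast
  qed (use p in simp)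
  ultimately show ?thesis by blast
qed

subsection \<open>Restriction to a face\<close>

definition restr :: "(monomial \<Rightarrow> bool) \<Rightarrow> 'k::field mpoly \<Rightarrow> 'k mpoly" where
  "restr T p = (\<Sum>w\<in>{w\<in>keys p. T w}. single w (lookup p w))"

lemma lookup_restr: "lookup (restr T p) w = (if T w then lookup p w else 0)"
  by (auto simp: restr_def lookup_sum lookup_single when_def in_keys_iff sum.delta)

lemma keys_restr: "keys (restr T p) = {w \<in> keys p. T w}"
  by (auto simp: in_keys_iff lookup_restr split: if_splits)

lemma restr_closed: "p \<in> polys k V \<Longrightarrow> restr T p \<in> polys k V"
  by (auto simp: carrier_poly_ring keys_restr)

lemma restr_split: "p = restr T p + restr (\<lambda>w. \<not> T w) p"
  by (rule poly_mapping_eqI) (auto simp: lookup_add lookup_restr)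

text \<open>
  Setting the variables outside \<open>F\<close> to zero.  The result is kept in the same polynomial ring, so that
  restrictions to different faces can be compared and iterated.
\<close>

definition res :: "nat set \<Rightarrow> 'k::field mpoly \<Rightarrow> 'k mpoly" where
  "res F = restr (\<lambda>w. keys w \<subseteq> F)"

lemma lookup_res: "lookup (res F p) w = (if keys w \<subseteq> F then lookup p w else 0)"
  by (simp add: res_def lookup_restr)

lemma keys_res: "keys (res F p) = {w \<in> keys p. keys w \<subseteq> F}"
  by (simp add: res_def keys_restr)

lemma res_add [simp]: "res F (p + q) = res F p + res F q"
  and res_minus [simp]: "res F (p - q) = res F p - res F q"
  and res_zero [simp]: "res F 0 = 0"
  and res_const [simp]: "res F (single 0 c) = single 0 c"
  by (rule poly_mapping_eqI; auto simp: lookup_res lookup_add lookup_minus lookup_single when_def)+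

lemma res_one [simp]: "res F 1 = 1"
  using res_const[of F 1] by simp

lemma res_sum: "res F (sum f A) = (\<Sum>a\<in>A. res F (f a))"
  by (induction A rule: infinite_finite_induct) auto

lemma res_eq_0_iff: "res F p = 0 \<longleftrightarrow> (\<forall>w\<in>keys p. \<not> keys w \<subseteq> F)"
  using keys_eq_empty[of "res F p"] unfolding keys_res by blast

lemma res_eq_self: "(\<And>w. w \<in> keys p \<Longrightarrow> keys w \<subseteq> F) \<Longrightarrow> res F p = p"
  by (rule poly_mapping_eqI) (auto simp: lookup_res in_keys_iff)

lemma res_res [simp]: "res F (res G p) = res (F \<inter> G) p"
  by (rule poly_mapping_eqI) (auto simp: lookup_res)

text \<open>
  Multiplicativity holds because the monomials whose support leaves \<open>F\<close> span an ideal, while those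
  supported in \<open>F\<close> span a subring.
\<close>

lemma res_mult [simp]: "res F (p * q) = res F p * res F q"
proof -
  let ?N = "\<lambda>w. \<not> keys w \<subseteq> F"
  let ?p = "restr ?N p" and ?q = "restr ?N q"
  have z: "res F (a * b) = 0" if "\<And>w. w \<in> keys a \<Longrightarrow> ?N w" for a b :: "'a mpoly"
    unfolding res_eq_0_iff
  proof
    fix w assume "w \<in> keys (a * b)"
    then obtain u v where "w = u + v" "u \<in> keys a" by (rule keys_multE)
    thus "?N w" using that by (simp add: keys_monomial_add)
  qed
  have z': "res F (b * a) = 0" if "\<And>w. w \<in> keys a \<Longrightarrow> ?N w" for a b :: "'a mpoly"
    using z[OF that] by (simp add: mult.commute)
  have "p * q = (res F p + ?p) * (res F q + ?q)"
    using restr_split[of p "\<lambda>w. keys w \<subseteq> F"] restr_split[of q "\<lambda>w. keys w \<subseteq> F"]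
    by (simp add: res_def)
  also have "\<dots> = res F p * res F q + (res F p * ?q + ?p * (res F q + ?q))"
    by (simp add: algebra_simps)
  finally have "res F (p * q) = res F (res F p * res F q)"
    using z[of ?p] z'[of ?q] by (simp add: keys_restr)
  also have "\<dots> = res F p * res F q"
  proof (rule res_eq_self)
    fix w assume "w \<in> keys (res F p * res F q)"
    then obtain u v where "w = u + v" "u \<in> keys (res F p)" "v \<in> keys (res F q)"
      by (rule keys_multE)
    thus "keys w \<subseteq> F" by (simp add: keys_monomial_add keys_res)
  qed
  finally show ?thesis .
qed

lemma res_power [simp]: "res F (p ^ e) = res F p ^ e"
  by (induction e) auto

lemma res_closed: "p \<in> polys k V \<Longrightarrow> res F p \<in> polys k V"
  by (simp add: res_def restr_closed)

text \<open>
  The ideal generated by the variables outside \<open>F\<close>, written as the kernel of the restriction.  It is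
  prime because the ring of all polynomials is a domain.
\<close>

definition face_prime :: "'k::field itself \<Rightarrow> nat set \<Rightarrow> nat set \<Rightarrow> 'k mpoly set" where
  "face_prime k V F = {p \<in> polys k V. res F p = 0}"

lemma face_prime_ideal: "ideal (face_prime k V F) (poly_ring k V)"
  by (rule poly_idealI) (auto simp: face_prime_def intro: poly_closed)

lemma face_prime_prime: "primeideal (face_prime k V F) (poly_ring k V)"
proof (rule primeidealI[OF face_prime_ideal poly_cring])
  have "1 \<notin> face_prime k V F" by (simp add: face_prime_def)
  thus "polys k V \<noteq> face_prime k V F" using poly_one_closed by blast
qed (auto simp: face_prime_def)

subsection \<open>Variables\<close>

definition X :: "nat \<Rightarrow> 'k::field mpoly" where "X v = single (var v) 1"

lemma keys_var [simp]: "keys (var v) = {v}" by (simp add: var_def)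

lemma lookup_var: "lookup (var v) i = (if i = v then 1 else 0)"
  by (simp add: var_def lookup_single when_def)

lemma X_closed: "v \<in> V \<Longrightarrow> X v \<in> polys k V"
  by (simp add: X_def carrier_poly_ring)

lemma keys_X [simp]: "keys (X v :: 'k::field mpoly) = {var v}"
  by (simp add: X_def)

lemma res_X: "res F (X v) = (if v \<in> F then X v else 0)"
  by (cases "v \<in> F") (auto simp: res_eq_0_iff intro!: res_eq_self)

lemma X_nonzero [simp]: "X v \<noteq> (0 :: 'k::field mpoly)"
  using keys_X[of v] by (metis insert_not_empty keys_zero)

lemma X_power: "X v ^ e = (single (single v e) 1 :: 'k::field mpoly)"
proof (induction e)
  case (Suc e)
  have "X v ^ Suc e = single (var v + single v e) (1 :: 'k)"
    using Suc by (simp add: X_def mult_single)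
  thus ?case by (simp add: var_def single_add[symmetric])
qed simp

lemma divide_by_X_power:
  assumes "p \<in> polys k V" and "\<And>w. w \<in> keys p \<Longrightarrow> e \<le> lookup w v"
  shows "\<exists>q\<in>polys k V. p = X v ^ e * q"
  unfolding X_power using assms
  by (intro divide_by_monomial) (auto simp: monomial_le_iff lookup_single when_def)

lemma res_Compl_var_eq_0: "res (- {v}) p = 0 \<longleftrightarrow> (\<forall>w\<in>keys p. 1 \<le> lookup w v)"
  by (auto simp: res_eq_0_iff in_keys_iff subset_iff Suc_le_eq)

section \<open>Dimension\<close>

text \<open>
  Power products of a list of polynomials.  Exponents are lists of the same length, so that an
  induction can split off one polynomial together with its exponent.
\<close>

fun mon :: "'k::field mpoly list \<Rightarrow> nat list \<Rightarrow> 'k mpoly" where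
  "mon (y # ys) (e # es) = y ^ e * mon ys es"
| "mon _ _ = 1"

lemma mon_closed: "set ys \<subseteq> polys k V \<Longrightarrow> mon ys a \<in> polys k V"
  by (induction ys a rule: mon.induct) (auto intro: poly_mult_closed poly_power_closed poly_one_closed)

lemma poly_prod_closed:
  "(\<And>a. a \<in> A \<Longrightarrow> f a \<in> polys k V) \<Longrightarrow> prod f A \<in> polys k V"
  by (induction A rule: infinite_finite_induct) (auto intro: poly_mult_closed poly_one_closed)

text \<open>
  Elements chosen from the successive gaps of a chain of primes satisfy no polynomial relation.  Given
  a relation in \<open>Q 0\<close>, divide by the lowest power of the first element \<open>y\<close> that occurs, which is allowed as
  \<open>y \<notin> Q 0\<close>.  The quotient lies in \<open>Q 1\<close>, and so do its terms that still contain \<open>y\<close>; the other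
  terms form a relation in \<open>Q 1\<close> between the remaining elements.
\<close>

lemma algebraically_independent_over_chain:
  assumes "set ys \<subseteq> polys k V"
    and "\<And>i. i \<le> length ys \<Longrightarrow> primeideal (Q i) (poly_ring k V)"
    and "\<And>i. i < length ys \<Longrightarrow> Q i \<subseteq> Q (Suc i) \<and> ys ! i \<in> Q (Suc i) \<and> ys ! i \<notin> Q i"
    and "finite A" and "\<And>a. a \<in> A \<Longrightarrow> length a = length ys"
    and "(\<Sum>a\<in>A. single 0 (c a) * mon ys a) \<in> Q 0"
  shows "\<forall>a\<in>A. c a = 0"
  using assms
proof (induction ys arbitrary: Q A c)
  case Nil
  show ?case
  proof
    fix a assume a: "a \<in> A"
    have "b = []" if "b \<in> A" for b using Nil.prems(5)[OF that] by simp
    then have A: "A = {[]}" and a': "a = []" using a by auto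
    note Q = poly_primeD[OF Nil.prems(2)[of 0]] 
    have "single 0 (c []) \<in> Q 0" using Nil.prems(6) A by simp
    then have "single 0 (inverse (c [])) * single 0 (c []) \<in> Q 0"
      using poly_idealD(4)[OF Q(1) poly_const_closed] by simp
    then show "c a = 0" using Q(2) a' by (cases "c [] = 0") (auto simp: mult_single)
  qed
next
  case (Cons y ys)
  show ?case
  proof (rule ccontr)
    assume "\<not> (\<forall>a\<in>A. c a = 0)"
    define A' where "A' = {a \<in> A. c a \<noteq> 0}"
    have A': "A' \<noteq> {}" "finite A'" using \<open>\<not> _\<close> Cons.prems(4) by (auto simp: A'_def)
    define e where "e = Min (hd ` A')"
    have e: "e \<le> hd a" if "a \<in> A'" for a using that A' by (auto simp: e_def)
    have "e \<in> hd ` A'" unfolding e_def using A' by (intro Min_in) auto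
    define B where "B = {a \<in> A'. hd a = e}"
    have B: "B \<noteq> {}" "finite B" using \<open>e \<in> _\<close> A' by (auto simp: B_def)
    have cons: "a = hd a # tl a" if "a \<in> A'" for a
      using that Cons.prems(5)[of a] by (cases a) (auto simp: A'_def)
    note Q0 = poly_primeD[OF Cons.prems(2)[of 0, simplified]]
    have "primeideal (Q 1) (poly_ring k V)" using Cons.prems(2)[of 1] by simp
    note Q1 = poly_primeD[OF this]
    have y: "y \<in> polys k V" "y \<notin> Q 0" "y \<in> Q 1" "Q 0 \<subseteq> Q 1"
      and ys: "set ys \<subseteq> polys k V"
      using Cons.prems(1) Cons.prems(3)[of 0] by auto
    let ?t = "\<lambda>a. single 0 (c a) * (y ^ (hd a - e) * mon ys (tl a))"
    have tc: "?t a \<in> polys k V" for a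
      using y ys by (intro poly_mult_closed poly_power_closed mon_closed poly_const_closed)
    have "(\<Sum>a\<in>A. single 0 (c a) * mon (y # ys) a)
        = (\<Sum>a\<in>A'. single 0 (c a) * mon (y # ys) a)"
      using Cons.prems(4) by (intro sum.mono_neutral_right) (auto simp: A'_def)
    also have "\<dots> = (\<Sum>a\<in>A'. y ^ e * ?t a)"
    proof (rule sum.cong)
      fix a assume a: "a \<in> A'"
      have "mon (y # ys) a = mon (y # ys) (hd a # tl a)" using cons[OF a] by metis
      also have "\<dots> = y ^ (e + (hd a - e)) * mon ys (tl a)" using e[OF a] by simp
      finally show "single 0 (c a) * mon (y # ys) a = y ^ e * ?t a"
        by (simp add: power_add mult_ac)
    qed simp
    also have "\<dots> = y ^ e * (\<Sum>a\<in>A'. ?t a)" by (simp add: sum_distrib_left)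
    finally have "y ^ e * (\<Sum>a\<in>A'. ?t a) \<in> Q 0" using Cons.prems(6) by simp
    then have "(\<Sum>a\<in>A'. ?t a) \<in> Q 0"
      using Q0(3)[of "y ^ e" "\<Sum>a\<in>A'. ?t a"] Q0(4)[of y e] y poly_power_closed[OF y(1)]
        poly_sum_closed[of A' ?t k V] tc by blast
    then have T: "(\<Sum>a\<in>A'. ?t a) \<in> Q 1" using y by auto
    have "(\<Sum>a\<in>A' - B. ?t a) \<in> Q 1"
    proof (intro poly_ideal_sum[OF Q1(1)])
      fix a assume "a \<in> A' - B"
      then have "e < hd a" using e[of a] by (auto simp: B_def)
      then obtain m where m: "hd a - e = Suc m" by (metis Suc_diff_Suc)
      have "?t a = (single 0 (c a) * (y ^ m * mon ys (tl a))) * y"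
        unfolding m by (simp add: mult_ac)
      moreover have "single 0 (c a) * (y ^ m * mon ys (tl a)) \<in> polys k V"
        using y ys by (intro poly_mult_closed poly_power_closed mon_closed poly_const_closed)
      ultimately show "?t a \<in> Q 1" using poly_idealD(4)[OF Q1(1) _ y(3)] by metis
    qed
    from poly_idealD(6)[OF Q1(1) T this] have "(\<Sum>a\<in>B. ?t a) \<in> Q 1"
      using sum.subset_diff[of B A' ?t] A' by (simp add: B_def)
    also have "(\<Sum>a\<in>B. ?t a) = (\<Sum>b\<in>tl ` B. single 0 (c (e # b)) * mon ys b)"
    proof (subst sum.reindex)
      show inj: "inj_on tl B"
        using cons by (intro inj_onI) (metis (mono_tags, lifting) B_def mem_Collect_eq)
      show "sum ?t B = sum ((\<lambda>b. single 0 (c (e # b)) * mon ys b) \<circ> tl) B"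
      proof (rule sum.cong)
        fix a assume "a \<in> B"
        then have "hd a = e" "a = e # tl a" using cons[of a] by (auto simp: B_def)
        thus "?t a = ((\<lambda>b. single 0 (c (e # b)) * mon ys b) \<circ> tl) a"
          by simp
      qed simp
    qed
    finally have S: "(\<Sum>b\<in>tl ` B. single 0 (c (e # b)) * mon ys b) \<in> Q (Suc 0)" by simp
    have "\<forall>b\<in>tl ` B. c (e # b) = 0"
    proof (rule Cons.IH[of "\<lambda>i. Q (Suc i)"])
      show "\<And>b. b \<in> tl ` B \<Longrightarrow> length b = length ys"
        using Cons.prems(5) by (auto simp: B_def A'_def)
      show "Q (Suc i) \<subseteq> Q (Suc (Suc i)) \<and> ys ! i \<in> Q (Suc (Suc i)) \<and> ys ! i \<notin> Q (Suc i)"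
        if "i < length ys" for i
        using Cons.prems(3)[of "Suc i"] that by simp
    qed (use ys B S Cons.prems(2) in auto)
    moreover obtain a where "a \<in> B" using B by auto
    moreover have "a = e # tl a" using \<open>a \<in> B\<close> cons[of a] by (auto simp: B_def)
    ultimately show False by (auto simp: B_def A'_def)
  qed
qed

text \<open>
  Gaussian elimination: one monomial is cleared at a time by subtracting multiples of a polynomial in
  which it occurs.
\<close>

lemma linear_dependence:
  assumes "finite W" "finite B" "card W < card B"
    and "\<And>b. b \<in> B \<Longrightarrow> keys (f b :: 'k::field mpoly) \<subseteq> W"
  shows "\<exists>c. (\<exists>b\<in>B. c b \<noteq> 0) \<and> (\<Sum>b\<in>B. single 0 (c b) * f b) = 0"
  using assms
proof (induction W arbitrary: B f rule: finite_induct)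
  case empty
  then have "B \<noteq> {}" by auto
  moreover have "f b = 0" if "b \<in> B" for b using empty(3)[OF that] by simp
  ultimately show ?case by (intro exI[of _ "\<lambda>_. 1"]) auto
next
  case (insert w W)
  show ?case
  proof (cases "\<forall>b\<in>B. lookup (f b) w = 0")
    case True
    have "keys (f b) \<subseteq> W" if b: "b \<in> B" for b
    proof -
      have "w \<notin> keys (f b)" using True b by (simp add: in_keys_iff)
      thus ?thesis using insert.prems(3)[OF b] by auto
    qed
    thus ?thesis using insert by (intro insert.IH) auto
  next
    case False
    then obtain b0 where b0: "b0 \<in> B" "lookup (f b0) w \<noteq> 0" by auto
    define r where "r b = lookup (f b) w / lookup (f b0) w" for b
    define g where "g b = f b - single 0 (r b) * f b0" for b
    have lk: "lookup (single 0 a * p) v = a * lookup p v"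
      for a :: 'k and p :: "'k mpoly" and v
      by (simp add: mult_map_scale_conv_mult[symmetric] map.rep_eq when_def)
    have "\<exists>c. (\<exists>b\<in>B - {b0}. c b \<noteq> 0) \<and> (\<Sum>b\<in>B - {b0}. single 0 (c b) * g b) = 0"
    proof (rule insert.IH)
      show "card W < card (B - {b0})" using insert b0 by auto
      fix b assume b: "b \<in> B - {b0}"
      show "keys (g b) \<subseteq> W"
      proof
        fix v assume v: "v \<in> keys (g b)"
        then have "v \<in> keys (f b) \<or> v \<in> keys (f b0)"
          by (auto simp: in_keys_iff g_def lookup_minus lk)
        moreover have "v \<noteq> w" using v b0 by (auto simp: in_keys_iff g_def lookup_minus lk r_def)
        ultimately show "v \<in> W" using insert.prems(3) b b0 by blast
      qed
    qed (use insert in auto)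
    then obtain c where c: "\<exists>b\<in>B - {b0}. c b \<noteq> 0"
      "(\<Sum>b\<in>B - {b0}. single 0 (c b) * g b) = 0" by auto
    let ?c = "c(b0 := - (\<Sum>b\<in>B - {b0}. c b * r b))"
    have ss: "single 0 (\<Sum>b\<in>D. h b) = (\<Sum>b\<in>D. single 0 (h b) :: 'k mpoly)" for D h
      by (induction D rule: infinite_finite_induct) (auto simp: single_add)
    have "(\<Sum>b\<in>B. single 0 (?c b) * f b)
        = single 0 (?c b0) * f b0 + (\<Sum>b\<in>B - {b0}. single 0 (?c b) * f b)"
      using b0 insert.prems by (subst sum.remove[of _ b0]) auto
    also have "(\<Sum>b\<in>B - {b0}. single 0 (?c b) * f b)
        = (\<Sum>b\<in>B - {b0}. single 0 (c b) * g b + single 0 (c b * r b) * f b0)"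
      by (intro sum.cong) (auto simp: g_def algebra_simps mult_single)
    also have "\<dots> = (\<Sum>b\<in>B - {b0}. single 0 (c b * r b)) * f b0"
      using c by (simp add: sum.distrib sum_distrib_right)
    finally have "(\<Sum>b\<in>B. single 0 (?c b) * f b) = 0"
      by (simp add: ss single_uminus)
    moreover have "\<exists>b\<in>B. ?c b \<noteq> 0" using c(1) by auto
    ultimately show ?thesis by blast
  qed
qed

text \<open>
  Bounding each exponent separately, rather than the total degree, makes the counts below plain
  powers.
\<close>

definition box :: "nat set \<Rightarrow> nat \<Rightarrow> monomial set" where
  "box F m = {w. keys w \<subseteq> F \<and> (\<forall>i. lookup w i \<le> m)}"

lemma finite_card_box:
  assumes "finite F" shows "finite (box F m)" "card (box F m) \<le> (m + 1) ^ card F"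
proof -
  let ?f = "\<lambda>w. restrict (lookup w) F"
  have inj: "inj_on ?f (box F m)"
  proof (rule inj_onI)
    fix v w assume "v \<in> box F m" "w \<in> box F m" and e: "?f v = ?f w"
    show "v = w"
    proof (rule poly_mapping_eqI)
      fix i
      show "lookup v i = lookup w i"
      proof (cases "i \<in> F")
        case True thus ?thesis using fun_cong[OF e, of i] by simp
      next
        case False
        then have "i \<notin> keys v" "i \<notin> keys w"
          using \<open>v \<in> _\<close> \<open>w \<in> _\<close> by (auto simp: box_def)
        thus ?thesis by (simp add: in_keys_iff)
      qed
    qed
  qed
  have sub: "?f ` box F m \<subseteq> (\<Pi>\<^sub>E i\<in>F. {..m})" by (auto simp: box_def)
  have fin: "finite (\<Pi>\<^sub>E i\<in>F. {..m})" using assms by (intro finite_PiE) auto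
  show "finite (box F m)" using inj sub fin by (metis finite_imageD finite_subset)
  have "card (box F m) = card (?f ` box F m)" using inj by (simp add: card_image)
  also have "\<dots> \<le> card (\<Pi>\<^sub>E i\<in>F. {..m})" by (rule card_mono[OF fin sub])
  also have "\<dots> = (m + 1) ^ card F" using assms by (simp add: card_PiE)
  finally show "card (box F m) \<le> (m + 1) ^ card F" .
qed

lemma box_mult:
  "keys p \<subseteq> box F m \<Longrightarrow> keys q \<subseteq> box F m' \<Longrightarrow>
    keys (p * q) \<subseteq> box F (m + m')"
  by (auto elim!: keys_multE simp: box_def keys_monomial_add lookup_add subset_iff intro!: add_mono)

lemma box_power: "keys p \<subseteq> box F m \<Longrightarrow> keys (p ^ e) \<subseteq> box F (e * m)"
proof (induction e)
  case (Suc e) thus ?case using box_mult[of p F m "p ^ e" "e * m"] by simp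
qed (simp add: box_def)

lemma box_mono: "m \<le> m' \<Longrightarrow> box F m \<subseteq> box F m'"
  by (auto simp: box_def intro: order.trans)

lemma box_mon:
  "\<forall>y\<in>set ys. keys y \<subseteq> box F E \<Longrightarrow> set a \<subseteq> {..N} \<Longrightarrow>
    keys (mon ys a) \<subseteq> box F (length ys * (N * E))"
proof (induction ys a rule: mon.induct)
  case (1 y ys e es)
  have "keys (y ^ e) \<subseteq> box F (e * E)" using 1 by (intro box_power) auto
  also have "\<dots> \<subseteq> box F (N * E)" using 1 by (intro box_mono mult_right_mono) auto
  finally show ?case using 1 box_mult[of "y ^ e" F "N * E" "mon ys es"] by simp
qed (auto simp: box_def)

lemma box_exists:
  assumes "finite Y" and "\<And>y. y \<in> Y \<Longrightarrow> \<forall>w\<in>keys y. keys w \<subseteq> F"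
  shows "\<exists>E. \<forall>y\<in>Y. keys (y :: 'k::field mpoly) \<subseteq> box F E"
proof -
  let ?S = "\<Union>y\<in>Y. \<Union>w\<in>keys y. lookup w ` keys w"
  have fin: "finite ?S" using assms(1) by auto
  have "lookup w i \<le> Max (insert 0 ?S)" if "y \<in> Y" "w \<in> keys y" for y w i
  proof (cases "i \<in> keys w")
    case True
    then have "lookup w i \<in> insert 0 ?S" using that by blast
    thus ?thesis using fin by (intro Max_ge) auto
  qed (simp add: in_keys_iff)
  then have "\<forall>y\<in>Y. keys y \<subseteq> box F (Max (insert 0 ?S))"
    using assms(2) by (fastforce simp: box_def)
  thus ?thesis by blast
qed

text \<open>
  Let \<open>F\<close> be the set of variables outside the smallest prime \<open>Q 0\<close>.  It is a face, since the product
  of its variables is not in \<open>Q 0\<close>; and modulo \<open>Q 0\<close> each polynomial agrees with its restriction to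
  \<open>F\<close>.  A chain with more than \<open>d\<close> steps therefore yields \<open>d + 1\<close> algebraically independent
  polynomials in at most \<open>d\<close> variables.  Their power products with exponents up to \<open>N\<close> number
  \<open>(N + 1)\<^sup>d\<^sup>+\<^sup>1\<close>, but they involve only \<open>O(N\<^sup>d)\<close> monomials, so for large \<open>N\<close> they are linearly
  dependent, a contradiction.
\<close>

lemma prime_chain_length_le:
  assumes V: "finite V" and c: "simplicial_complex V \<Delta>"
    and d: "\<And>F. F \<in> \<Delta> \<Longrightarrow> card F \<le> d"
    and Q: "prime_chain (poly_ring k V) l Q"
    and I: "\<And>F. F \<subseteq> V \<Longrightarrow> F \<notin> \<Delta> \<Longrightarrow> (\<Prod>v\<in>F. X v) \<in> Q 0"
  shows "l \<le> d"
proof (rule ccontr)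
  assume "\<not> l \<le> d"
  have Qp: "primeideal (Q i) (poly_ring k V)" if "i \<le> d + 1" for i
    using Q that \<open>\<not> l \<le> d\<close> by (auto simp: prime_chain_def)
  have Qs: "Q i \<subset> Q (Suc i)" if "i \<le> d" for i
    using Q that \<open>\<not> l \<le> d\<close> by (auto simp: prime_chain_def)
  have Q0i: "i \<le> d + 1 \<Longrightarrow> Q 0 \<subseteq> Q i" for i
  proof (induction i)
    case (Suc i) thus ?case using Qs[of i] by auto
  qed simp
  note P0 = poly_primeD[OF Qp[of 0, simplified]]
  define F where "F = {v \<in> V. X v \<notin> Q 0}"
  have pr: "(\<Prod>v\<in>G. X v) \<in> Q 0 \<Longrightarrow> \<exists>v\<in>G. X v \<in> Q 0" if "G \<subseteq> V" for G
    using finite_subset[OF that V] that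
  proof (induction G rule: finite_induct)
    case empty thus ?case using P0(2) by simp
  next
    case (insert v G)
    have "(\<Prod>v\<in>G. X v) \<in> polys k V"
      using insert.prems(2) by (intro poly_prod_closed X_closed) auto
    thus ?case using insert P0(3)[of "X v" "\<Prod>v\<in>G. X v"] X_closed[of v V] by auto
  qed
  have "F \<in> \<Delta>" using I[of F] pr[of F] by (auto simp: F_def)
  have finF: "finite F" using V by (simp add: F_def)
  have resQ: "p - res F p \<in> Q 0" if p: "p \<in> polys k V" for p
  proof (rule poly_mem_idealI[OF P0(1)])
    show "p - res F p \<in> polys k V" using p by (intro poly_minus_closed res_closed)
    fix w assume "w \<in> keys (p - res F p)"
    then have w: "w \<in> keys p" "\<not> keys w \<subseteq> F"
      by (auto simp: in_keys_iff lookup_minus lookup_res split: if_splits)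
    then obtain v where v: "v \<in> keys w" "v \<notin> F" by auto
    then have "X v \<in> Q 0" using p w by (auto simp: F_def carrier_poly_ring)
    moreover have "w = var v + (w - var v)"
      using v by (intro monomial_split) (auto simp: lookup_var in_keys_iff)
    ultimately show "\<exists>g h. w = g + h \<and> single g 1 \<in> Q 0"
      unfolding X_def by blast
  qed
  have "\<exists>y\<in>polys k V. y \<in> Q (Suc i) \<and> y \<notin> Q i \<and> res F y = y" if id: "i \<le> d" for i
  proof -
    obtain y where y: "y \<in> Q (Suc i)" "y \<notin> Q i" using Qs[OF id] by auto
    note A = poly_primeD(1)[OF Qp[of i]] and B = poly_primeD(1)[OF Qp[of "Suc i"]]
    have yc: "y \<in> polys k V" using poly_idealD(1)[OF B y(1)] id by simp
    have r: "y - res F y \<in> Q i" "y - res F y \<in> Q (Suc i)" 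
      using resQ[OF yc] Q0i[of i] Q0i[of "Suc i"] id by auto
    have "res F y \<in> Q (Suc i)" using poly_idealD(6)[OF B y(1) r(2)] id by simp
    moreover have "res F y \<notin> Q i" using poly_idealD(3)[OF A r(1), of "res F y"] y(2) id by auto
    ultimately have "res F y \<in> Q (Suc i)" "res F y \<notin> Q i" by auto
    thus ?thesis using res_closed[OF yc] by (intro bexI[of _ "res F y"]) auto
  qed
  then obtain y where y: "\<And>i. i \<le> d \<Longrightarrow> y i \<in> polys k V"
    "\<And>i. i \<le> d \<Longrightarrow> y i \<in> Q (Suc i)" "\<And>i. i \<le> d \<Longrightarrow> y i \<notin> Q i" "\<And>i. i \<le> d \<Longrightarrow> res F (y i) = y i"
    by metis
  define ys where "ys = map y [0..<d+1]"
  have "\<exists>E. \<forall>y\<in>set ys. keys y \<subseteq> box F E"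
  proof (rule box_exists)
    fix z assume "z \<in> set ys"
    then have "res F z = z" using y(4) by (auto simp: ys_def)
    then have "keys z = keys (res F z)" by simp
    thus "\<forall>w\<in>keys z. keys w \<subseteq> F" unfolding keys_res by blast
  qed simp
  then obtain E where E: "\<forall>y\<in>set ys. keys y \<subseteq> box F E" by auto
  \<comment> \<open>With \<open>m + 1 \<le> C (N + 1)\<close>, the choice \<open>N = C\<^sup>d\<close> makes \<open>(m + 1)\<^sup>d\<close> smaller than \<open>(N + 1)\<^sup>d\<^sup>+\<^sup>1\<close>.\<close>
  define C where "C = (d + 1) * E + 1"
  define N where "N = C ^ d"
  define B where "B = {a. set a \<subseteq> {..N} \<and> length a = d + 1}"
  define m where "m = (d + 1) * (N * E)"
  have "card (box F m) \<le> (m + 1) ^ card F" by (rule finite_card_box[OF finF])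
  also have "\<dots> \<le> (m + 1) ^ d" using d[OF \<open>F \<in> \<Delta>\<close>] by (intro power_increasing) auto
  also have "\<dots> \<le> (C * (N + 1)) ^ d" by (intro power_mono) (auto simp: m_def C_def algebra_simps)
  also have "\<dots> = N * (N + 1) ^ d" unfolding power_mult_distrib N_def ..
  also have "\<dots> < (N + 1) ^ (d + 1)" by simp
  also have "\<dots> = card B" by (simp add: B_def card_lists_length_eq)
  finally have "card (box F m) < card B" .
  moreover have "finite B" unfolding B_def by (intro finite_lists_length_eq) auto
  moreover have "keys (mon ys a) \<subseteq> box F m" if "a \<in> B" for a
    using box_mon[OF E, of a N] that by (simp add: B_def ys_def m_def)
  ultimately obtain c where c: "\<exists>b\<in>B. c b \<noteq> 0" "(\<Sum>b\<in>B. single 0 (c b) * mon ys b) = 0"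
    using linear_dependence[OF finite_card_box(1)[OF finF], of B m "mon ys"] by auto
  have "\<forall>a\<in>B. c a = 0"
  proof (rule algebraically_independent_over_chain)
    show "set ys \<subseteq> polys k V" using y by (auto simp: ys_def)
    show "Q i \<subseteq> Q (Suc i) \<and> ys ! i \<in> Q (Suc i) \<and> ys ! i \<notin> Q i" if "i < length ys" for i
      using that y(2,3)[of i] Qs[of i] by (auto simp: ys_def simp del: upt_Suc)
    show "(\<Sum>b\<in>B. single 0 (c b) * mon ys b) \<in> Q 0" using c poly_idealD(2)[OF P0(1)] by simp
  qed (use Qp \<open>finite B\<close> in \<open>auto simp: ys_def B_def\<close>)
  thus False using c by auto
qed

lemma face_prime_chain:
  assumes "set vs \<subseteq> V" "distinct vs"
  shows "prime_chain (poly_ring k V) (length vs) (\<lambda>i. face_prime k V (set (drop i vs)))"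
  unfolding prime_chain_def
proof (intro conjI allI impI face_prime_prime)
  fix i assume i: "i < length vs"
  have s: "set (drop i vs) = insert (vs ! i) (set (drop (Suc i) vs))"
    using i by (metis Cons_nth_drop_Suc list.simps(15))
  have n: "vs ! i \<notin> set (drop (Suc i) vs)"
    using distinct_drop[OF assms(2), of i] i by (simp add: Cons_nth_drop_Suc[symmetric])
  have "vs ! i \<in> V" using i assms(1) by auto
  then have "X (vs ! i) \<in> face_prime k V (set (drop (Suc i) vs))"
    "X (vs ! i) \<notin> face_prime k V (set (drop i vs))"
    using s n by (auto simp: face_prime_def res_X X_closed)
  moreover have "face_prime k V (set (drop i vs)) \<subseteq> face_prime k V (set (drop (Suc i) vs))"
    using s by (auto simp: face_prime_def res_eq_0_iff)
  ultimately show "face_prime k V (set (drop i vs)) \<subset> face_prime k V (set (drop (Suc i) vs))" by blast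
qed

section \<open>Stanley-Reisner rings\<close>

lemma lookup_sum_var: "finite F \<Longrightarrow> lookup (\<Sum>i\<in>F. var i) v = (if v \<in> F then 1 else 0)"
  by (simp add: lookup_sum lookup_var)

lemma keys_sum_var: "finite F \<Longrightarrow> keys (\<Sum>i\<in>F. var i) = F"
  by (auto simp: in_keys_iff lookup_sum_var split: if_splits)

lemma sum_var_le_iff:
  "finite F \<Longrightarrow> (\<exists>h. w = (\<Sum>i\<in>F. var i) + h) \<longleftrightarrow> F \<subseteq> keys w"
  by (auto simp: monomial_le_iff lookup_sum_var in_keys_iff Suc_le_eq)

lemma prod_X: "(\<Prod>v\<in>F. X v) = (single (\<Sum>i\<in>F. var i) 1 :: 'k::field mpoly)"
  by (induction F rule: infinite_finite_induct) (auto simp: X_def mult_single)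

locale complex =
  fixes k :: "'k::field itself" and V :: "nat set" and \<Delta> :: "nat set set"
  assumes complex: "simplicial_complex V \<Delta>"
begin

abbreviation "R \<equiv> poly_ring k V"
abbreviation "I \<equiv> sr_ideal k V \<Delta>"
abbreviation "A \<equiv> sr_ring k V \<Delta>"
abbreviation "M \<equiv> face_prime k V {}"

sublocale R: cring R by (rule poly_cring)

lemma finV: "finite V" and faceV: "F \<in> \<Delta> \<Longrightarrow> F \<subseteq> V" and empty_face: "{} \<in> \<Delta>"
  and down: "F \<in> \<Delta> \<Longrightarrow> G \<subseteq> F \<Longrightarrow> G \<in> \<Delta>"
  using complex by (auto simp: simplicial_complex_def)

lemma finite_face: "F \<in> \<Delta> \<Longrightarrow> finite F" by (rule finite_subset[OF faceV finV])

lemma finite_complex: "finite \<Delta>"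
  using faceV by (intro finite_subset[of \<Delta> "Pow V"]) (auto simp: finV)

lemma sr_ideal_iff_keys: "p \<in> I \<longleftrightarrow> p \<in> carrier R \<and> (\<forall>w\<in>keys p. keys w \<notin> \<Delta>)"
proof -
  have fin: "F \<subseteq> V \<Longrightarrow> finite F" for F using finV finite_subset by auto
  have "(\<exists>g\<in>{\<Sum>i\<in>F. var i |F. F \<subseteq> V \<and> F \<notin> \<Delta>}. \<exists>h. w = g + h) \<longleftrightarrow> keys w \<notin> \<Delta>"
    if w: "keys w \<subseteq> V" for w
  proof -
    have "(\<exists>g\<in>{\<Sum>i\<in>F. var i |F. F \<subseteq> V \<and> F \<notin> \<Delta>}. \<exists>h. w = g + h) \<longleftrightarrow>
        (\<exists>F. F \<subseteq> V \<and> F \<notin> \<Delta> \<and> (\<exists>h. w = (\<Sum>i\<in>F. var i) + h))" by blast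
    also have "\<dots> \<longleftrightarrow> (\<exists>F. F \<subseteq> V \<and> F \<notin> \<Delta> \<and> F \<subseteq> keys w)"
      by (intro ex_cong1 conj_cong refl sum_var_le_iff fin)
    also have "\<dots> \<longleftrightarrow> keys w \<notin> \<Delta>" using w down by blast
    finally show ?thesis .
  qed
  moreover have "p \<in> I \<longleftrightarrow> p \<in> carrier R \<and>
      (\<forall>w\<in>keys p. \<exists>g\<in>{\<Sum>i\<in>F. var i |F. F \<subseteq> V \<and> F \<notin> \<Delta>}. \<exists>h. w = g + h)"
    unfolding sr_ideal_def
    by (rule monomial_ideal_iff) (use fin in \<open>auto simp: keys_sum_var\<close>)
  ultimately show ?thesis unfolding carrier_poly_ring by blast
qed

text \<open>
  The map \<open>p \<mapsto> (res F p)\<^sub>F\<close> embeds the Stanley-Reisner ring into a product of polynomial rings.  This is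
  the form in which the ideal is used from here on.
\<close>

lemma sr_ideal_iff: "p \<in> I \<longleftrightarrow> p \<in> carrier R \<and> (\<forall>F\<in>\<Delta>. res F p = 0)"
  unfolding sr_ideal_iff_keys res_eq_0_iff using down by blast

lemma sr_ideal_ideal: "ideal I R"
  by (rule poly_idealI) (auto simp: sr_ideal_iff intro: poly_closed)

lemma sr_ideal_carrier: "p \<in> I \<Longrightarrow> p \<in> carrier R" by (simp add: sr_ideal_iff)

lemma sr_ideal_subset_face_prime: "F \<in> \<Delta> \<Longrightarrow> I \<subseteq> face_prime k V F"
  by (auto simp: face_prime_def sr_ideal_iff)

lemma nonface_monomial: "F \<subseteq> V \<Longrightarrow> F \<notin> \<Delta> \<Longrightarrow> (\<Prod>v\<in>F. X v) \<in> I"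
  using finV finite_subset[of F V] unfolding prod_X sr_ideal_iff_keys
  by (auto simp: carrier_poly_ring keys_sum_var)

sublocale Q: cring A
  unfolding sr_ring_def by (rule ideal.quotient_is_cring[OF sr_ideal_ideal poly_cring])

definition cls :: "'k mpoly \<Rightarrow> 'k mpoly set" where "cls p = I +>\<^bsub>R\<^esub> p"

lemma carrier_A: "carrier A = cls ` carrier R"
  unfolding sr_ring_def cls_def using ideal.carrier_Quot[OF sr_ideal_ideal] .

lemma cls_hom: "cls \<in> ring_hom R A"
  unfolding sr_ring_def cls_def using ideal.rcos_ring_hom[OF sr_ideal_ideal] .

lemma cls_mult: "p \<in> carrier R \<Longrightarrow> q \<in> carrier R \<Longrightarrow> cls p \<otimes>\<^bsub>A\<^esub> cls q = cls (p * q)"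
  using ring_hom_mult[OF cls_hom, of p q] by simp

lemma cls_closed: "p \<in> carrier R \<Longrightarrow> cls p \<in> carrier A" using carrier_A by auto

lemma cls_pow: "p \<in> carrier R \<Longrightarrow> cls p [^]\<^bsub>A\<^esub> (e::nat) = cls (p ^ e)"
proof (induction e)
  case 0 show ?case using ring_hom_one[OF cls_hom] by simp
next
  case (Suc e) thus ?case using cls_mult[of "p ^ e" p] poly_power_closed[of p k V e] by (simp add: mult.commute)
qed

lemma cls_in_Idl: "Y \<subseteq> carrier R \<Longrightarrow> p \<in> carrier R \<Longrightarrow>
    cls p \<in> Idl\<^bsub>A\<^esub> (cls ` Y) \<longleftrightarrow> p \<in> Idl\<^bsub>R\<^esub> (I \<union> Y)"
  unfolding sr_ring_def cls_def by (rule R.Idl_Quot_iff[OF sr_ideal_ideal])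

text \<open>
  Polynomials without constant term; this identifies the graded maximal ideal of the Stanley-Reisner
  ring with the classes of \<open>face_prime k V {}\<close>.
\<close>

lemma ideal_of_variables: "Idl\<^bsub>R\<^esub> (I \<union> X ` V) = M"
proof
  have sub: "I \<union> X ` V \<subseteq> carrier R" using sr_ideal_carrier X_closed by blast
  show "Idl\<^bsub>R\<^esub> (I \<union> X ` V) \<subseteq> M"
    using sr_ideal_subset_face_prime[OF empty_face]
    by (intro R.genideal_minimal face_prime_ideal) (auto simp: face_prime_def X_closed res_X)
  show "M \<subseteq> Idl\<^bsub>R\<^esub> (I \<union> X ` V)"
  proof
    fix p assume p: "p \<in> M"
    show "p \<in> Idl\<^bsub>R\<^esub> (I \<union> X ` V)"
    proof (rule poly_mem_idealI[OF R.genideal_ideal[OF sub]])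
      fix w assume w: "w \<in> keys p"
      have "keys w \<noteq> {}" using p w by (auto simp: face_prime_def res_eq_0_iff)
      then obtain v where v: "v \<in> keys w" by (meson ex_in_conv)
      then have "v \<in> V" using p w by (auto simp: face_prime_def carrier_poly_ring)
      then have "X v \<in> Idl\<^bsub>R\<^esub> (I \<union> X ` V)" using R.genideal_self[OF sub] by auto
      moreover have "w = var v + (w - var v)"
        using v by (intro monomial_split) (auto simp: lookup_var in_keys_iff)
      ultimately show "\<exists>g h. w = g + h \<and> single g 1 \<in> Idl\<^bsub>R\<^esub> (I \<union> X ` V)"
        unfolding X_def by blast
    qed (use p in \<open>simp add: face_prime_def\<close>)
  qed
qed

lemma cls_in_max_iff: "p \<in> carrier R \<Longrightarrow> cls p \<in> sr_max_ideal k V \<Delta> \<longleftrightarrow> p \<in> M"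
proof -
  assume p: "p \<in> carrier R"
  have "sr_max_ideal k V \<Delta> = Idl\<^bsub>A\<^esub> (cls ` X ` V)"
    unfolding sr_max_ideal_def cls_def X_def image_image ..
  moreover have "X ` V \<subseteq> carrier R" using X_closed by (rule image_subsetI)
  ultimately show ?thesis using cls_in_Idl[of "X ` V" p] p ideal_of_variables by simp
qed

lemma sr_max_ideal_prime: "primeideal (sr_max_ideal k V \<Delta>) A"
  and sr_max_ideal_eq: "sr_max_ideal k V \<Delta> = cls ` M"
proof -
  have m: "sr_max_ideal k V \<Delta> = Idl\<^bsub>A\<^esub> (cls ` X ` V)"
    unfolding sr_max_ideal_def cls_def X_def image_image ..
  have "cls ` X ` V \<subseteq> carrier A" using X_closed[of _ V k] cls_closed by blast
  from ideal.Icarr[OF Q.genideal_ideal[OF this]] have "sr_max_ideal k V \<Delta> \<subseteq> carrier A"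
    unfolding m by (rule subsetI)
  then show e: "sr_max_ideal k V \<Delta> = cls ` M"
    using cls_in_max_iff carrier_A by (auto simp: face_prime_def)
  show "primeideal (sr_max_ideal k V \<Delta>) A"
    unfolding e unfolding cls_def sr_ring_def
    by (rule R.Quot_prime_image(1)[OF sr_ideal_ideal face_prime_prime
          sr_ideal_subset_face_prime[OF empty_face]])
qed

lemma sr_prime_chain_le:
  assumes "\<And>F. F \<in> \<Delta> \<Longrightarrow> card F \<le> d" and "prime_chain A l Q"
  shows "l \<le> d"
proof -
  obtain P where P: "prime_chain R l P" "I \<subseteq> P 0"
    using R.Quot_prime_chain_vimage[OF sr_ideal_ideal] assms(2) unfolding sr_ring_def by blast
  show ?thesis
    by (rule prime_chain_length_le[OF finV complex assms(1) P(1)])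
       (use nonface_monomial P(2) in auto)
qed

text \<open>
  Adding the variables of \<open>F\<close> one at a time to the prime of \<open>F\<close> gives a chain that ends in the graded
  maximal ideal.  It therefore survives localization there, which is needed for \<open>krull_dim_loc\<close>.
\<close>

lemma sr_prime_chain_exists:
  assumes "F \<in> \<Delta>"
  shows "\<exists>Q. prime_chain A (card F) Q \<and> (\<forall>i\<le>card F. Q i \<subseteq> sr_max_ideal k V \<Delta>)"
proof -
  obtain vs where vs: "set vs = F" "distinct vs" using finite_face[OF assms] finite_distinct_list by blast
  then have l: "length vs = card F" using distinct_card by fastforce
  have "prime_chain R (length vs) (\<lambda>i. face_prime k V (set (drop i vs)))"
    using face_prime_chain[of vs V k] vs faceV[OF assms] by auto
  then have "prime_chain A (length vs) (\<lambda>i. cls ` face_prime k V (set (drop i vs)))"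
    unfolding sr_ring_def cls_def
    by (rule R.Quot_prime_chain_image[OF sr_ideal_ideal])
       (use sr_ideal_subset_face_prime assms vs in auto)
  moreover have "face_prime k V (set (drop i vs)) \<subseteq> M" for i
    by (auto simp: face_prime_def res_eq_0_iff)
  ultimately show ?thesis unfolding l sr_max_ideal_eq by blast
qed

lemma krull_dim_sr:
  assumes "\<And>F. F \<in> \<Delta> \<Longrightarrow> card F \<le> d" and "F \<in> \<Delta>" "card F = d"
  shows "krull_dim A = enat d"
proof -
  obtain Q where "prime_chain A d Q" using sr_prime_chain_exists[OF assms(2)] assms(3) by auto
  thus ?thesis using sr_prime_chain_le[OF assms(1)] by (rule krull_dim_eqI)
qed

sublocale loc: mult_set A "carrier A - sr_max_ideal k V \<Delta>"
proof
  interpret m: primeideal "sr_max_ideal k V \<Delta>" A by (rule sr_max_ideal_prime)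
  show "\<one>\<^bsub>A\<^esub> \<in> carrier A - sr_max_ideal k V \<Delta>" using m.one_imp_carrier m.I_notcarr by auto
qed (use primeideal.I_prime[OF sr_max_ideal_prime] in auto)

lemma krull_dim_loc:
  assumes "\<And>F. F \<in> \<Delta> \<Longrightarrow> card F \<le> d" and "F \<in> \<Delta>" "card F = d"
  shows "krull_dim loc.Loc = enat d"
proof -
  obtain Q where "prime_chain A d Q" "\<forall>i\<le>d. Q i \<subseteq> sr_max_ideal k V \<Delta>"
    using sr_prime_chain_exists[OF assms(2)] assms(3) by auto
  then have "prime_chain loc.Loc d (\<lambda>i. loc.ext (Q i))" by (intro loc.ext_prime_chain) auto
  thus ?thesis
    using sr_prime_chain_le[OF assms(1)] loc.contr_prime_chain by (blast intro: krull_dim_eqI)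
qed

end

section \<open>Cohen-Macaulay complexes\<close>

lemma poly_Idl_insert_iff:
  assumes "ideal J (poly_ring k V)" "x \<in> polys k V"
  shows "a \<in> Idl\<^bsub>poly_ring k V\<^esub> (insert x J) \<longleftrightarrow> (\<exists>i\<in>J. \<exists>b\<in>polys k V. a = i + b * x)"
  using cring.Idl_insert_iff[OF poly_cring assms, of a] by simp

lemma poly_Idl_insert_ideal:
  assumes "ideal J (poly_ring k V)" "x \<in> polys k V"
  shows "ideal (Idl\<^bsub>poly_ring k V\<^esub> (insert x J)) (poly_ring k V)"
proof -
  interpret R: cring "poly_ring k V" by (rule poly_cring)
  show ?thesis using assms(2) poly_idealD(1)[OF assms(1)] by (intro R.genideal_ideal) auto
qed

text \<open>
  Regular sequences relative to an ideal, by recursion: each element is absorbed into the ideal before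
  the next one is tested.  This is what makes the inductions for cones and gluings work.
\<close>

fun regular_mod :: "'k::field itself \<Rightarrow> nat set \<Rightarrow> 'k mpoly set \<Rightarrow> 'k mpoly list \<Rightarrow> bool" where
  "regular_mod k V J [] \<longleftrightarrow> True"
| "regular_mod k V J (x # xs) \<longleftrightarrow> (\<forall>a\<in>polys k V. x * a \<in> J \<longrightarrow> a \<in> J) \<and>
     regular_mod k V (Idl\<^bsub>poly_ring k V\<^esub> (insert x J)) xs"

lemma regular_mod_nth:
  assumes "ideal J (poly_ring k V)" "set xs \<subseteq> polys k V" "regular_mod k V J xs"
    and "r < length xs" "a \<in> polys k V"
    and "xs ! r * a \<in> Idl\<^bsub>poly_ring k V\<^esub> (J \<union> set (take r xs))"
  shows "a \<in> Idl\<^bsub>poly_ring k V\<^esub> (J \<union> set (take r xs))"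
  using assms
proof (induction xs arbitrary: J r)
  case (Cons x xs)
  interpret R: cring "poly_ring k V" by (rule poly_cring)
  have J: "J \<subseteq> polys k V" using poly_idealD(1)[OF Cons.prems(1)] by auto
  show ?case
  proof (cases r)
    case 0
    then show ?thesis using Cons.prems R.Idl_ideal_eq[OF Cons.prems(1)] by simp
  next
    case (Suc r')
    have "set (take r' xs) \<subseteq> polys k V"
      using Cons.prems(2) set_take_subset[of r' xs] by auto
    then have "Idl\<^bsub>poly_ring k V\<^esub> (J \<union> set (take r (x # xs)))
        = Idl\<^bsub>poly_ring k V\<^esub> (Idl\<^bsub>poly_ring k V\<^esub> (insert x J) \<union> set (take r' xs))"
      using R.Idl_Idl_Un[of "insert x J" "set (take r' xs)"] J Cons.prems(2) Suc by simp
    moreover have "ideal (Idl\<^bsub>poly_ring k V\<^esub> (insert x J)) (poly_ring k V)"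
      using Cons.prems by (intro poly_Idl_insert_ideal) auto
    ultimately show ?thesis
      using Cons.IH[of "Idl\<^bsub>poly_ring k V\<^esub> (insert x J)" r'] Cons.prems Suc by simp
  qed
qed simp

text \<open>
  A regular sequence as long as the dimension suffices, because depth is bounded by dimension.
\<close>

lemma (in complex) cohen_macaulayI:
  assumes "\<And>F. F \<in> \<Delta> \<Longrightarrow> card F \<le> length ps" and "F \<in> \<Delta>" "card F = length ps"
    and M: "set ps \<subseteq> M" and reg: "regular_mod k V I ps"
  shows "cohen_macaulay k V \<Delta>"
proof -
  have psc: "set ps \<subseteq> carrier R" using M by (auto simp: face_prime_def)
  have "regular_sequence A (map cls ps)"
    unfolding regular_sequence_def
  proof (intro conjI allI impI ballI)
    show sub: "set (map cls ps) \<subseteq> carrier A" using psc cls_closed by auto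
    interpret m: primeideal "sr_max_ideal k V \<Delta>" A by (rule sr_max_ideal_prime)
    have "Idl\<^bsub>A\<^esub> (set (map cls ps)) \<subseteq> sr_max_ideal k V \<Delta>"
      using M by (intro Q.genideal_minimal m.is_ideal) (auto simp: sr_max_ideal_eq)
    thus "Idl\<^bsub>A\<^esub> (set (map cls ps)) \<noteq> carrier A"
      using m.I_notcarr m.a_subset by (metis subset_antisym)
    fix r a assume r: "r < length (map cls ps)" and a: "a \<in> carrier A"
      and h: "map cls ps ! r \<otimes>\<^bsub>A\<^esub> a \<in> Idl\<^bsub>A\<^esub> (set (take r (map cls ps)))"
    obtain q where q: "q \<in> carrier R" "a = cls q" using a carrier_A by auto
    have s: "set (take r (map cls ps)) = cls ` set (take r ps)" by (simp add: take_map)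
    have tc: "set (take r ps) \<subseteq> carrier R" using psc set_take_subset[of r ps] by auto
    have pc: "ps ! r \<in> carrier R" using psc r by auto
    have "cls (ps ! r * q) \<in> Idl\<^bsub>A\<^esub> (cls ` set (take r ps))"
      using h r q cls_mult[OF pc q(1)] s by simp
    then have "ps ! r * q \<in> Idl\<^bsub>R\<^esub> (I \<union> set (take r ps))"
      using cls_in_Idl[OF tc poly_mult_closed[OF pc q(1)]] by simp
    then have "q \<in> Idl\<^bsub>R\<^esub> (I \<union> set (take r ps))"
      using r by (intro regular_mod_nth[OF sr_ideal_ideal psc reg _ q(1)]) simp_all
    then show "a \<in> Idl\<^bsub>A\<^esub> (set (take r (map cls ps)))"
      using cls_in_Idl[OF tc q(1)] s q(2) by simp
  qed
  moreover have "set (map cls ps) \<subseteq> sr_max_ideal k V \<Delta>" using M by (auto simp: sr_max_ideal_eq)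
  ultimately have "enat (length (map cls ps)) \<le> depth A (sr_max_ideal k V \<Delta>)"
    unfolding depth_def by (intro Sup_upper) blast
  then have "krull_dim A \<le> depth A (sr_max_ideal k V \<Delta>)"
    using krull_dim_sr[OF assms(1-3)] by simp
  thus ?thesis
    unfolding cohen_macaulay_def cohen_macaulay_graded_def
    using Q.depth_le_krull_dim by (intro antisym)
qed

text \<open>
  The first two elements of a regular sequence are all that is needed to see that a disconnected
  complex is not Cohen-Macaulay.
\<close>

lemma (in complex) cohen_macaulayD:
  assumes cm: "cohen_macaulay k V \<Delta>" and F: "F \<in> \<Delta>" "2 \<le> card F"
  obtains f g where "f \<in> M" "g \<in> M" "\<And>a. a \<in> carrier R \<Longrightarrow> f * a \<in> I \<Longrightarrow> a \<in> I"
    "\<And>a. a \<in> carrier R \<Longrightarrow> g * a \<in> Idl\<^bsub>R\<^esub> (insert f I) \<Longrightarrow> a \<in> Idl\<^bsub>R\<^esub> (insert f I)"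
proof -
  obtain Q where "prime_chain A (card F) Q" using sr_prime_chain_exists[OF F(1)] by auto
  then have "enat (card F) \<le> krull_dim A" by (rule prime_chain_le_krull_dim)
  then have "enat (card F) \<le> depth A (sr_max_ideal k V \<Delta>)"
    using cm by (simp add: cohen_macaulay_def cohen_macaulay_graded_def)
  moreover have "enat 1 < enat (card F)" using F(2) by simp
  ultimately have "enat 1 < depth A (sr_max_ideal k V \<Delta>)" by (rule order.strict_trans2[rotated])
  then obtain xs where xs: "regular_sequence A xs" "set xs \<subseteq> sr_max_ideal k V \<Delta>" "1 < length xs"
    unfolding depth_def less_Sup_iff by auto
  then obtain x y zs where e: "xs = x # y # zs" by (cases xs; cases "tl xs") auto
  have "x \<in> cls ` M" "y \<in> cls ` M" using xs(2) e by (auto simp: sr_max_ideal_eq)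
  then obtain f g where f: "f \<in> M" "x = cls f" and g: "g \<in> M" "y = cls g" by auto
  then have fc: "f \<in> carrier R" and gc: "g \<in> carrier R" by (auto simp: face_prime_def)
  have reg: "\<And>r a. r < length xs \<Longrightarrow> a \<in> carrier A \<Longrightarrow> xs ! r \<otimes>\<^bsub>A\<^esub> a \<in> Idl\<^bsub>A\<^esub> (set (take r xs))
      \<Longrightarrow> a \<in> Idl\<^bsub>A\<^esub> (set (take r xs))"
    using xs(1) unfolding regular_sequence_def by blast
  show thesis
  proof (rule that[OF f(1) g(1)])
    fix a assume a: "a \<in> carrier R"
    have IE: "Idl\<^bsub>R\<^esub> (I \<union> {}) = I" using R.Idl_ideal_eq[OF sr_ideal_ideal] by simp
    show "a \<in> I" if h: "f * a \<in> I"
    proof -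
      have "cls f \<otimes>\<^bsub>A\<^esub> cls a \<in> Idl\<^bsub>A\<^esub> (cls ` {})"
        using cls_in_Idl[of "{}" "f * a"] poly_mult_closed[OF fc a] h IE cls_mult[OF fc a] by simp
      then have "cls a \<in> Idl\<^bsub>A\<^esub> (cls ` {})" using reg[of 0 "cls a"] e f cls_closed[OF a] by simp
      thus ?thesis using cls_in_Idl[of "{}" a] a IE by simp
    qed
    show "a \<in> Idl\<^bsub>R\<^esub> (insert f I)" if h: "g * a \<in> Idl\<^bsub>R\<^esub> (insert f I)"
    proof -
      have "cls g \<otimes>\<^bsub>A\<^esub> cls a \<in> Idl\<^bsub>A\<^esub> (cls ` {f})"
        using cls_in_Idl[of "{f}" "g * a"] poly_mult_closed[OF gc a] h cls_mult[OF gc a] fc by simp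
      then have "cls a \<in> Idl\<^bsub>A\<^esub> (cls ` {f})" using reg[of 1 "cls a"] e f g cls_closed[OF a] by simp
      thus ?thesis using cls_in_Idl[of "{f}" a] a fc by simp
    qed
  qed
qed

subsection \<open>Gluing\<close>

text \<open>
  The depth lemma for \<open>0 \<rightarrow> R/(J\<^sub>1 \<inter> J\<^sub>2) \<rightarrow> R/J\<^sub>1 \<oplus> R/J\<^sub>2 \<rightarrow> R/(J\<^sub>1 + J\<^sub>2) \<rightarrow> 0\<close>: the third module may have
  depth smaller by one, hence \<open>butlast\<close>.  The induction step is the identity
  \<open>(J\<^sub>1 \<inter> J\<^sub>2) + (x) = (J\<^sub>1 + (x)) \<inter> (J\<^sub>2 + (x))\<close>, valid since \<open>x\<close> is a nonzerodivisor modulo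
  \<open>J\<^sub>1 + J\<^sub>2\<close>.
\<close>

lemma regular_mod_Int:
  assumes "ideal J\<^sub>1 (poly_ring k V)" "ideal J\<^sub>2 (poly_ring k V)" "set xs \<subseteq> polys k V"
    and "regular_mod k V J\<^sub>1 xs" "regular_mod k V J\<^sub>2 xs"
    and "ideal K (poly_ring k V)" "K = {a + b | a b. a \<in> J\<^sub>1 \<and> b \<in> J\<^sub>2}"
    and "regular_mod k V K (butlast xs)"
  shows "regular_mod k V (J\<^sub>1 \<inter> J\<^sub>2) xs"
  using assms
proof (induction xs arbitrary: J\<^sub>1 J\<^sub>2 K)
  case (Cons x xs)
  let ?R = "poly_ring k V"
  let ?E = "\<lambda>J. Idl\<^bsub>?R\<^esub> (insert x J)"
  note J1 = Cons.prems(1) and J2 = Cons.prems(2) and K = Cons.prems(6) and Ke = Cons.prems(7)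
  have x: "x \<in> carrier ?R" using Cons.prems(3) by simp
  have J12: "ideal (J\<^sub>1 \<inter> J\<^sub>2) ?R" using ring.i_intersect[OF cring.axioms(1)[OF poly_cring] J1 J2] .
  note E1 = poly_Idl_insert_iff[OF J1 x] and E2 = poly_Idl_insert_iff[OF J2 x]
    and E12 = poly_Idl_insert_iff[OF J12 x] and EK = poly_Idl_insert_iff[OF K x]
  show ?case
  proof (cases "xs = []")
    case True
    then show ?thesis using Cons.prems by auto
  next
    case False
    then have xK: "\<And>a. a \<in> carrier ?R \<Longrightarrow> x * a \<in> K \<Longrightarrow> a \<in> K"
      and rK: "regular_mod k V (?E K) (butlast xs)" using Cons.prems(8) by auto
    have "?E (J\<^sub>1 \<inter> J\<^sub>2) = ?E J\<^sub>1 \<inter> ?E J\<^sub>2"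
    proof (intro equalityI subsetI)
      fix z assume "z \<in> ?E (J\<^sub>1 \<inter> J\<^sub>2)" thus "z \<in> ?E J\<^sub>1 \<inter> ?E J\<^sub>2" unfolding E12 using E1 E2 by blast
    next
      fix z assume "z \<in> ?E J\<^sub>1 \<inter> ?E J\<^sub>2"
      then obtain i a j b where i: "i \<in> J\<^sub>1" "a \<in> carrier ?R" "z = i + a * x"
        and j: "j \<in> J\<^sub>2" "b \<in> carrier ?R" "z = j + b * x" using E1 E2 by blast
      have "x * (a - b) = (- i) + j" using i(3) j(3) by (simp add: algebra_simps)
      also have "\<dots> \<in> K" unfolding Ke using poly_idealD(7)[OF J1 i(1)] j(1) by blast
      finally have "a - b \<in> K" using xK i(2) j(2) poly_minus_closed by blast
      then obtain m n where mn: "m \<in> J\<^sub>1" "n \<in> J\<^sub>2" "a - b = m + n" unfolding Ke by blast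
      have mc: "m \<in> carrier ?R" using poly_idealD(1)[OF J1 mn(1)] .
      have "i + m * x - (j - n * x) = (i + a * x) - (j + b * x) - ((a - b) - (m + n)) * x"
        by (simp add: algebra_simps)
      then have "i + m * x - (j - n * x) = 0"
        unfolding i(3)[symmetric] j(3)[symmetric] mn(3) by simp
      then have "i + m * x = j - n * x" by simp
      moreover have "i + m * x \<in> J\<^sub>1" "j - n * x \<in> J\<^sub>2"
        using poly_idealD(3)[OF J1 i(1) poly_idealD(5)[OF J1 x mn(1)]]
          poly_idealD(6)[OF J2 j(1) poly_idealD(5)[OF J2 x mn(2)]] by auto
      ultimately have "i + m * x \<in> J\<^sub>1 \<inter> J\<^sub>2" by auto
      moreover have "z = (i + m * x) + (a - m) * x" using i(3) by (simp add: algebra_simps)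
      ultimately show "z \<in> ?E (J\<^sub>1 \<inter> J\<^sub>2)" unfolding E12 using poly_minus_closed[OF i(2) mc] by blast
    qed
    moreover have "?E K = {a + b | a b. a \<in> ?E J\<^sub>1 \<and> b \<in> ?E J\<^sub>2}"
    proof (intro equalityI subsetI)
      fix z assume "z \<in> ?E K"
      then obtain c b where c: "c \<in> K" "b \<in> carrier ?R" "z = c + b * x" using EK by blast
      then obtain m n where "m \<in> J\<^sub>1" "n \<in> J\<^sub>2" "c = m + n" using Ke by blast
      with c have h: "m \<in> J\<^sub>1" "n \<in> J\<^sub>2" "b \<in> carrier ?R" "z = (m + n) + b * x" by auto
      then have "m = m + 0 * x" "n + b * x \<in> ?E J\<^sub>2" "z = m + (n + b * x)"
        using E2 by (auto simp: add.assoc)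
      moreover have "m \<in> ?E J\<^sub>1" unfolding E1 using h(1) poly_zero_closed[of k V] by force
      ultimately show "z \<in> {a + b | a b. a \<in> ?E J\<^sub>1 \<and> b \<in> ?E J\<^sub>2}" by blast
    next
      fix z assume "z \<in> {a + b | a b. a \<in> ?E J\<^sub>1 \<and> b \<in> ?E J\<^sub>2}"
      then obtain c d where cd: "c \<in> ?E J\<^sub>1" "d \<in> ?E J\<^sub>2" "z = c + d" by blast
      obtain i a where ia: "i \<in> J\<^sub>1" "a \<in> carrier ?R" "c = i + a * x" using cd(1) E1 by blast
      obtain j b where jb: "j \<in> J\<^sub>2" "b \<in> carrier ?R" "d = j + b * x" using cd(2) E2 by blast
      from ia jb cd(3) have h: "i \<in> J\<^sub>1" "a \<in> carrier ?R" "j \<in> J\<^sub>2" "b \<in> carrier ?R"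
        "z = (i + a * x) + (j + b * x)" by auto
      have "z = (i + j) + (a + b) * x" using h(5) by (simp add: algebra_simps)
      moreover have "i + j \<in> K" unfolding Ke using h by blast
      ultimately show "z \<in> ?E K" unfolding EK using poly_add_closed[OF h(2,4)] by blast
    qed
    ultimately have "regular_mod k V (?E (J\<^sub>1 \<inter> J\<^sub>2)) xs"
      using Cons.IH[of "?E J\<^sub>1" "?E J\<^sub>2" "?E K"] Cons.prems rK
        poly_Idl_insert_ideal[OF J1 x] poly_Idl_insert_ideal[OF J2 x] poly_Idl_insert_ideal[OF K x]
      by simp
    thus ?thesis using Cons.prems(4,5) by auto
  qed
qed simp

subsection \<open>Monomial ideals of families of faces\<close>

text \<open>
  Agrees with the Stanley-Reisner ideal for complexes, but is directly given by its monomials; so unions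
  and intersections of families of faces become intersections and sums of ideals.
\<close>

definition nonface_ideal :: "'k::field itself \<Rightarrow> nat set \<Rightarrow> nat set set \<Rightarrow> 'k mpoly set" where
  "nonface_ideal k V \<Delta> = {p \<in> polys k V. \<forall>w\<in>keys p. keys w \<notin> \<Delta>}"

definition down_closed :: "nat set set \<Rightarrow> bool" where
  "down_closed \<Delta> \<longleftrightarrow> (\<forall>F\<in>\<Delta>. \<forall>G\<subseteq>F. G \<in> \<Delta>)"

lemma nonface_ideal_iff:
  "down_closed \<Delta> \<Longrightarrow> p \<in> nonface_ideal k V \<Delta> \<longleftrightarrow> p \<in> polys k V \<and> (\<forall>F\<in>\<Delta>. res F p = 0)"
  unfolding nonface_ideal_def res_eq_0_iff down_closed_def by blast

lemma nonface_ideal_ideal: "down_closed \<Delta> \<Longrightarrow> ideal (nonface_ideal k V \<Delta>) (poly_ring k V)"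
  by (rule poly_idealI) (auto simp: nonface_ideal_iff intro: poly_closed)

lemma (in complex) sr_ideal_eq_nonface_ideal: "I = nonface_ideal k V \<Delta>"
  unfolding nonface_ideal_def using sr_ideal_iff_keys by blast

lemma nonface_ideal_Int: "nonface_ideal k V \<Delta> \<inter> nonface_ideal k V \<Gamma> = nonface_ideal k V (\<Delta> \<union> \<Gamma>)"
  unfolding nonface_ideal_def by auto

lemma nonface_ideal_sum:
  "nonface_ideal k V (\<Delta> \<inter> \<Gamma>) = {a + b | a b. a \<in> nonface_ideal k V \<Delta> \<and> b \<in> nonface_ideal k V \<Gamma>}"
proof (intro equalityI subsetI)
  fix p assume p: "p \<in> nonface_ideal k V (\<Delta> \<inter> \<Gamma>)"
  let ?T = "\<lambda>w. keys w \<notin> \<Delta>"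
  have "restr ?T p \<in> nonface_ideal k V \<Delta>" "restr (\<lambda>w. \<not> ?T w) p \<in> nonface_ideal k V \<Gamma>"
    using p by (auto simp: nonface_ideal_def keys_restr restr_closed)
  thus "p \<in> {a + b | a b. a \<in> nonface_ideal k V \<Delta> \<and> b \<in> nonface_ideal k V \<Gamma>}"
    using restr_split[of p ?T] by blast
next
  fix p assume "p \<in> {a + b | a b. a \<in> nonface_ideal k V \<Delta> \<and> b \<in> nonface_ideal k V \<Gamma>}"
  then obtain a b where h: "a \<in> nonface_ideal k V \<Delta>" "b \<in> nonface_ideal k V \<Gamma>" "p = a + b" by blast
  thus "p \<in> nonface_ideal k V (\<Delta> \<inter> \<Gamma>)"
    using Poly_Mapping.keys_add[of a b] poly_add_closed[of a k V b] by (auto simp: nonface_ideal_def)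
qed

lemma regular_mod_Un:
  assumes "down_closed \<Delta>" "down_closed \<Gamma>" "set xs \<subseteq> polys k V"
    and "regular_mod k V (nonface_ideal k V \<Delta>) xs" "regular_mod k V (nonface_ideal k V \<Gamma>) xs"
    and "regular_mod k V (nonface_ideal k V (\<Delta> \<inter> \<Gamma>)) (butlast xs)"
  shows "regular_mod k V (nonface_ideal k V (\<Delta> \<union> \<Gamma>)) xs"
  unfolding nonface_ideal_Int[symmetric]
proof (rule regular_mod_Int[where K = "nonface_ideal k V (\<Delta> \<inter> \<Gamma>)"])
  show "ideal (nonface_ideal k V (\<Delta> \<inter> \<Gamma>)) (poly_ring k V)"
    using assms(1,2) by (intro nonface_ideal_ideal) (auto simp: down_closed_def)
qed (use assms nonface_ideal_ideal nonface_ideal_sum in blast)+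

subsection \<open>Cones\<close>

definition join :: "nat set \<Rightarrow> nat set set \<Rightarrow> nat set set" where
  "join Z G = {S \<union> F | S F. S \<subseteq> Z \<and> F \<in> G}"

lemma down_closed_join: "down_closed G \<Longrightarrow> down_closed (join Z G)"
  unfolding down_closed_def join_def
proof (clarify)
  fix S F H assume G: "\<forall>F\<in>G. \<forall>H\<subseteq>F. H \<in> G" and h: "S \<subseteq> Z" "F \<in> G" "H \<subseteq> S \<union> F"
  have "H = (H \<inter> S) \<union> (H \<inter> F)" "H \<inter> S \<subseteq> Z" "H \<inter> F \<in> G" using h G by auto
  thus "\<exists>S F. H = S \<union> F \<and> S \<subseteq> Z \<and> F \<in> G" by blast
qed

text \<open>
  The vertices of the simplex are cone points.  The variable of a cone point \<open>z\<close> is a nonzerodivisor, as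
  \<open>F\<close> can be enlarged by \<open>z\<close> before restricting; and adding it to the ideal removes \<open>z\<close> from the
  complex.
\<close>

lemma regular_mod_join:
  assumes "down_closed G" "set zs \<subseteq> V" "distinct zs" "set zs \<inter> \<Union>G = {}"
    and "regular_mod k V (nonface_ideal k V G) ps"
  shows "regular_mod k V (nonface_ideal k V (join (set zs) G)) (map X zs @ ps)"
  using assms(2-4)
proof (induction zs)
  case Nil
  have "join {} G = G" by (auto simp: join_def)
  thus ?case using assms(5) by simp
next
  case (Cons z zs)
  let ?D = "join (set (z # zs)) G"
  have dc: "down_closed ?D" by (rule down_closed_join[OF assms(1)])
  have zV: "z \<in> V" using Cons.prems by simp
  have cone: "insert z F \<in> ?D" if F: "F \<in> ?D" for F
  proof -
    obtain S H where "F = S \<union> H" "S \<subseteq> set (z # zs)" "H \<in> G" using F by (auto simp: join_def)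
    then have "insert z F = insert z S \<union> H" "insert z S \<subseteq> set (z # zs)" "H \<in> G" by auto
    thus ?thesis unfolding join_def by blast
  qed
  have "a \<in> nonface_ideal k V ?D" if a: "a \<in> polys k V" "X z * a \<in> nonface_ideal k V ?D" for a
    unfolding nonface_ideal_iff[OF dc]
  proof (intro conjI ballI a(1))
    fix F assume F: "F \<in> ?D"
    have "res (insert z F) (X z * a) = 0" using a(2) cone[OF F] nonface_ideal_iff[OF dc] by blast
    then have "res (insert z F) a = 0" by (simp add: res_X)
    then have "res F (res (insert z F) a) = 0" by simp
    moreover have "F \<inter> insert z F = F" by auto
    ultimately show "res F a = 0" by simp
  qed
  moreover have "Idl\<^bsub>poly_ring k V\<^esub> (insert (X z) (nonface_ideal k V ?D)) = nonface_ideal k V (join (set zs) G)"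
  proof (intro equalityI subsetI)
    have sub: "join (set zs) G = {F \<in> ?D. z \<notin> F}"
    proof (intro equalityI subsetI)
      fix F assume "F \<in> {F \<in> ?D. z \<notin> F}"
      then obtain S H where "F = S \<union> H" "S \<subseteq> insert z (set zs)" "H \<in> G" "z \<notin> F"
        by (auto simp: join_def)
      moreover from this have "S \<subseteq> set zs" by auto
      ultimately show "F \<in> join (set zs) G" by (auto simp: join_def)
    next
      fix F assume "F \<in> join (set zs) G"
      then obtain S H where h: "F = S \<union> H" "S \<subseteq> set zs" "H \<in> G" by (auto simp: join_def)
      then have "S \<subseteq> set (z # zs)" by auto
      then have "F \<in> ?D" using h unfolding join_def by blast
      moreover have "z \<notin> F" using h Cons.prems by auto
      ultimately show "F \<in> {F \<in> ?D. z \<notin> F}" by blast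
    qed
    have dc': "down_closed (join (set zs) G)" by (rule down_closed_join[OF assms(1)])
    have ID: "ideal (nonface_ideal k V ?D) (poly_ring k V)" by (rule nonface_ideal_ideal[OF dc])
    have II: "ideal (Idl\<^bsub>poly_ring k V\<^esub> (insert (X z) (nonface_ideal k V ?D))) (poly_ring k V)"
      by (rule poly_Idl_insert_ideal[OF ID X_closed[OF zV]])
    fix p
    show "p \<in> nonface_ideal k V (join (set zs) G)"
      if pI: "p \<in> Idl\<^bsub>poly_ring k V\<^esub> (insert (X z) (nonface_ideal k V ?D))"
    proof -
      obtain i b where h: "i \<in> nonface_ideal k V ?D" "b \<in> polys k V" "p = i + b * X z"
        using pI unfolding poly_Idl_insert_iff[OF ID X_closed[OF zV]] by blast
      have "res F p = 0" if "F \<in> join (set zs) G" for F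
        using that h unfolding sub nonface_ideal_iff[OF dc] by (simp add: res_X)
      moreover have "p \<in> polys k V"
        using h poly_idealD(1)[OF ID h(1)] X_closed[OF zV] by (auto intro: poly_add_closed poly_mult_closed)
      ultimately show ?thesis unfolding nonface_ideal_iff[OF dc'] by blast
    qed
    assume p: "p \<in> nonface_ideal k V (join (set zs) G)"
    have e: "X z = single (var z) 1" by (simp add: X_def)
    show "p \<in> Idl\<^bsub>poly_ring k V\<^esub> (insert (X z) (nonface_ideal k V ?D))"
    proof (rule poly_mem_idealI[OF II])
      show pc: "p \<in> polys k V" using p by (simp add: nonface_ideal_def)
      interpret R: cring "poly_ring k V" by (rule poly_cring)
      have self: "insert (X z) (nonface_ideal k V ?D) \<subseteq> Idl\<^bsub>poly_ring k V\<^esub> (insert (X z) (nonface_ideal k V ?D))"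
        using X_closed[OF zV] by (intro R.genideal_self) (auto simp: nonface_ideal_def)
      fix w assume w: "w \<in> keys p"
      show "\<exists>g h. w = g + h \<and> single g 1 \<in> Idl\<^bsub>poly_ring k V\<^esub> (insert (X z) (nonface_ideal k V ?D))"
      proof (cases "z \<in> keys w")
        case True
        then have "w = var z + (w - var z)" by (intro monomial_split) (auto simp: lookup_var in_keys_iff)
        thus ?thesis using self e by (metis insert_subset)
      next
        case False
        then have "keys w \<notin> ?D" using p w sub by (auto simp: nonface_ideal_def)
        then have "single w 1 \<in> nonface_ideal k V ?D"
          using w pc by (auto simp: nonface_ideal_def carrier_poly_ring)
        moreover have "w = w + 0" by simp
        ultimately show ?thesis using self by blast
      qed
    qed
  qed
  ultimately show ?case using Cons by simp
qed

subsection \<open>Joins of a simplex with points or a graph\<close>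

definition points :: "nat set \<Rightarrow> nat set set" where
  "points W = insert {} ((\<lambda>w. {w}) ` W)"

definition graph :: "nat set set \<Rightarrow> nat set set" where
  "graph E = {F. \<exists>e\<in>E. F \<subseteq> e}"

lemma down_closed_points: "down_closed (points W)"
  by (auto simp: down_closed_def points_def subset_singleton_iff)

lemma down_closed_graph: "down_closed (graph E)"
  by (auto simp: down_closed_def graph_def)

lemma Union_points: "\<Union>(points W) = W" and Union_graph: "\<Union>(graph E) = \<Union>E"
  by (auto simp: points_def graph_def)

lemma simplicial_complex_join:
  assumes "finite V" "Z \<subseteq> V" "\<Union>G \<subseteq> V" "{} \<in> G" "down_closed G"
  shows "simplicial_complex V (join Z G)"
proof -
  have "down_closed (join Z G)" by (rule down_closed_join[OF assms(5)])
  moreover have "join Z G \<subseteq> Pow V" using assms by (auto simp: join_def)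
  moreover have "{} \<in> join Z G" using assms(4) by (auto simp: join_def)
  ultimately show ?thesis using assms(1) by (auto simp: simplicial_complex_def down_closed_def)
qed

lemma cohen_macaulay_join:
  assumes V: "finite V" "Z \<subseteq> V" "\<Union>G \<subseteq> V" "Z \<inter> \<Union>G = {}" and G: "down_closed G"
    and d: "\<And>F. F \<in> G \<Longrightarrow> card F \<le> length ps" "F\<^sub>0 \<in> G" "card F\<^sub>0 = length ps"
    and ps: "set ps \<subseteq> face_prime k V {}" "regular_mod k V (nonface_ideal k V G) ps"
  shows "cohen_macaulay k V (join Z G)"
proof -
  have e: "{} \<in> G" using G d(2) by (auto simp: down_closed_def)
  interpret complex k V "join Z G"
    using simplicial_complex_join[OF V(1-3) e G] by unfold_locales
  have finZ: "finite Z" by (rule finite_subset[OF V(2,1)])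
  then obtain zs where zs: "set zs = Z" "distinct zs" using finite_distinct_list by blast
  then have l: "length zs = card Z" using distinct_card by fastforce
  show ?thesis
  proof (rule cohen_macaulayI[of "map X zs @ ps" "Z \<union> F\<^sub>0"])
    fix F assume "F \<in> join Z G"
    then obtain S H where h: "F = S \<union> H" "S \<subseteq> Z" "H \<in> G" by (auto simp: join_def)
    have "card F \<le> card S + card H" using h(1) card_Un_le by simp
    also have "\<dots> \<le> card Z + length ps" using h d(1) finZ by (intro add_mono card_mono) auto
    finally show "card F \<le> length (map X zs @ ps)" using l by simp
  next
    show "Z \<union> F\<^sub>0 \<in> join Z G" using d(2) by (auto simp: join_def)
    have "finite F\<^sub>0" using d(2) V by (meson Union_upper finite_subset)
    then show "card (Z \<union> F\<^sub>0) = length (map X zs @ ps)"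
      using finZ d(2,3) V(4) l by (subst card_Un_disjoint) auto
    have "X z \<in> M" if "z \<in> Z" for z :: nat
      using that V(2) X_closed[of z V k] by (auto simp: face_prime_def res_X)
    thus "set (map X zs @ ps) \<subseteq> M" using ps(1) zs(1) by auto
    show "regular_mod k V I (map X zs @ ps)"
      unfolding sr_ideal_eq_nonface_ideal using regular_mod_join[OF G _ zs(2) _ ps(2)] zs V by auto
  qed
qed

text \<open>
  Restricted to a vertex \<open>w\<close>, the sum of the vertices is the variable \<open>x\<^sub>w\<close>, a nonzerodivisor on every
  axis.
\<close>

lemma vertex_sum_regular_on_points:
  assumes W: "W \<noteq> {}" "W \<subseteq> V" and th: "\<And>w. w \<in> W \<Longrightarrow> res {w} \<theta> = (X w :: 'k::field mpoly)"
  shows "regular_mod k V (nonface_ideal k V (points W)) [\<theta>]"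
proof -
  have "a \<in> nonface_ideal k V (points W)"
    if a: "a \<in> polys k V" "\<theta> * a \<in> nonface_ideal k V (points W)" for a
    unfolding nonface_ideal_iff[OF down_closed_points]
  proof (intro conjI ballI a(1))
    have w0: "res {w} a = 0" if "w \<in> W" for w
    proof -
      have "res {w} (\<theta> * a) = 0"
        using a(2) that unfolding nonface_ideal_iff[OF down_closed_points] by (auto simp: points_def)
      thus ?thesis using th[OF that] by simp
    qed
    fix F assume "F \<in> points W"
    then consider "F = {}" | w where "w \<in> W" "F = {w}" by (auto simp: points_def)
    thus "res F a = 0"
    proof cases
      case 1
      obtain w where "w \<in> W" using W by auto
      then have "res {} (res {w} a) = 0" using w0 by simp
      thus ?thesis using 1 by simp
    qed (use w0 in auto)
  qed
  thus ?thesis by simp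
qed

lemma sum_X_closed: "W \<subseteq> V \<Longrightarrow> (\<Sum>w\<in>W. X w) \<in> polys k V"
  by (intro poly_sum_closed X_closed) auto

lemma res_sum_X: "finite W \<Longrightarrow> res F (\<Sum>w\<in>W. X w) = (\<Sum>w\<in>W \<inter> F. X w)"
  unfolding res_sum res_X by (simp add: sum.inter_restrict)

lemma cohen_macaulay_join_points:
  assumes "finite V" "Z \<subseteq> V" "W \<subseteq> V" "Z \<inter> W = {}" "W \<noteq> {}"
  shows "cohen_macaulay k V (join Z (points W))"
proof -
  have finW: "finite W" by (rule finite_subset[OF assms(3,1)])
  obtain w where w: "w \<in> W" using assms by auto
  show ?thesis
  proof (rule cohen_macaulay_join[where ps = "[\<Sum>w\<in>W. X w]" and F\<^sub>0 = "{w}"])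
    show "regular_mod k V (nonface_ideal k V (points W)) [\<Sum>w\<in>W. X w]"
      using assms finW by (intro vertex_sum_regular_on_points) (auto simp: res_sum_X)
    show "set [\<Sum>w\<in>W. X w] \<subseteq> face_prime k V {}"
      using assms finW by (simp add: face_prime_def res_sum_X sum_X_closed)
  qed (use assms w in \<open>auto simp: Union_points down_closed_points\<close>, auto simp: points_def)
qed

lemma cohen_macaulay_simplex:
  assumes "finite V" "Z \<subseteq> V" shows "cohen_macaulay k V (Pow Z)"
proof -
  have e: "join Z {{}} = Pow Z" by (auto simp: join_def)
  have "cohen_macaulay k V (join Z {{}})"
    by (rule cohen_macaulay_join[where ps = "[]" and F\<^sub>0 = "{}"])
       (use assms in \<open>auto simp: down_closed_def\<close>)
  thus ?thesis unfolding e .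
qed

text \<open>
  A finite connected graph is built edge by edge, each new edge meeting the earlier ones.  This order is
  the one in which the edges are glued together.
\<close>

inductive connected_edges :: "nat set set \<Rightarrow> bool" where
  one: "card e = 2 \<Longrightarrow> connected_edges {e}"
| add: "connected_edges E \<Longrightarrow> card e = 2 \<Longrightarrow> e \<inter> \<Union>E \<noteq> {} \<Longrightarrow> connected_edges (insert e E)"

lemma connected_edges_finite: "connected_edges E \<Longrightarrow> finite E \<and> E \<noteq> {} \<and> (\<forall>e\<in>E. card e = 2)"
  by (induction rule: connected_edges.induct) auto

text \<open>
  On a single edge the sequence is \<open>x + y, xy\<close>.  If \<open>x y a = b (x + y)\<close>, setting \<open>x\<close> or \<open>y\<close> to zero
  shows that \<open>b\<close> vanishes on both axes, so it is divisible by \<open>x y\<close>, and cancelling \<open>x y\<close> exhibits \<open>a\<close> as a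
  multiple of \<open>x + y\<close>.
\<close>

lemma edge_regular:
  assumes xy: "x \<noteq> y" "x \<in> V" "y \<in> V"
    and th: "\<theta>\<^sub>1 \<in> polys k V" "res {x, y} \<theta>\<^sub>1 = X x + X y" "res {x, y} \<theta>\<^sub>2 = X x * X y"
  shows "regular_mod k V (nonface_ideal k V (Pow {x, y})) [\<theta>\<^sub>1, \<theta>\<^sub>2]"
proof -
  let ?J = "nonface_ideal k V (Pow {x, y})"
  have dc: "down_closed (Pow {x, y})" by (auto simp: down_closed_def)
  have J: "p \<in> ?J \<longleftrightarrow> p \<in> polys k V \<and> res {x, y} p = 0" for p
    unfolding nonface_ideal_def res_eq_0_iff by auto
  have id: "ideal ?J (poly_ring k V)" by (rule nonface_ideal_ideal[OF dc])
  have nz: "X x + X y \<noteq> (0 :: 'a mpoly)"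
  proof
    assume "X x + X y = (0 :: 'a mpoly)"
    then have "res {x} (X x + X y) = (0 :: 'a mpoly)" by simp
    thus False using xy by (simp add: res_X)
  qed
  have 1: "a \<in> ?J" if "a \<in> polys k V" "\<theta>\<^sub>1 * a \<in> ?J" for a
    using that nz unfolding J by (simp add: th)
  have 2: "a \<in> Idl\<^bsub>poly_ring k V\<^esub> (insert \<theta>\<^sub>1 ?J)"
    if a: "a \<in> polys k V" "\<theta>\<^sub>2 * a \<in> Idl\<^bsub>poly_ring k V\<^esub> (insert \<theta>\<^sub>1 ?J)" for a
  proof -
    obtain i b where ib: "i \<in> ?J" "b \<in> polys k V" "\<theta>\<^sub>2 * a = i + b * \<theta>\<^sub>1"
      using a(2) unfolding poly_Idl_insert_iff[OF id th(1)] by blast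
    let ?a = "res {x, y} a" and ?b = "res {x, y} b"
    have "res {x, y} (\<theta>\<^sub>2 * a) = res {x, y} (i + b * \<theta>\<^sub>1)" using ib(3) by simp
    then have e: "X x * X y * ?a = ?b * (X x + X y)" using ib(1) by (simp add: th J)
    have "res {x} (X x * X y * ?a) = res {x} (?b * (X x + X y))" using e by simp
    then have bx: "res {x} b = 0" using xy by (simp add: res_X)
    have "res {y} (X x * X y * ?a) = res {y} (?b * (X x + X y))" using e by simp
    then have bY: "res {y} b = 0" using xy by (simp add: res_X)
    have "\<exists>h\<in>polys k V. ?b = single (var x + var y) 1 * h"
    proof (rule divide_by_monomial)
      show "?b \<in> polys k V" using ib(2) by (rule res_closed)
      fix w assume "w \<in> keys ?b"
      then have w: "w \<in> keys b" "keys w \<subseteq> {x, y}" by (auto simp: keys_res)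
      have "\<not> keys w \<subseteq> {x}" "\<not> keys w \<subseteq> {y}"
        using bx bY w(1) unfolding res_eq_0_iff by auto
      then have "x \<in> keys w" "y \<in> keys w" using w(2) by auto
      then show "\<exists>h. w = var x + var y + h"
        using xy by (auto simp: monomial_le_iff lookup_add lookup_var in_keys_iff)
    qed
    then obtain h where h: "h \<in> polys k V" "?b = X x * X y * h"
      by (auto simp: X_def mult_single)
    have "X x * X y * ?a = X x * X y * (h * (X x + X y))" using e h(2) by (simp add: mult_ac)
    then have a': "?a = h * (X x + X y)" by simp
    have "res {x, y} ?a = res {x, y} h * (X x + X y)" unfolding a' by (simp add: res_X)
    then have "?a = res {x, y} h * (X x + X y)" by simp
    then have "a - h * \<theta>\<^sub>1 \<in> ?J" unfolding J
      using a(1) h(1) th by (auto intro: poly_minus_closed poly_mult_closed)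
    moreover have "a = (a - h * \<theta>\<^sub>1) + h * \<theta>\<^sub>1" by simp
    ultimately show ?thesis unfolding poly_Idl_insert_iff[OF id th(1)] using h(1) by blast
  qed
  show ?thesis using 1 2 by simp
qed

lemma graph_insert: "graph (insert e E) = Pow e \<union> graph E"
  by (auto simp: graph_def)

text \<open>
  A new edge meets the graph built so far in one or two of its vertices.  On this nonempty set of points
  the first element of the sequence is regular, which is what gluing requires.
\<close>

lemma connected_graph_regular:
  assumes "connected_edges E" "\<Union>E \<subseteq> V"
    and th: "\<theta>\<^sub>1 \<in> polys k V" "\<theta>\<^sub>2 \<in> polys k V"
    and "\<And>e. e \<in> E \<Longrightarrow> res e \<theta>\<^sub>1 = (\<Sum>v\<in>e. X v) \<and> res e \<theta>\<^sub>2 = (\<Prod>v\<in>e. X v)"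
  shows "regular_mod k V (nonface_ideal k V (graph E)) [\<theta>\<^sub>1, \<theta>\<^sub>2]"
  using assms(1,2,5)
proof (induction rule: connected_edges.induct)
  case (one e)
  then obtain x y where xy: "e = {x, y}" "x \<noteq> y" by (auto simp: card_2_iff)
  have "graph {e} = Pow {x, y}" using xy by (auto simp: graph_def)
  moreover have "res {x, y} \<theta>\<^sub>1 = X x + X y" "res {x, y} \<theta>\<^sub>2 = X x * X y"
    using one.prems(2)[of e] xy by auto
  ultimately show ?case
    using edge_regular[OF xy(2) _ _ th(1)] one.prems(1) xy(1) by simp
next
  case (add E e)
  obtain x y where xy: "e = {x, y}" "x \<noteq> y" using add.hyps by (auto simp: card_2_iff)
  have r1: "regular_mod k V (nonface_ideal k V (Pow e)) [\<theta>\<^sub>1, \<theta>\<^sub>2]"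
  proof -
    have "res {x, y} \<theta>\<^sub>1 = X x + X y" "res {x, y} \<theta>\<^sub>2 = X x * X y"
      using add.prems(2)[of e] xy by auto
    thus ?thesis using edge_regular[OF xy(2) _ _ th(1)] add.prems(1) xy(1) by simp
  qed
  have r2: "regular_mod k V (nonface_ideal k V (graph E)) [\<theta>\<^sub>1, \<theta>\<^sub>2]"
    using add by auto
  show ?case
  proof (cases "e \<in> E")
    case True thus ?thesis using r2 by (simp add: insert_absorb)
  next
    case False
    have "Pow e \<inter> graph E = points (e \<inter> \<Union>E)"
    proof (intro equalityI subsetI)
      fix F assume F: "F \<in> Pow e \<inter> graph E"
      then obtain e' where e': "e' \<in> E" "F \<subseteq> e'" by (auto simp: graph_def)
      have "card e' = 2" using connected_edges_finite[OF add.hyps(1)] e' by auto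
      then have "F \<noteq> e"
        using e' False add.hyps(2) by (metis card_subset_eq card.infinite zero_neq_numeral)
      then have "F = {} \<or> F = {x} \<or> F = {y}" using F xy by auto
      thus "F \<in> points (e \<inter> \<Union>E)" using e' F by (auto simp: points_def)
    next
      fix F assume "F \<in> points (e \<inter> \<Union>E)"
      thus "F \<in> Pow e \<inter> graph E" using connected_edges_finite[OF add.hyps(1)]
        by (auto simp: points_def graph_def)
    qed
    moreover have "regular_mod k V (nonface_ideal k V (points (e \<inter> \<Union>E))) [\<theta>\<^sub>1]"
    proof (rule vertex_sum_regular_on_points)
      show "e \<inter> \<Union>E \<subseteq> V" using add.prems by auto
      show "res {w} \<theta>\<^sub>1 = X w" if "w \<in> e \<inter> \<Union>E" for w
      proof -
        have "res {w} \<theta>\<^sub>1 = res {w} (res e \<theta>\<^sub>1)" using that by (simp add: Int_absorb2)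
        also have "res e \<theta>\<^sub>1 = X x + X y" using add.prems xy by simp
        finally show ?thesis using that xy by (auto simp: res_X)
      qed
    qed (rule add.hyps)
    ultimately show ?thesis unfolding graph_insert
      using r1 r2 th down_closed_graph by (intro regular_mod_Un) (auto simp: down_closed_def)
  qed
qed

text \<open>
  The first two elementary symmetric functions of the graph, the sum of its vertices and the sum of its
  edges, restrict to \<open>x + y\<close> and \<open>x y\<close> on every edge.  Using these instead of two general linear forms
  works over every field, finite ones included.
\<close>

lemma cohen_macaulay_join_connected:
  assumes V: "finite V" "Z \<subseteq> V" "\<Union>E \<subseteq> V" "Z \<inter> \<Union>E = {}" and E: "connected_edges E"
  shows "cohen_macaulay k V (join Z (graph E))"
proof -
  note Ef = connected_edges_finite[OF E]
  let ?t1 = "(\<Sum>v\<in>\<Union>E. X v) :: 'a mpoly" and ?t2 = "(\<Sum>e\<in>E. \<Prod>v\<in>e. X v) :: 'a mpoly"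
  obtain e where e: "e \<in> E" using Ef by auto
  have fe: "finite e \<and> e \<noteq> {}" if "e \<in> E" for e
    using Ef that by (metis card.empty card.infinite zero_neq_numeral)
  have finU: "finite (\<Union>E)" by (rule finite_subset[OF V(3,1)])
  have pr: "res F (\<Prod>v\<in>e. X v) = (if e \<subseteq> F then (\<Prod>v\<in>e. X v) else (0 :: 'a mpoly))" if "finite e" for F e
    using that by (induction e rule: finite_induct) (auto simp: res_X)
  have r2: "res F ?t2 = (\<Sum>e\<in>{e\<in>E. e \<subseteq> F}. \<Prod>v\<in>e. X v)" for F
    using Ef fe by (simp add: res_sum pr sum.inter_filter cong: sum.cong)
  have t1: "?t1 \<in> polys k V" using V by (intro sum_X_closed)
  have t2: "?t2 \<in> polys k V"
    using V by (intro poly_sum_closed poly_prod_closed X_closed) auto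
  show ?thesis
  proof (rule cohen_macaulay_join[where ps = "[?t1, ?t2]" and F\<^sub>0 = e])
    show "regular_mod k V (nonface_ideal k V (graph E)) [?t1, ?t2]"
    proof (rule connected_graph_regular[OF E V(3) t1 t2])
      fix e assume e: "e \<in> E"
      have "e' = e" if "e' \<in> E" "e' \<subseteq> e" for e'
        using that Ef e fe[OF e] by (intro card_subset_eq) auto
      then have "{e' \<in> E. e' \<subseteq> e} = {e}" using e by auto
      moreover have "\<Union>E \<inter> e = e" using e by auto
      ultimately show "res e ?t1 = (\<Sum>v\<in>e. X v) \<and> res e ?t2 = (\<Prod>v\<in>e. X v)"
        by (simp add: res_sum_X[OF finU] r2)
    qed
    have z: "{e \<in> E. e \<subseteq> {}} = {}" using fe by auto
    have "res {} ?t2 = 0" unfolding r2 z by simp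
    thus "set [?t1, ?t2] \<subseteq> face_prime k V {}"
      unfolding face_prime_def using t1 t2 by (simp add: res_sum_X[OF finU])
    show "card F \<le> length [?t1, ?t2]" if FE: "F \<in> graph E" for F
    proof -
      obtain e where e: "e \<in> E" "F \<subseteq> e" using FE by (auto simp: graph_def)
      then have "card F \<le> card e" using fe by (intro card_mono) auto
      thus ?thesis using Ef e by simp
    qed
  qed (use V e Ef in \<open>auto simp: Union_graph down_closed_graph\<close>, auto simp: graph_def)
qed

subsection \<open>Disconnected complexes\<close>

text \<open>
  Let \<open>f, g\<close> be a regular sequence and let \<open>f\<^sub>U\<close> be the part of \<open>f\<close> on the component \<open>U\<close>.  Since \<open>f\<close> and
  \<open>g\<close> have no constant term, \<open>g f\<^sub>U = g\<^sub>U f\<close> in the Stanley-Reisner ring; so \<open>f\<^sub>U = h f\<close> for some \<open>h\<close> by regularity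
  of \<open>g\<close> modulo \<open>f\<close>.  Then \<open>f h\<close> vanishes off \<open>U\<close> and \<open>f (1 - h)\<close> vanishes on \<open>U\<close>.  Regularity of
  \<open>f\<close> forces the constant term of \<open>h\<close> to be both \<open>0\<close> and \<open>1\<close>.
\<close>

lemma (in complex) disconnected_not_cohen_macaulay:
  assumes V: "{x, y} \<subseteq> V" "{x} \<in> \<Delta>" "{y} \<in> \<Delta>" "x \<in> U" "y \<notin> U"
    and dis: "\<And>F. F \<in> \<Delta> \<Longrightarrow> F \<subseteq> U \<or> F \<inter> U = {}"
    and F: "F \<in> \<Delta>" "2 \<le> card F"
  shows "\<not> cohen_macaulay k V \<Delta>"
proof
  assume "cohen_macaulay k V \<Delta>"
  then obtain f g where f: "f \<in> M" and g: "g \<in> M"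
    and freg: "\<And>a. a \<in> carrier R \<Longrightarrow> f * a \<in> I \<Longrightarrow> a \<in> I"
    and greg: "\<And>a. a \<in> carrier R \<Longrightarrow> g * a \<in> Idl\<^bsub>R\<^esub> (insert f I) \<Longrightarrow> a \<in> Idl\<^bsub>R\<^esub> (insert f I)"
    using cohen_macaulayD F by metis
  have fc: "f \<in> carrier R" and gc: "g \<in> carrier R" and f0: "res {} f = 0" and g0: "res {} g = 0"
    using f g by (auto simp: face_prime_def)
  have resU: "res U a \<in> carrier R" if "a \<in> carrier R" for a using that by (rule res_closed)
  have sub: "F \<inter> U = F \<or> F \<inter> U = {}" if "F \<in> \<Delta>" for F using dis[OF that] by auto
  have rU: "res F (res U a) = res F a" if "F \<subseteq> U" for F and a :: "'k mpoly"
    using that by (simp add: Int_absorb2)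
  have rN: "res F (res U a) = res {} a" if "F \<inter> U = {}" for F and a :: "'k mpoly"
    using that by simp
  have r0: "res {} a = res {} (res F a)" for F and a :: "'k mpoly" by simp
  have "g * res U f - res U g * f \<in> I"
    unfolding sr_ideal_iff
  proof (intro conjI ballI)
    show "g * res U f - res U g * f \<in> carrier R"
      using fc gc resU by (intro poly_minus_closed poly_mult_closed)
    fix F assume "F \<in> \<Delta>"
    then consider "F \<subseteq> U" | "F \<inter> U = {}" using dis by blast
    thus "res F (g * res U f - res U g * f) = 0"
      by cases (simp_all add: Int_absorb2 f0 g0 mult.commute)
  qed
  moreover have "g * res U f = (g * res U f - res U g * f) + res U g * f" by simp
  ultimately have "g * res U f \<in> Idl\<^bsub>R\<^esub> (insert f I)"
    unfolding poly_Idl_insert_iff[OF sr_ideal_ideal fc] using resU[OF gc] by blast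
  then have "res U f \<in> Idl\<^bsub>R\<^esub> (insert f I)" using greg resU[OF fc] by blast
  then obtain i h where h: "i \<in> I" "h \<in> carrier R" "res U f = i + h * f"
    unfolding poly_Idl_insert_iff[OF sr_ideal_ideal fc] by blast
  have i: "res F i = 0" if "F \<in> \<Delta>" for F using h(1) that sr_ideal_iff by blast
  have cancel: "res {v} (X v * b) = 0"
    if v: "v \<in> V" "{v} \<in> \<Delta>" and b: "b \<in> carrier R" "\<And>F. F \<in> \<Delta> \<Longrightarrow> v \<in> F \<Longrightarrow> res F (f * b) = 0" for v b
  proof -
    have "X v * b \<in> I"
    proof (rule freg)
      show "X v * b \<in> carrier R" by (intro poly_mult_closed X_closed v(1) b(1))
      show "f * (X v * b) \<in> I" unfolding sr_ideal_iff
      proof (intro conjI ballI)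
        show "f * (X v * b) \<in> carrier R"
          by (intro poly_mult_closed fc X_closed v(1) b(1))
        fix F assume F: "F \<in> \<Delta>"
        show "res F (f * (X v * b)) = 0"
          using b(2)[OF F] by (cases "v \<in> F") (auto simp: res_X)
      qed
    qed
    thus ?thesis using v sr_ideal_iff by blast
  qed
  have "res {y} h = 0"
  proof -
    have "res {y} (X y * h) = 0"
    proof (rule cancel)
      fix F assume F: "F \<in> \<Delta>" "y \<in> F"
      then have "F \<inter> U = {}" using dis V by blast
      then have "res F (res U f) = 0" using f0 by simp
      thus "res F (f * h) = 0" unfolding h(3) using i[OF F(1)] by (simp add: mult.commute)
    qed (use V h in auto)
    thus ?thesis by (simp add: res_X)
  qed
  then have h0: "res {} h = 0" using r0[of h "{y}"] by simp
  have "res {x} (1 - h) = 0"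
  proof -
    have "res {x} (X x * (1 - h)) = 0"
    proof (rule cancel)
      show "1 - h \<in> carrier R" using h(2) poly_one_closed poly_minus_closed by blast
      fix F assume F: "F \<in> \<Delta>" "x \<in> F"
      then have "F \<subseteq> U" using dis V by blast
      then have "res F f = res F (i + h * f)" using h(3) rU[of F f] by simp
      thus "res F (f * (1 - h)) = 0" using i[OF F(1)] by (simp add: algebra_simps)
    qed (use V in auto)
    thus ?thesis by (simp add: res_X del: res_minus)
  qed
  then have "res {} (1 - h) = 0" using r0[of "1 - h" "{x}"] by (simp del: res_minus)
  thus False using h0 by simp
qed

section \<open>Buchsbaum complexes\<close>

context complex
begin

text \<open>
  The polynomials with nonzero constant term: their classes are the denominators allowed in the local
  ring at the graded maximal ideal.
\<close>

definition "D = {s \<in> carrier R. res {} s \<noteq> 0}"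
abbreviation "quo p s \<equiv> loc.fr (cls p) (cls s)"
abbreviation "m_loc \<equiv> local_max_ideal A (sr_max_ideal k V \<Delta>)"

lemma buchsbaum_iff: "buchsbaum k V \<Delta> \<longleftrightarrow> buchsbaum_local loc.Loc m_loc"
  by (simp add: buchsbaum_def buchsbaum_graded_def)

lemma D_iff: "s \<in> D \<longleftrightarrow> s \<in> carrier R \<and> res {} s \<noteq> 0"
  by (simp add: D_def)

lemma D_carrier: "s \<in> D \<Longrightarrow> s \<in> carrier R" by (simp add: D_iff)

lemma D_eq: "D = carrier R - M"
  by (auto simp: D_iff face_prime_def)

lemma denominators: "carrier A - sr_max_ideal k V \<Delta> = cls ` D"
  unfolding D_eq using cls_in_max_iff carrier_A by auto

lemma D_one: "1 \<in> D" and D_mult: "s \<in> D \<Longrightarrow> t \<in> D \<Longrightarrow> s * t \<in> D"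
  by (auto simp: D_iff poly_one_closed intro: poly_mult_closed)

lemma D_res: "s \<in> D \<Longrightarrow> res F s \<noteq> 0"
proof
  assume "s \<in> D" "res F s = 0"
  then have "res {} (res F s) = 0" "res {} s \<noteq> 0" by (auto simp: D_iff)
  thus False by simp
qed

lemma cls_D: "s \<in> D \<Longrightarrow> cls s \<in> carrier A - sr_max_ideal k V \<Delta>"
  unfolding denominators by simp

lemma m_loc_eq: "m_loc = {quo p s | p s. p \<in> M \<and> s \<in> D}"
proof -
  have "m_loc = {loc.fr a s | a s. a \<in> cls ` M \<and> s \<in> cls ` D}"
    unfolding local_max_ideal_def denominators unfolding sr_max_ideal_eq ..
  thus ?thesis by blast
qed

lemma loc_elem:
  assumes "x \<in> carrier loc.Loc"
  obtains p s where "p \<in> carrier R" "s \<in> D" "x = quo p s"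
proof -
  obtain a s where a: "a \<in> carrier A" "s \<in> carrier A - sr_max_ideal k V \<Delta>" "x = loc.fr a s"
    using loc.loc_cases[OF assms] .
  obtain p where "p \<in> carrier R" "a = cls p" using a(1) unfolding carrier_A by auto
  moreover obtain q where "q \<in> D" "s = cls q" using a(2) unfolding denominators by auto
  ultimately show ?thesis using that a(3) by simp
qed

lemma quo_closed: "p \<in> carrier R \<Longrightarrow> s \<in> D \<Longrightarrow> quo p s \<in> carrier loc.Loc"
  by (intro loc.fr_closed cls_closed cls_D)

lemma quo_mult: "p \<in> carrier R \<Longrightarrow> q \<in> carrier R \<Longrightarrow> s \<in> D \<Longrightarrow> t \<in> D \<Longrightarrow>
    quo p s \<otimes>\<^bsub>loc.Loc\<^esub> quo q t = quo (p * q) (s * t)"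
  using loc.loc_mult[OF cls_closed cls_closed cls_D cls_D, of p q s t] cls_mult[of p q]
    cls_mult[OF D_carrier D_carrier, of s t] by simp

lemma quo_pow: "p \<in> carrier R \<Longrightarrow> s \<in> D \<Longrightarrow> quo p s [^]\<^bsub>loc.Loc\<^esub> (e::nat) = quo (p ^ e) (s ^ e)"
  using loc.loc_pow[OF cls_closed cls_D, of p s e] cls_pow[of p e]
    cls_pow[OF D_carrier, of s e] by simp

lemma D_pow: "s \<in> D \<Longrightarrow> s ^ e \<in> D"
  by (induction e) (auto simp: D_one intro: D_mult)

lemma quo_in_Idl_iff:
  assumes Y: "Y \<subseteq> carrier R \<times> D" and b: "b \<in> carrier R" "t \<in> D"
  shows "quo b t \<in> Idl\<^bsub>loc.Loc\<^esub> ((\<lambda>(p, s). quo p s) ` Y) \<longleftrightarrow>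
    (\<exists>w\<in>D. w * b \<in> Idl\<^bsub>R\<^esub> (I \<union> fst ` Y))"
proof -
  let ?Y = "(\<lambda>(p, s). (cls p, cls s)) ` Y"
  have 1: "(\<lambda>(a, s). loc.fr a s) ` ?Y = (\<lambda>(p, s). quo p s) ` Y"
    unfolding image_image by (intro image_cong) auto
  have 2: "fst ` ?Y = cls ` fst ` Y" unfolding image_image by (intro image_cong) auto
  have 3: "?Y \<subseteq> carrier A \<times> (carrier A - sr_max_ideal k V \<Delta>)"
  proof -
    have "(cls p, cls s) \<in> carrier A \<times> (carrier A - sr_max_ideal k V \<Delta>)" if "(p, s) \<in> Y" for p s
      using that Y by (intro SigmaI cls_closed cls_D) auto
    thus ?thesis by (intro image_subsetI) (simp only: case_prod_beta prod.collapse)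
  qed
  have 4: "fst ` Y \<subseteq> carrier R" using Y by auto
  have "quo b t \<in> Idl\<^bsub>loc.Loc\<^esub> ((\<lambda>(p, s). quo p s) ` Y) \<longleftrightarrow>
      (\<exists>w\<in>cls ` D. w \<otimes>\<^bsub>A\<^esub> cls b \<in> Idl\<^bsub>A\<^esub> (cls ` fst ` Y))"
    using loc.Idl_loc_iff[OF 3 cls_closed[OF b(1)] cls_D[OF b(2)]] unfolding 1 2 unfolding denominators .
  also have "\<dots> \<longleftrightarrow> (\<exists>w\<in>D. cls (w * b) \<in> Idl\<^bsub>A\<^esub> (cls ` fst ` Y))"
  proof -
    have "cls w \<otimes>\<^bsub>A\<^esub> cls b = cls (w * b)" if "w \<in> D" for w by (rule cls_mult[OF D_carrier[OF that] b(1)])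
    thus ?thesis by (simp cong: bex_cong)
  qed
  also have "\<dots> \<longleftrightarrow> (\<exists>w\<in>D. w * b \<in> Idl\<^bsub>R\<^esub> (I \<union> fst ` Y))"
    by (intro bex_cong refl cls_in_Idl[OF 4] poly_mult_closed D_carrier b(1))
  finally show ?thesis .
qed

lemma quo_in_Idl_empty_iff:
  assumes "b \<in> carrier R" "t \<in> D"
  shows "quo b t \<in> Idl\<^bsub>loc.Loc\<^esub> {} \<longleftrightarrow> (\<exists>w\<in>D. w * b \<in> I)"
  using quo_in_Idl_iff[of "{}" b t] assms R.Idl_ideal_eq[OF sr_ideal_ideal] by simp

subsection \<open>Buchsbaum complexes are pure\<close>

text \<open>
  The elementary symmetric functions of the complex.  If \<open>d\<close> is the largest number of vertices of a
  face, those of degrees \<open>1\<close> to \<open>d\<close> form a system of parameters, whatever the field.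
\<close>

definition face_sum :: "nat \<Rightarrow> 'k mpoly" where
  "face_sum r = (\<Sum>F\<in>{F\<in>\<Delta>. card F = r}. \<Prod>v\<in>F. X v)"

lemma prod_X_closed: "F \<subseteq> V \<Longrightarrow> (\<Prod>v\<in>F. X v) \<in> carrier R"
  by (intro poly_prod_closed X_closed) auto

lemma face_sum_closed: "face_sum r \<in> carrier R"
  unfolding face_sum_def using faceV by (intro poly_sum_closed prod_X_closed) auto

lemma res_prod_X: "finite G \<Longrightarrow> res F (\<Prod>v\<in>G. X v) = (if G \<subseteq> F then \<Prod>v\<in>G. X v else (0 :: 'k mpoly))"
  by (induction G rule: finite_induct) (auto simp: res_X)

lemma face_sum_in_M: assumes "0 < r" shows "face_sum r \<in> M"
proof -
  have "res {} (\<Prod>v\<in>F. X v) = (0 :: 'k mpoly)" if "F \<in> {F\<in>\<Delta>. card F = r}" for F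
    using that assms finite_face by (subst res_prod_X) auto
  then have "res {} (face_sum r) = 0" unfolding face_sum_def res_sum by simp
  thus ?thesis using face_sum_closed by (simp add: face_prime_def)
qed

lemma prime_contains_prod:
  assumes "primeideal P R" "(\<Prod>v\<in>G. X v) \<in> P" "G \<subseteq> V"
  shows "\<exists>v\<in>G. X v \<in> P"
  using finite_subset[OF assms(3) finV] assms(2,3)
proof (induction G rule: finite_induct)
  case empty thus ?case using poly_primeD(2)[OF assms(1)] by simp
next
  case (insert v G)
  thus ?case using poly_primeD(3)[OF assms(1) X_closed[of v V] prod_X_closed[of G]] by auto
qed

text \<open>
  If no power of \<open>p\<close> were in the ideal, some prime \<open>P\<close> over the ideal would not contain \<open>p\<close>.  But such
  a prime contains all variables.  Otherwise let \<open>G\<close> be the face of variables outside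
  \<open>P\<close>, with \<open>r\<close> elements.  Every other face with \<open>r\<close> vertices has a vertex outside \<open>G\<close>, so all
  terms of \<open>face_sum r\<close> but one lie in \<open>P\<close>; the remaining term is the product of the variables of
  \<open>G\<close>, which is not in \<open>P\<close>.
\<close>

lemma face_sums_radical:
  assumes d: "\<And>F. F \<in> \<Delta> \<Longrightarrow> card F \<le> d" and p: "p \<in> M"
  shows "\<exists>e::nat. p ^ e \<in> Idl\<^bsub>R\<^esub> (I \<union> face_sum ` {1..d})"
proof (rule ccontr)
  let ?J = "Idl\<^bsub>R\<^esub> (I \<union> face_sum ` {1..d})"
  assume n: "\<not> (\<exists>e::nat. p ^ e \<in> ?J)"
  have pc: "p \<in> carrier R" using p by (simp add: face_prime_def)
  have sub: "I \<union> face_sum ` {1..d} \<subseteq> carrier R" using sr_ideal_carrier face_sum_closed by auto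
  have "\<exists>Q. primeideal Q R \<and> ?J \<subseteq> Q \<and> Q \<inter> range (\<lambda>e. p ^ e) = {}"
  proof (rule R.prime_avoiding)
    show "ideal ?J R" by (rule R.genideal_ideal[OF sub])
    show "range (\<lambda>e. p ^ e) \<subseteq> carrier R" using poly_power_closed[OF pc] by auto
    show "\<one>\<^bsub>R\<^esub> \<in> range (\<lambda>e. p ^ e)" by (auto intro: image_eqI[of _ _ 0])
    show "s \<otimes>\<^bsub>R\<^esub> t \<in> range (\<lambda>e. p ^ e)" if "s \<in> range (\<lambda>e. p ^ e)" "t \<in> range (\<lambda>e. p ^ e)" for s t
      using that by (auto simp: power_add[symmetric])
    show "?J \<inter> range (\<lambda>e. p ^ e) = {}" using n by auto
  qed
  then obtain P where P: "primeideal P R" "?J \<subseteq> P" "P \<inter> range (\<lambda>e. p ^ e) = {}" by blast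
  note Pi = poly_primeD(1)[OF P(1)]
  have IP: "I \<subseteq> P" "\<And>r. 1 \<le> r \<Longrightarrow> r \<le> d \<Longrightarrow> face_sum r \<in> P"
    using P(2) R.genideal_self[OF sub] by (blast, force)
  define G where "G = {v \<in> V. X v \<notin> P}"
  have GV: "G \<subseteq> V" by (auto simp: G_def)
  have GP: "(\<Prod>v\<in>G. X v) \<notin> P" using prime_contains_prod[OF P(1) _ GV] by (auto simp: G_def)
  have G: "G \<in> \<Delta>" using nonface_monomial[OF GV] GP IP(1) by auto
  have "G = {}"
  proof (rule ccontr)
    assume "G \<noteq> {}"
    then have r: "1 \<le> card G" using finite_face[OF G] by (simp add: Suc_le_eq card_gt_0_iff)
    have fin: "finite {F\<in>\<Delta>. card F = card G}" using finite_complex by simp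
    have "(\<Sum>F\<in>{F\<in>\<Delta>. card F = card G} - {G}. \<Prod>v\<in>F. X v) \<in> P"
    proof (intro poly_ideal_sum[OF Pi])
      fix F assume F: "F \<in> {F\<in>\<Delta>. card F = card G} - {G}"
      then have "\<not> F \<subseteq> G" using finite_face[OF G] card_subset_eq[of G F] by auto
      then obtain v where v: "v \<in> F" "v \<notin> G" by auto
      have FV: "F \<subseteq> V" and finF: "finite F" using F faceV finite_face by auto
      have "X v \<in> P" using v FV by (auto simp: G_def)
      then have "X v * (\<Prod>v\<in>F - {v}. X v) \<in> P"
        using FV by (intro poly_idealD(5)[OF Pi] prod_X_closed) auto
      thus "(\<Prod>v\<in>F. X v) \<in> P" using v finF by (simp add: prod.remove)
    qed
    moreover have "face_sum (card G) \<in> P" using IP(2) r d[OF G] by simp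
    moreover have "face_sum (card G)
        = (\<Prod>v\<in>G. X v) + (\<Sum>F\<in>{F\<in>\<Delta>. card F = card G} - {G}. \<Prod>v\<in>F. X v)"
      unfolding face_sum_def using G fin by (subst sum.remove[of _ G]) auto
    ultimately have "(\<Prod>v\<in>G. X v) \<in> P"
      using poly_idealD(6)[OF Pi, of "face_sum (card G)" "\<Sum>F\<in>{F\<in>\<Delta>. card F = card G} - {G}. \<Prod>v\<in>F. X v"]
      by simp
    thus False using GP by simp
  qed
  then have "Idl\<^bsub>R\<^esub> (I \<union> X ` V) \<subseteq> P" using IP(1) by (intro R.genideal_minimal Pi) (auto simp: G_def)
  then have "p \<in> P" using p ideal_of_variables by auto
  moreover have "p \<in> range (\<lambda>e. p ^ e)" by (auto intro: image_eqI[of _ _ 1])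
  ultimately show False using P(3) by auto
qed

text \<open>
  Let \<open>F\<close> be a facet with fewer than \<open>d\<close> vertices.  Put \<open>face_sum d\<close> in front of the system of
  parameters.  The product \<open>x\<^sup>F\<close> of the vertices of \<open>F\<close> annihilates it, since no face
  contains \<open>F\<close> together with \<open>d\<close> vertices.  In a Buchsbaum ring \<open>x\<^sup>F\<close> would then be annihilated by the maximal
  ideal, but \<open>x\<^sub>v x\<^sup>F \<noteq> 0\<close> for each \<open>v \<in> F\<close>.
\<close>

theorem buchsbaum_imp_pure:
  assumes bb: "buchsbaum k V \<Delta>"
  shows "pure \<Delta>"
proof (rule ccontr)
  assume "\<not> pure \<Delta>"
  then obtain F G where FG: "F \<in> facets \<Delta>" "G \<in> facets \<Delta>" "card F < card G"
    unfolding pure_def by (metis linorder_neqE_nat)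
  define d where "d = Max (card ` \<Delta>)"
  have d: "card H \<le> d" if "H \<in> \<Delta>" for H using that finite_complex by (auto simp: d_def)
  have "d \<in> card ` \<Delta>" unfolding d_def using finite_complex empty_face by (intro Max_in) auto
  then obtain G0 where G0: "G0 \<in> \<Delta>" "card G0 = d" by auto
  have F: "F \<in> \<Delta>" "card F < d" using FG d[of G] by (auto simp: facets_def)
  have Fmax: "\<And>H. H \<in> \<Delta> \<Longrightarrow> F \<subseteq> H \<Longrightarrow> H = F" using FG(1) by (auto simp: facets_def)
  have "F \<noteq> {}" using Fmax[OF G0(1)] G0 F by auto
  then obtain v where v: "v \<in> F" by auto
  have vV: "v \<in> V" using v faceV[OF F(1)] by auto
  \<comment> \<open>The order is reversed so that \<open>face_sum d\<close> comes first.\<close>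
  let ?xs = "map (\<lambda>r. quo (face_sum r) 1) (rev [1..<d+1])"
  let ?Y = "(\<lambda>r. (face_sum r, 1)) ` {1..d}"
  have set: "set ?xs = (\<lambda>(p, s). quo p s) ` ?Y" unfolding image_image by auto
  have Y: "?Y \<subseteq> carrier R \<times> D" using face_sum_closed D_one by blast
  have fY: "fst ` ?Y = face_sum ` {1..d}" unfolding image_image by simp
  have "system_of_parameters loc.Loc m_loc ?xs"
    unfolding system_of_parameters_def
  proof (intro conjI ballI)
    have "quo (face_sum r) 1 \<in> m_loc" if "1 \<le> r" for r
      unfolding m_loc_eq using face_sum_in_M[of r] D_one that by (intro CollectI exI conjI) auto
    thus "set ?xs \<subseteq> m_loc" by auto
    show "enat (length ?xs) = krull_dim loc.Loc" using krull_dim_loc[OF d G0] by simp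
    fix a assume "a \<in> m_loc"
    then obtain p s where p: "p \<in> M" "s \<in> D" "a = quo p s" unfolding m_loc_eq by blast
    have pc: "p \<in> carrier R" using p(1) by (simp add: face_prime_def)
    obtain e where e: "p ^ e \<in> Idl\<^bsub>R\<^esub> (I \<union> face_sum ` {1..d})"
      using face_sums_radical[OF d p(1)] by blast
    have "quo (p ^ e) (s ^ e) \<in> Idl\<^bsub>loc.Loc\<^esub> (set ?xs)"
      unfolding set quo_in_Idl_iff[OF Y poly_power_closed[OF pc] D_pow[OF p(2)]] fY
      using e D_one by (intro bexI[of _ 1]) auto
    then show "\<exists>e::nat. a [^]\<^bsub>loc.Loc\<^esub> e \<in> Idl\<^bsub>loc.Loc\<^esub> (set ?xs)"
      unfolding p(3) using quo_pow[OF pc p(2), of e] by (intro exI[of _ e]) simp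
  qed
  then have "weak_sequence loc.Loc m_loc ?xs"
    using bb unfolding buchsbaum_iff buchsbaum_local_def by blast
  moreover have "0 < length ?xs" using F by simp
  ultimately have "colon loc.Loc (Idl\<^bsub>loc.Loc\<^esub> {}) {?xs ! 0} = colon loc.Loc (Idl\<^bsub>loc.Loc\<^esub> {}) m_loc"
    unfolding weak_sequence_def by fastforce
  moreover have "?xs ! 0 = quo (face_sum d) 1" using F by simp
  ultimately have eq: "colon loc.Loc (Idl\<^bsub>loc.Loc\<^esub> {}) {quo (face_sum d) 1} = colon loc.Loc (Idl\<^bsub>loc.Loc\<^esub> {}) m_loc"
    by simp
  let ?f = "(\<Prod>v\<in>F. X v) :: 'k mpoly"
  have fc: "?f \<in> carrier R" by (rule prod_X_closed[OF faceV[OF F(1)]])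
  have "face_sum d * ?f \<in> I"
  proof -
    have "(\<Prod>v\<in>H. X v) * ?f \<in> I" if H: "H \<in> \<Delta>" "card H = d" for H
      unfolding sr_ideal_iff
    proof (intro conjI ballI poly_mult_closed fc prod_X_closed[OF faceV[OF H(1)]])
      fix K assume K: "K \<in> \<Delta>"
      have "\<not> (H \<subseteq> K \<and> F \<subseteq> K)" using Fmax[OF K] card_mono[OF finite_face[OF F(1)], of H] H(2) F(2) by auto
      thus "res K ((\<Prod>v\<in>H. X v) * ?f) = 0"
        using finite_face[OF H(1)] finite_face[OF F(1)] by (auto simp: res_prod_X)
    qed
    then show ?thesis unfolding face_sum_def sum_distrib_right
      by (intro poly_ideal_sum[OF sr_ideal_ideal]) auto
  qed
  then have "quo (face_sum d * ?f) (1 * 1) \<in> Idl\<^bsub>loc.Loc\<^esub> {}"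
    using D_one by (subst quo_in_Idl_empty_iff)
      (auto intro!: poly_mult_closed face_sum_closed fc bexI[of _ 1])
  then have "quo ?f 1 \<in> colon loc.Loc (Idl\<^bsub>loc.Loc\<^esub> {}) {quo (face_sum d) 1}"
    unfolding colon_def using quo_mult[OF face_sum_closed fc D_one D_one] quo_closed[OF fc D_one] by simp
  then have "quo ?f 1 \<in> colon loc.Loc (Idl\<^bsub>loc.Loc\<^esub> {}) m_loc" unfolding eq .
  moreover have Xv: "X v \<in> carrier R" "X v \<in> M" using X_closed[OF vV] by (auto simp: face_prime_def res_X)
  then have "quo (X v) 1 \<in> m_loc" unfolding m_loc_eq using D_one by blast
  ultimately have "quo (X v) 1 \<otimes>\<^bsub>loc.Loc\<^esub> quo ?f 1 \<in> Idl\<^bsub>loc.Loc\<^esub> {}" unfolding colon_def by blast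
  then have "quo (X v * ?f) (1 * 1) \<in> Idl\<^bsub>loc.Loc\<^esub> {}" using quo_mult[OF Xv(1) fc D_one D_one] by simp
  then obtain w where w: "w \<in> D" "w * (X v * ?f) \<in> I"
    using quo_in_Idl_empty_iff[OF poly_mult_closed[OF Xv(1) fc] D_mult[OF D_one D_one]] by blast
  have "res F (w * (X v * ?f)) = 0" using w(2) F(1) sr_ideal_iff by blast
  moreover have "?f \<noteq> 0" using finite_face[OF F(1)] by simp
  ultimately show False using D_res[OF w(1), of F] v finite_face[OF F(1)] by (simp add: res_X res_prod_X)
qed

end

subsection \<open>Pure graphs are Buchsbaum\<close>

text \<open>
  The variable \<open>x\<close> is prime, and \<open>res (- {x})\<close> is reduction modulo \<open>x\<close>; as \<open>x\<close> does not divide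
  \<open>f\<close>, the \<open>N\<close> factors \<open>x\<close> of the product can be split off from \<open>p\<close> one by one.
\<close>

lemma X_power_dvd:
  assumes p: "p \<in> polys k V" and e: "f * p = X x ^ N * q"
    and f: "res (- {x}) f \<noteq> 0"
  shows "\<forall>w\<in>keys p. N \<le> lookup w x"
  using p e
proof (induction N arbitrary: p)
  case (Suc N)
  have "res (- {x}) (f * p) = res (- {x}) (X x ^ Suc N * q)" using Suc.prems(2) by simp
  then have "res (- {x}) f * res (- {x}) p = 0" by (simp add: res_X)
  then have "res (- {x}) p = 0" using f by simp
  then obtain p' where p': "p' \<in> polys k V" "p = X x ^ 1 * p'"
    using divide_by_X_power[OF Suc.prems(1), of 1 x] unfolding res_Compl_var_eq_0 by blast
  have "X x * (f * p') = X x * (X x ^ N * q)" using Suc.prems(2) p'(2) by (simp add: mult_ac)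
  then have "f * p' = X x ^ N * q" by simp
  then have IH: "\<forall>w\<in>keys p'. N \<le> lookup w x" using Suc.IH p'(1) by blast
  show ?case
  proof
    fix w assume "w \<in> keys p"
    then have "w \<in> keys (X x * p')" using p'(2) by simp
    then obtain a b where "w = a + b" "a \<in> keys (X x :: 'a mpoly)" "b \<in> keys p'"
      by (rule keys_multE)
    thus "Suc N \<le> lookup w x" using IH by (auto simp: lookup_add lookup_var)
  qed
qed simp

context complex
begin

lemma ideal_Idl: "Y \<subseteq> carrier R \<Longrightarrow> ideal (Idl\<^bsub>R\<^esub> (I \<union> Y)) R"
  using sr_ideal_carrier by (intro R.genideal_ideal) auto

lemma Idl_one_iff: "a \<in> carrier R \<Longrightarrow>
    p \<in> Idl\<^bsub>R\<^esub> (I \<union> {a}) \<longleftrightarrow> (\<exists>i\<in>I. \<exists>c\<in>carrier R. p = i + c * a)"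
  using poly_Idl_insert_iff[OF sr_ideal_ideal] by simp

lemma Idl_two_iff:
  assumes "a \<in> carrier R" "b \<in> carrier R"
  shows "p \<in> Idl\<^bsub>R\<^esub> (I \<union> {a, b}) \<longleftrightarrow>
    (\<exists>i\<in>I. \<exists>c\<in>carrier R. \<exists>d\<in>carrier R. p = i + c * a + d * b)"
proof -
  have I: "I \<subseteq> carrier R" using sr_ideal_carrier by blast
  have "Idl\<^bsub>R\<^esub> (I \<union> {a, b}) = Idl\<^bsub>R\<^esub> (Idl\<^bsub>R\<^esub> (I \<union> {a}) \<union> {b})"
    using R.Idl_Idl_Un[of "I \<union> {a}" "{b}"] assms I by (simp add: insert_commute)
  also have "p \<in> \<dots> \<longleftrightarrow> (\<exists>j\<in>Idl\<^bsub>R\<^esub> (I \<union> {a}). \<exists>d\<in>carrier R. p = j + d * b)"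
    using poly_Idl_insert_iff[OF ideal_Idl[of "{a}"] assms(2)] assms(1) by simp
  finally show ?thesis unfolding Bex_def Idl_one_iff[OF assms(1)] by blast
qed

lemma res_in_sr: "i \<in> I \<Longrightarrow> F \<in> \<Delta> \<Longrightarrow> res F i = 0"
  using sr_ideal_iff by blast

lemma res_Compl_nonzero: "s \<in> D \<Longrightarrow> res (- {x}) (res F s) \<noteq> 0"
  using D_res[of s "- {x} \<inter> F"] by simp

lemma X_power_dvd_on_edge:
  assumes xy: "x \<noteq> y" and s: "s' \<in> D" and p: "p \<in> carrier R"
    and e: "res {x, y} s' * X y ^ N' * res {x, y} p = X x ^ N * q"
  shows "\<forall>w\<in>keys (res {x, y} p). N \<le> lookup w x"
proof (rule X_power_dvd[OF res_closed[OF p] e])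
  have "res (- {x}) (res {x, y} s') \<noteq> 0" by (rule res_Compl_nonzero[OF s])
  thus "res (- {x}) (res {x, y} s' * X y ^ N') \<noteq> 0" using xy by (simp add: res_X)
qed

text \<open>
  If the parameter \<open>a\<close> vanished on the edge \<open>{x, y}\<close>, then up to units powers of both \<open>x\<close> and \<open>y\<close>
  would be multiples of \<open>b\<close> there.  Eliminating \<open>b\<close> shows that the cofactor \<open>p\<close> of the power of \<open>x\<close> is
  itself divisible by this power, so that \<open>b\<close> divides a unit, although \<open>b\<close> has no constant term.
\<close>

lemma parameter_nonzero_on_edge:
  assumes ab: "a \<in> carrier R" "b \<in> M" and xy: "{x, y} \<in> \<Delta>" "x \<noteq> y"
    and x: "s \<in> D" "s * X x ^ N \<in> Idl\<^bsub>R\<^esub> (I \<union> {a, b})"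
    and y: "s' \<in> D" "s' * X y ^ N' \<in> Idl\<^bsub>R\<^esub> (I \<union> {a, b})"
  shows "res {x, y} a \<noteq> 0"
proof
  let ?e = "{x, y}"
  assume a0: "res ?e a = 0"
  have bc: "b \<in> carrier R" "res {} b = 0" using ab(2) by (auto simp: face_prime_def)
  obtain i c p where 1: "i \<in> I" "p \<in> carrier R" "s * X x ^ N = i + c * a + p * b"
    using x(2) Idl_two_iff[OF ab(1) bc(1)] by blast
  obtain j d q where 2: "j \<in> I" "q \<in> carrier R" "s' * X y ^ N' = j + d * a + q * b"
    using y(2) Idl_two_iff[OF ab(1) bc(1)] by blast
  have "res ?e (s * X x ^ N) = res ?e (i + c * a + p * b)" using 1(3) by simp
  then have e1: "res ?e s * X x ^ N = res ?e p * res ?e b"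
    using a0 res_in_sr[OF 1(1) xy(1)] by (simp add: res_X)
  have "res ?e (s' * X y ^ N') = res ?e (j + d * a + q * b)" using 2(3) by simp
  then have e2: "res ?e s' * X y ^ N' = res ?e q * res ?e b"
    using a0 res_in_sr[OF 2(1) xy(1)] by (simp add: res_X)
  have b0: "res ?e b \<noteq> 0" using e1 D_res[OF x(1), of ?e] by auto
  have "res ?e b * (res ?e s' * X y ^ N' * res ?e p) = res ?e b * (X x ^ N * (res ?e s * res ?e q))"
    using e1 e2 by (simp add: mult_ac)
  then have "res ?e s' * X y ^ N' * res ?e p = X x ^ N * (res ?e s * res ?e q)" using b0 by simp
  from X_power_dvd_on_edge[OF xy(2) y(1) 1(2) this]
  obtain p' where p': "res ?e p = X x ^ N * p'"
    using divide_by_X_power[OF res_closed[OF 1(2)], of _ N x] by blast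
  have "X x ^ N * res ?e s = X x ^ N * (p' * res ?e b)" using e1 p' by (simp add: mult_ac)
  then have "res ?e s = p' * res ?e b" by simp
  then have "res {} (res ?e s) = res {} (p' * res ?e b)" by simp
  thus False using bc(2) x(1) by (simp add: D_iff)
qed

text \<open>
  Let \<open>a, b\<close> be a system of parameters; its length is two.  As \<open>a\<close> is nonzero on every edge, it is a nonzerodivisor, so
  \<open>(0 : a) = 0\<close>.  Now let \<open>b c \<in> (a)\<close> and let \<open>x\<close> be a vertex.  A power of \<open>x\<close>, up to a unit \<open>s\<close>,
  lies in \<open>(a, b)\<close>, whence \<open>s x\<^sup>N c = a p\<close> for some \<open>p\<close>.  On edges without \<open>x\<close> this forces \<open>p = 0\<close>; on an
  edge \<open>{x, y}\<close> the analogous equation \<open>s' y\<^sup>M c = a q\<close> gives \<open>s' y\<^sup>M p = s x\<^sup>N q\<close>, hence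
  \<open>x\<^sup>N\<close> divides \<open>p\<close>.  So \<open>p = x\<^sup>N p''\<close> in the Stanley-Reisner ring, and cancelling all but one \<open>x\<close>, which is possible as the
  ring is reduced, leaves \<open>s x c = a x p'' \<in> (a)\<close>.  Thus the maximal ideal multiplies \<open>c\<close> into \<open>(a)\<close>.
\<close>

theorem pure_graph_buchsbaum:
  assumes dim: "\<And>F. F \<in> \<Delta> \<Longrightarrow> \<exists>e\<in>\<Delta>. F \<subseteq> e \<and> card e = 2"
  shows "buchsbaum k V \<Delta>"
  unfolding buchsbaum_iff buchsbaum_local_def
proof (intro allI impI)
  fix xs assume sop: "system_of_parameters loc.Loc m_loc xs"
  obtain e0 where e0: "e0 \<in> \<Delta>" "card e0 = 2" using dim[OF empty_face] by auto
  have le2: "card F \<le> 2" if "F \<in> \<Delta>" for F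
    using dim[OF that] by (metis card_mono finite_face)
  have "length xs = 2"
    using sop krull_dim_loc[OF le2 e0] by (simp add: system_of_parameters_def)
  then obtain \<alpha> \<beta> where xs: "xs = [\<alpha>, \<beta>]"
    by (auto simp: length_Suc_conv numeral_2_eq_2)
  obtain a sa where a: "a \<in> M" "sa \<in> D" "\<alpha> = quo a sa"
    using sop unfolding system_of_parameters_def xs m_loc_eq by auto
  obtain b sb where b: "b \<in> M" "sb \<in> D" "\<beta> = quo b sb"
    using sop unfolding system_of_parameters_def xs m_loc_eq by auto
  have ac: "a \<in> carrier R" and bc: "b \<in> carrier R" using a(1) b(1) by (auto simp: face_prime_def)
  have mIdl: "quo c u \<in> Idl\<^bsub>loc.Loc\<^esub> {\<alpha>, \<beta>} \<longleftrightarrow> (\<exists>w\<in>D. w * c \<in> Idl\<^bsub>R\<^esub> (I \<union> {a, b}))"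
    if "c \<in> carrier R" "u \<in> D" for c u
    using quo_in_Idl_iff[of "{(a, sa), (b, sb)}" c u] that a b ac bc by simp
  have aIdl: "quo c u \<in> Idl\<^bsub>loc.Loc\<^esub> {\<alpha>} \<longleftrightarrow> (\<exists>w\<in>D. w * c \<in> Idl\<^bsub>R\<^esub> (I \<union> {a}))"
    if "c \<in> carrier R" "u \<in> D" for c u
    using quo_in_Idl_iff[of "{(a, sa)}" c u] that a ac by simp
  have pw: "\<exists>s\<in>D. \<exists>N. s * X v ^ Suc N \<in> Idl\<^bsub>R\<^esub> (I \<union> {a, b})" if v: "v \<in> V" for v
  proof -
    have Xv: "X v \<in> carrier R" by (rule X_closed[OF v])
    then have "X v \<in> M" by (simp add: face_prime_def res_X)
    then have "quo (X v) 1 \<in> m_loc" unfolding m_loc_eq using D_one by blast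
    then obtain e :: nat where "quo (X v) 1 [^]\<^bsub>loc.Loc\<^esub> e \<in> Idl\<^bsub>loc.Loc\<^esub> {\<alpha>, \<beta>}"
      using sop unfolding system_of_parameters_def xs by auto
    then have "quo (X v ^ e) (1 ^ e) \<in> Idl\<^bsub>loc.Loc\<^esub> {\<alpha>, \<beta>}" using quo_pow[OF Xv D_one] by simp
    then obtain s where s: "s \<in> D" "s * X v ^ e \<in> Idl\<^bsub>R\<^esub> (I \<union> {a, b})"
      using mIdl[OF poly_power_closed[OF Xv] D_pow[OF D_one]] by blast
    \<comment> \<open>One more factor makes the exponent positive, which the edges without \<open>v\<close> need later on.\<close>
    have "X v * (s * X v ^ e) \<in> Idl\<^bsub>R\<^esub> (I \<union> {a, b})"
      using ac bc by (intro poly_idealD(4)[OF ideal_Idl Xv s(2)]) auto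
    then have "s * X v ^ Suc e \<in> Idl\<^bsub>R\<^esub> (I \<union> {a, b})" by (simp add: mult_ac)
    thus ?thesis using s(1) by blast
  qed
  have edge: "\<exists>y. e = {x, y} \<and> x \<noteq> y" if "e \<in> \<Delta>" "card e = 2" "x \<in> e" for e x
    using that by (auto simp: card_2_iff insert_commute)
  have a_edge: "res e a \<noteq> 0" if e: "e \<in> \<Delta>" "card e = 2" for e
  proof -
    obtain x y where xy: "e = {x, y}" "x \<noteq> y" using e by (auto simp: card_2_iff)
    have V: "x \<in> V" "y \<in> V" using faceV[OF e(1)] xy by auto
    show ?thesis
      using pw[OF V(1)] pw[OF V(2)] parameter_nonzero_on_edge[OF ac b(1) _ xy(2)] e(1) xy(1) by blast
  qed
  have sup: "colon loc.Loc J m_loc \<subseteq> colon loc.Loc J {\<mu>}" if "\<mu> \<in> m_loc" for J \<mu>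
    using that by (auto simp: colon_def)
  have "colon loc.Loc (Idl\<^bsub>loc.Loc\<^esub> {}) {\<alpha>} \<subseteq> colon loc.Loc (Idl\<^bsub>loc.Loc\<^esub> {}) m_loc"
  proof
    fix z assume z: "z \<in> colon loc.Loc (Idl\<^bsub>loc.Loc\<^esub> {}) {\<alpha>}"
    then have "z \<in> carrier loc.Loc" by (simp add: colon_def)
    then obtain c u where c: "c \<in> carrier R" "u \<in> D" "z = quo c u" by (rule loc_elem)
    have "quo (a * c) (sa * u) \<in> Idl\<^bsub>loc.Loc\<^esub> {}"
      using z c a(3) quo_mult[OF ac c(1) a(2) c(2)] by (simp add: colon_def)
    then obtain w where w: "w \<in> D" "w * (a * c) \<in> I"
      using quo_in_Idl_empty_iff[OF poly_mult_closed[OF ac c(1)] D_mult[OF a(2) c(2)]] by blast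
    have "c \<in> I" unfolding sr_ideal_iff
    proof (intro conjI ballI c(1))
      fix F assume "F \<in> \<Delta>"
      then obtain e where e: "e \<in> \<Delta>" "F \<subseteq> e" "card e = 2" using dim by blast
      have "res e (w * (a * c)) = 0" by (rule res_in_sr[OF w(2) e(1)])
      then have "res e c = 0" using D_res[OF w(1), of e] a_edge[OF e(1,3)] by simp
      then have "res F (res e c) = 0" by simp
      thus "res F c = 0" using e(2) by (simp add: Int_absorb2)
    qed
    show "z \<in> colon loc.Loc (Idl\<^bsub>loc.Loc\<^esub> {}) m_loc"
      unfolding colon_def
    proof (intro CollectI conjI ballI)
      show "z \<in> carrier loc.Loc" by fact
      fix \<mu> assume "\<mu> \<in> m_loc"
      then obtain p s where p: "p \<in> M" "s \<in> D" "\<mu> = quo p s" unfolding m_loc_eq by blast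
      have pc: "p \<in> carrier R" using p(1) by (simp add: face_prime_def)
      have "1 * (p * c) \<in> I" using poly_idealD(4)[OF sr_ideal_ideal pc \<open>c \<in> I\<close>] by simp
      then have "quo (p * c) (s * u) \<in> Idl\<^bsub>loc.Loc\<^esub> {}"
        using quo_in_Idl_empty_iff[OF poly_mult_closed[OF pc c(1)] D_mult[OF p(2) c(2)]] D_one by blast
      thus "\<mu> \<otimes>\<^bsub>loc.Loc\<^esub> z \<in> Idl\<^bsub>loc.Loc\<^esub> {}" using p(3) c(3) quo_mult[OF pc c(1) p(2) c(2)] by simp
    qed
  qed
  moreover have "colon loc.Loc (Idl\<^bsub>loc.Loc\<^esub> {\<alpha>}) {\<beta>} \<subseteq> colon loc.Loc (Idl\<^bsub>loc.Loc\<^esub> {\<alpha>}) m_loc"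
  proof
    fix z assume z: "z \<in> colon loc.Loc (Idl\<^bsub>loc.Loc\<^esub> {\<alpha>}) {\<beta>}"
    then have zc: "z \<in> carrier loc.Loc" by (simp add: colon_def)
    then obtain c u where c: "c \<in> carrier R" "u \<in> D" "z = quo c u" by (rule loc_elem)
    let ?J = "Idl\<^bsub>R\<^esub> (I \<union> {a})"
    have J: "ideal ?J R" using ac by (intro ideal_Idl) auto
    have "quo (b * c) (sb * u) \<in> Idl\<^bsub>loc.Loc\<^esub> {\<alpha>}"
      using z c b(3) quo_mult[OF bc c(1) b(2) c(2)] by (simp add: colon_def)
    then obtain w0 where w0: "w0 \<in> D" "w0 * (b * c) \<in> ?J"
      using aIdl[OF poly_mult_closed[OF bc c(1)] D_mult[OF b(2) c(2)]] by blast
    have step: "\<exists>s\<in>D. \<exists>N. \<exists>p\<in>carrier R. \<exists>i\<in>I. s * X v ^ Suc N * c = i + p * a" if v: "v \<in> V" for v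
    proof -
      obtain s N where s: "s \<in> D" "s * X v ^ Suc N \<in> Idl\<^bsub>R\<^esub> (I \<union> {a, b})" using pw[OF v] by blast
      obtain i g h where g: "i \<in> I" "g \<in> carrier R" "h \<in> carrier R" "s * X v ^ Suc N = i + g * a + h * b"
        using s(2) unfolding Idl_two_iff[OF ac bc] by blast
      have w0c: "w0 * c \<in> carrier R" by (intro poly_mult_closed D_carrier w0(1) c(1))
      have aJ: "a \<in> ?J" "i \<in> ?J"
        using R.genideal_self[of "I \<union> {a}"] sr_ideal_carrier ac g(1) by auto
      have "(w0 * s) * X v ^ Suc N * c = (w0 * c) * (s * X v ^ Suc N)" by (simp add: mult_ac)
      also have "\<dots> = (w0 * c) * i + (w0 * c * g) * a + h * (w0 * (b * c))"
        unfolding g(4) by (simp add: algebra_simps)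
      also have "\<dots> \<in> ?J"
        by (intro poly_idealD(3)[OF J] poly_idealD(4)[OF J] w0c aJ g(2,3) w0(2) poly_mult_closed[OF w0c])
      finally show ?thesis unfolding Idl_one_iff[OF ac] using D_mult[OF w0(1) s(1)] by blast
    qed
    have var_ok: "\<exists>s\<in>D. s * (X x * c) \<in> ?J" if x: "x \<in> V" for x
    proof -
      obtain s N p i where s: "s \<in> D" "p \<in> carrier R" "i \<in> I" "s * X x ^ Suc N * c = i + p * a"
        using step[OF x] by blast
      \<comment> \<open>Only the monomials supported on faces can be controlled; the others vanish in the quotient.\<close>
      let ?p = "restr (\<lambda>w. keys w \<in> \<Delta>) p"
      have pc: "?p \<in> carrier R" by (rule restr_closed[OF s(2)])
      have low: "Suc N \<le> lookup w x" if w: "w \<in> keys ?p" for w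
      proof -
        have wp: "w \<in> keys p" "keys w \<in> \<Delta>" using w by (auto simp: keys_restr)
        then obtain e where e: "e \<in> \<Delta>" "keys w \<subseteq> e" "card e = 2" using dim by blast
        have we: "w \<in> keys (res e p)" using wp e by (simp add: keys_res)
        have "res e (s * X x ^ Suc N * c) = res e (i + p * a)" using s(4) by simp
        then have e1: "res e s * res e (X x) ^ Suc N * res e c = res e p * res e a"
          using res_in_sr[OF s(3) e(1)] by simp
        have ae: "res e a \<noteq> 0" by (rule a_edge[OF e(1,3)])
        have "x \<in> e"
        proof (rule ccontr)
          assume "x \<notin> e"
          then have "res e p = 0" using e1 ae by (simp add: res_X)
          thus False using we by simp
        qed
        then obtain y where y: "e = {x, y}" "x \<noteq> y" using edge[OF e(1,3)] by blast
        have "y \<in> V" using faceV[OF e(1)] y by auto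
        then obtain s' N' q j where s': "s' \<in> D" "q \<in> carrier R" "j \<in> I" "s' * X y ^ Suc N' * c = j + q * a"
          using step by blast
        have "res e (s' * X y ^ Suc N' * c) = res e (j + q * a)" using s'(4) by simp
        then have e2: "res e s' * X y ^ Suc N' * res e c = res e q * res e a"
          using res_in_sr[OF s'(3) e(1)] y by (simp add: res_X)
        have e1': "res e s * X x ^ Suc N * res e c = res e p * res e a"
          using e1 y by (simp add: res_X)
        have "res e a * (res e s' * X y ^ Suc N' * res e p) = res e s' * X y ^ Suc N' * (res e p * res e a)"
          by (simp only: mult_ac)
        also have "\<dots> = res e s * X x ^ Suc N * (res e s' * X y ^ Suc N' * res e c)"
          unfolding e1'[symmetric] by (simp only: mult_ac)
        also have "\<dots> = res e a * (X x ^ Suc N * (res e s * res e q))"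
          unfolding e2 by (simp only: mult_ac)
        finally have "res e s' * X y ^ Suc N' * res e p = X x ^ Suc N * (res e s * res e q)"
          using ae by simp
        from X_power_dvd_on_edge[OF y(2) s'(1) s(2) this[unfolded y(1)]] we show ?thesis
          unfolding y(1) by blast
      qed
      obtain p'' where p'': "p'' \<in> carrier R" "?p = X x ^ Suc N * p''"
        using divide_by_X_power[OF pc low] by blast
      let ?d = "s * c - p'' * a"
      have dc: "?d \<in> carrier R"
        by (intro poly_minus_closed poly_mult_closed D_carrier s(1) c(1) p''(1) ac)
      have rp: "res F p = res F ?p" if "F \<in> \<Delta>" for F
        by (rule poly_mapping_eqI) (use that down in \<open>auto simp: lookup_res lookup_restr\<close>)
      have "X x * ?d \<in> I" unfolding sr_ideal_iff
      proof (intro conjI ballI poly_mult_closed X_closed[OF x] dc)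
        fix F assume F: "F \<in> \<Delta>"
        show "res F (X x * ?d) = 0"
        proof (cases "x \<in> F")
          case True
          have "X x ^ Suc N * ?d = s * X x ^ Suc N * c - ?p * a"
            unfolding p''(2) by (simp add: algebra_simps)
          also have "\<dots> = i + (p - ?p) * a" unfolding s(4) by (simp add: algebra_simps)
          finally have "res F (X x ^ Suc N * ?d) = res F (i + (p - ?p) * a)" by simp
          then have "X x ^ Suc N * res F ?d = 0"
            using res_in_sr[OF s(3) F] rp[OF F] True by (simp add: res_X del: res_minus) (simp add: rp[OF F])
          then have "res F ?d = 0" by (simp del: res_minus)
          thus ?thesis by (simp del: res_minus)
        qed (simp add: res_X)
      qed
      moreover have "s * (X x * c) = X x * ?d + (X x * p'') * a" by (simp add: algebra_simps)
      ultimately show ?thesis unfolding Idl_one_iff[OF ac]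
        using s(1) poly_mult_closed[OF X_closed[OF x] p''(1)] by blast
    qed
    \<comment> \<open>The multipliers of \<open>c\<close> into the localized ideal form an ideal, so the variables suffice.\<close>
    let ?K = "{p \<in> polys k V. \<exists>s\<in>D. s * (p * c) \<in> ?J}"
    have K: "ideal ?K R"
    proof (rule poly_idealI)
      show "0 \<in> ?K" using D_one poly_zero_closed poly_idealD(2)[OF J] by auto
      fix p q
      show "p + q \<in> ?K" if pK: "p \<in> ?K" and qK: "q \<in> ?K"
      proof -
        obtain s t where st: "s \<in> D" "s * (p * c) \<in> ?J" "t \<in> D" "t * (q * c) \<in> ?J" using pK qK by blast
        have "(s * t) * ((p + q) * c) = t * (s * (p * c)) + s * (t * (q * c))" by (simp add: algebra_simps)
        also have "\<dots> \<in> ?J"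
          by (intro poly_idealD(3)[OF J] poly_idealD(4)[OF J] D_carrier st)
        finally show ?thesis using D_mult[OF st(1,3)] pK qK poly_add_closed by blast
      qed
      show "p * q \<in> ?K" if p: "p \<in> carrier R" and qK: "q \<in> ?K"
      proof -
        obtain s where st: "s \<in> D" "s * (q * c) \<in> ?J" using qK by blast
        have "s * (p * q * c) = p * (s * (q * c))" by (simp add: mult_ac)
        also have "\<dots> \<in> ?J" by (rule poly_idealD(4)[OF J p st(2)])
        finally show ?thesis using st(1) p qK poly_mult_closed by blast
      qed
    qed auto
    have "M \<subseteq> ?K" unfolding ideal_of_variables[symmetric]
    proof (rule R.genideal_minimal[OF K])
      have "i \<in> ?K" if i: "i \<in> I" for i
      proof -
        have "1 * (i * c) \<in> ?J"
          using poly_idealD(5)[OF sr_ideal_ideal c(1) i] R.genideal_self[of "I \<union> {a}"] sr_ideal_carrier ac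
          by auto
        thus ?thesis using D_one sr_ideal_carrier[OF i] by blast
      qed
      moreover have "X v \<in> ?K" if "v \<in> V" for v using var_ok[OF that] X_closed[OF that] by blast
      ultimately show "I \<union> X ` V \<subseteq> ?K" by blast
    qed
    show "z \<in> colon loc.Loc (Idl\<^bsub>loc.Loc\<^esub> {\<alpha>}) m_loc"
      unfolding colon_def
    proof (intro CollectI conjI ballI)
      show "z \<in> carrier loc.Loc" by fact
      fix \<mu> assume "\<mu> \<in> m_loc"
      then obtain p s where p: "p \<in> M" "s \<in> D" "\<mu> = quo p s" unfolding m_loc_eq by blast
      have pc: "p \<in> carrier R" using p(1) by (simp add: face_prime_def)
      have "quo (p * c) (s * u) \<in> Idl\<^bsub>loc.Loc\<^esub> {\<alpha>}"
        using aIdl[OF poly_mult_closed[OF pc c(1)] D_mult[OF p(2) c(2)]] \<open>M \<subseteq> ?K\<close> p(1) by blast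
      thus "\<mu> \<otimes>\<^bsub>loc.Loc\<^esub> z \<in> Idl\<^bsub>loc.Loc\<^esub> {\<alpha>}" using p(3) c(3) quo_mult[OF pc c(1) p(2) c(2)] by simp
    qed
  qed
  moreover have \<alpha>\<beta>: "\<alpha> \<in> m_loc" "\<beta> \<in> m_loc" using sop unfolding system_of_parameters_def xs by auto
  ultimately have "colon loc.Loc (Idl\<^bsub>loc.Loc\<^esub> {}) {\<alpha>} = colon loc.Loc (Idl\<^bsub>loc.Loc\<^esub> {}) m_loc"
    and "colon loc.Loc (Idl\<^bsub>loc.Loc\<^esub> {\<alpha>}) {\<beta>} = colon loc.Loc (Idl\<^bsub>loc.Loc\<^esub> {\<alpha>}) m_loc"
    using sup[OF \<alpha>\<beta>(1)] sup[OF \<alpha>\<beta>(2)] by (blast intro: subset_antisym)+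
  thus "weak_sequence loc.Loc m_loc xs"
    unfolding weak_sequence_def xs by (simp add: less_Suc_eq numeral_2_eq_2)
qed

end

section \<open>Links of joins\<close>

lemma facets_join:
  assumes "Z \<inter> \<Union>G = {}"
  shows "facets (join Z G) = (\<lambda>F. Z \<union> F) ` facets G"
proof (intro equalityI subsetI)
  fix H assume H: "H \<in> facets (join Z G)"
  then obtain S F where h: "H = S \<union> F" "S \<subseteq> Z" "F \<in> G" by (auto simp: facets_def join_def)
  then have "Z \<union> F \<in> join Z G" "H \<subseteq> Z \<union> F" by (auto simp: join_def)
  then have e: "H = Z \<union> F" using H by (auto simp: facets_def)
  have "F \<in> facets G" unfolding facets_def
  proof (intro CollectI conjI ballI impI h(3))
    fix F' assume F': "F' \<in> G" "F \<subseteq> F'"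
    then have "Z \<union> F' \<in> join Z G" "H \<subseteq> Z \<union> F'" using e by (auto simp: join_def)
    then have "Z \<union> F' = Z \<union> F" using H e by (auto simp: facets_def)
    thus "F' = F" using assms F' h(3) by blast
  qed
  thus "H \<in> (\<lambda>F. Z \<union> F) ` facets G" using e by blast
next
  fix H assume "H \<in> (\<lambda>F. Z \<union> F) ` facets G"
  then obtain F where F: "F \<in> facets G" "H = Z \<union> F" by auto
  have "H' = H" if "H' \<in> join Z G" "H \<subseteq> H'" for H'
  proof -
    obtain S F' where h: "H' = S \<union> F'" "S \<subseteq> Z" "F' \<in> G" using \<open>H' \<in> _\<close> by (auto simp: join_def)
    have "F \<in> G" using F by (simp add: facets_def)
    then have "F \<subseteq> F'" using h F(2) \<open>H \<subseteq> H'\<close> assms by blast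
    then have "F' = F" using F(1) h(3) by (simp add: facets_def)
    thus ?thesis using h F(2) \<open>H \<subseteq> H'\<close> by blast
  qed
  moreover have "H \<in> join Z G" using F by (auto simp: join_def facets_def)
  ultimately show "H \<in> facets (join Z G)" by (simp add: facets_def)
qed

lemma pure_join_iff:
  assumes "Z \<inter> \<Union>G = {}" "finite Z" "\<And>F. F \<in> G \<Longrightarrow> finite F"
  shows "pure (join Z G) \<longleftrightarrow> pure G"
proof -
  have "card (Z \<union> F) = card Z + card F" if "F \<in> facets G" for F
    using that assms by (intro card_Un_disjoint) (auto simp: facets_def)
  thus ?thesis unfolding pure_def facets_join[OF assms(1)] by auto
qed

text \<open>
  Here \<open>F \<inter> \<Union>G\<close> is the part of the face \<open>F\<close> in the second factor.
\<close>

lemma link_join: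
  assumes Z: "Z \<inter> \<Union>G = {}" and G: "down_closed G" and F: "F \<in> join Z G"
  shows "link (join Z G) F = join (Z - F) (link G (F \<inter> \<Union>G))"
proof (intro equalityI subsetI)
  obtain S H where h: "F = S \<union> H" "S \<subseteq> Z" "H \<in> G" using F by (auto simp: join_def)
  have FG: "F \<inter> \<Union>G = H" using h Z by blast
  fix K
  {
    assume K: "K \<in> link (join Z G) F"
    then obtain S' H' where k: "K = S' \<union> H'" "S' \<subseteq> Z" "H' \<in> G" by (auto simp: link_def join_def)
    obtain S'' H'' where k': "K \<union> F = S'' \<union> H''" "S'' \<subseteq> Z" "H'' \<in> G"
      using K by (auto simp: link_def join_def)
    have "H' \<union> H \<subseteq> H''" using k k' h Z by blast
    then have "H' \<union> H \<in> G" using k'(3) G unfolding down_closed_def by blast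
    moreover have "H' \<inter> H = {}" "S' \<subseteq> Z - F" using K k h by (auto simp: link_def)
    ultimately have "H' \<in> link G H" "S' \<subseteq> Z - F" using k(3) by (auto simp: link_def)
    thus "K \<in> join (Z - F) (link G (F \<inter> \<Union>G))" unfolding FG using k(1) by (auto simp: join_def)
  next
    assume "K \<in> join (Z - F) (link G (F \<inter> \<Union>G))"
    then obtain S' H' where k: "K = S' \<union> H'" "S' \<subseteq> Z - F" "H' \<in> G" "H' \<union> H \<in> G" "H' \<inter> H = {}"
      unfolding FG by (auto simp: join_def link_def)
    have KJ: "K \<in> join Z G" using k by (auto simp: join_def)
    have "K \<union> F = (S' \<union> S) \<union> (H' \<union> H)" using k h by auto
    moreover have "S' \<union> S \<subseteq> Z" using k h by auto
    ultimately have "K \<union> F \<in> join Z G" using k(4) unfolding join_def by blast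
    moreover have "K \<inter> F = {}" using k h Z by blast
    ultimately show "K \<in> link (join Z G) F" using KJ by (simp add: link_def)
  }
qed

lemma face_of_join:
  assumes "Z \<inter> \<Union>G = {}" "F \<in> join Z G" shows "F \<inter> \<Union>G \<in> G" "F \<subseteq> Z \<union> \<Union>G"
proof -
  obtain S H where h: "F = S \<union> H" "S \<subseteq> Z" "H \<in> G" using assms(2) by (auto simp: join_def)
  then have "F \<inter> \<Union>G = H" using assms(1) by blast
  thus "F \<inter> \<Union>G \<in> G" "F \<subseteq> Z \<union> \<Union>G" using h by auto
qed

lemma join_single: "join Z {{}} = Pow Z"
  by (auto simp: join_def)

lemma link_empty: "down_closed G \<Longrightarrow> link G {} = G"
  by (auto simp: link_def down_closed_def)

lemma cohen_macaulay_link_points: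
  assumes V: "finite V" "Z \<subseteq> V" "W \<subseteq> V" "Z \<inter> W = {}" "W \<noteq> {}" and F: "F \<in> join Z (points W)"
  shows "cohen_macaulay k (V - F) (link (join Z (points W)) F)"
proof -
  have l: "link (join Z (points W)) F = join (Z - F) (link (points W) (F \<inter> W))"
    using link_join[of Z "points W" F] V F down_closed_points by (simp add: Union_points)
  have "F \<inter> W \<in> points W" using face_of_join(1)[of Z "points W" F] V F by (simp add: Union_points)
  then consider "F \<inter> W = {}" | w where "w \<in> W" "F \<inter> W = {w}" by (auto simp: points_def)
  thus ?thesis
  proof cases
    case 1
    show ?thesis unfolding l 1 link_empty[OF down_closed_points]
      using V 1 by (intro cohen_macaulay_join_points) auto
  next
    case 2
    have "link (points W) {w} = {{}}" using 2 by (auto simp: link_def points_def)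
    thus ?thesis unfolding l 2(2) using V by (auto simp: join_single intro!: cohen_macaulay_simplex)
  qed
qed

text \<open>
  The graph part of the link is the whole graph, the set of neighbours of a vertex, or empty.  Only in
  the first case does connectedness matter.
\<close>

lemma cohen_macaulay_link_graph:
  assumes V: "finite V" "Z \<subseteq> V" "\<Union>E \<subseteq> V" "Z \<inter> \<Union>E = {}" and E: "\<And>e. e \<in> E \<Longrightarrow> card e = 2"
    and F: "F \<in> join Z (graph E)" and c: "F \<inter> \<Union>E \<noteq> {} \<or> connected_edges E"
  shows "cohen_macaulay k (V - F) (link (join Z (graph E)) F)"
proof -
  have l: "link (join Z (graph E)) F = join (Z - F) (link (graph E) (F \<inter> \<Union>E))"
    using link_join[of Z "graph E" F] V F down_closed_graph by (simp add: Union_graph)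
  have "F \<inter> \<Union>E \<in> graph E" using face_of_join(1)[of Z "graph E" F] V F by (simp add: Union_graph)
  then obtain e where e: "e \<in> E" "F \<inter> \<Union>E \<subseteq> e" by (auto simp: graph_def)
  obtain x y where xy: "e = {x, y}" "x \<noteq> y" using E[OF e(1)] by (auto simp: card_2_iff)
  consider "F \<inter> \<Union>E = {}" | w where "w \<in> e" "F \<inter> \<Union>E = {w}" | "F \<inter> \<Union>E = e" using e xy by blast
  thus ?thesis
  proof cases
    case 1
    then have ce: "connected_edges E" using c by auto
    show ?thesis unfolding l 1 link_empty[OF down_closed_graph]
      using V 1 by (intro cohen_macaulay_join_connected[OF _ _ _ _ ce]) auto
  next
    case 2
    let ?W = "{a. a \<noteq> w \<and> {w, a} \<in> E}"
    have "link (graph E) {w} = points ?W"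
    proof (intro equalityI subsetI)
      fix H assume H: "H \<in> link (graph E) {w}"
      then obtain e' where e': "e' \<in> E" "insert w H \<subseteq> e'" by (auto simp: link_def graph_def)
      then obtain a where a: "e' = {w, a}" "a \<noteq> w" using E[OF e'(1)] by (auto simp: card_2_iff)
      then have "H \<subseteq> {a}" using H e' by (auto simp: link_def)
      thus "H \<in> points ?W" using a e'(1) by (auto simp: points_def subset_singleton_iff)
    next
      fix H assume "H \<in> points ?W"
      thus "H \<in> link (graph E) {w}" using 2 e(1) by (auto simp: points_def link_def graph_def)
    qed
    moreover have "?W \<noteq> {}" "?W \<subseteq> \<Union>E" using 2(1) xy e(1) by (auto simp: insert_commute)
    moreover have "?W \<inter> F = {}"
    proof -
      have "?W \<inter> F \<subseteq> F \<inter> \<Union>E" using \<open>?W \<subseteq> \<Union>E\<close> by auto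
      thus ?thesis unfolding 2(2) by auto
    qed
    ultimately show ?thesis unfolding l 2(2) using V
      by (auto intro!: cohen_macaulay_join_points)
  next
    case 3
    have "link (graph E) e = {{}}"
    proof (intro equalityI subsetI)
      fix H assume H: "H \<in> link (graph E) e"
      then obtain e' where e': "e' \<in> E" "e \<union> H \<subseteq> e'" by (auto simp: link_def graph_def)
      have "finite e'" using E[OF e'(1)] by (metis card.infinite zero_neq_numeral)
      then have "e = e'" using e' E[OF e'(1)] E[OF e(1)] by (intro card_subset_eq) auto
      thus "H \<in> {{}}" using H e' by (auto simp: link_def)
    qed (use e(1) in \<open>auto simp: link_def graph_def\<close>)
    thus ?thesis unfolding l 3 using V by (auto simp: join_single intro!: cohen_macaulay_simplex)
  qed
qed

section \<open>Lexicographic segments of squarefree quadrics\<close>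

lemma keys_pair: "keys (var a + var b) = {a, b}"
  by (auto simp: keys_monomial_add)

lemma lookup_pair: "a \<noteq> b \<Longrightarrow> lookup (var a + var b) c = (if c = a \<or> c = b then 1 else 0)"
  by (simp add: lookup_add lookup_var)

lemma pair_eq_iff:
  assumes "a < b" "c < d" shows "var a + var b = var c + var d \<longleftrightarrow> a = c \<and> b = d"
proof
  assume "var a + var b = var c + var d"
  then have "{a, b} = {c, d}" using keys_pair by metis
  thus "a = c \<and> b = d" using assms by (auto simp: doubleton_eq_iff)
qed simp

lemma M2_iff: "w \<in> M2 n \<longleftrightarrow> (\<exists>a b. 1 \<le> a \<and> a < b \<and> b \<le> n \<and> w = var a + var b)"
proof
  assume w: "w \<in> M2 n"
  then have one: "lookup w c = 1" if "c \<in> keys w" for c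
  proof -
    have "lookup w c \<le> 1" using w by (auto simp: M2_def)
    moreover have "lookup w c \<noteq> 0" using that by (simp add: in_keys_iff)
    ultimately show ?thesis by simp
  qed
  then have "(\<Sum>c\<in>keys w. lookup w c) = card (keys w)" by simp
  then have "card (keys w) = 2" using w by (simp add: M2_def)
  then obtain x y where "keys w = {x, y}" "x \<noteq> y" by (auto simp: card_2_iff)
  then have "x < y \<or> y < x" by auto
  then obtain a b where ab: "keys w = {a, b}" "a < b"
  proof
    assume "x < y" thus thesis using that[of x y] \<open>keys w = _\<close> by blast
  next
    assume "y < x" thus thesis using that[of y x] \<open>keys w = _\<close> by (simp add: insert_commute)
  qed
  have "w = var a + var b"
  proof (rule poly_mapping_eqI)
    fix c
    show "lookup w c = lookup (var a + var b) c"
    proof (cases "c \<in> {a, b}")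
      case True
      then have "lookup w c = 1" using one[of c] unfolding ab(1) by blast
      thus ?thesis using True ab(2) by (auto simp: lookup_pair)
    next
      case False
      then have "c \<notin> keys w" unfolding ab(1) .
      thus ?thesis using False ab(2) by (simp add: lookup_pair in_keys_iff)
    qed
  qed
  moreover have "keys w \<subseteq> {1..n}" using w by (simp add: M2_def)
  then have "1 \<le> a" "b \<le> n" using ab(1) by auto
  ultimately show "\<exists>a b. 1 \<le> a \<and> a < b \<and> b \<le> n \<and> w = var a + var b" using ab by blast
next
  assume "\<exists>a b. 1 \<le> a \<and> a < b \<and> b \<le> n \<and> w = var a + var b"
  then obtain a b where "1 \<le> a" "a < b" "b \<le> n" "w = var a + var b" by blast
  thus "w \<in> M2 n" by (auto simp: M2_def keys_pair lookup_pair)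
qed

lemma pair_less:
  assumes "a < b" "c < d" "c < a \<or> c = a \<and> d < b"
  shows "var a + var b < var c + var d"
proof -
  have "\<exists>m. lookup (var a + var b) m < lookup (var c + var d) m \<and>
      (\<forall>l<m. lookup (var a + var b) l = lookup (var c + var d) l)"
  proof (cases "c < a")
    case True
    thus ?thesis using assms by (intro exI[of _ c]) (auto simp: lookup_pair)
  next
    case False
    thus ?thesis using assms by (intro exI[of _ d]) (auto simp: lookup_pair)
  qed
  thus ?thesis by (simp add: less_poly_mapping.rep_eq less_fun_def)
qed

lemma pair_le_iff:
  assumes "a < b" "c < d"
  shows "var a + var b \<le> var c + var d \<longleftrightarrow> c < a \<or> c = a \<and> d \<le> b"
proof (cases "c < a \<or> c = a \<and> d < b")
  case True
  thus ?thesis using pair_less[OF assms] by auto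
next
  case False
  then consider "a < c \<or> a = c \<and> b < d" | "a = c" "b = d" by linarith
  thus ?thesis
  proof cases
    case 1
    then have "var c + var d < var a + var b" using pair_less[OF assms(2,1)] by auto
    thus ?thesis using 1 by auto
  qed simp
qed

text \<open>
  A set is a face iff its squarefree monomial is not in the Stanley-Reisner ideal; so the complex can be
  read off from any monomial generators.
\<close>

lemma face_iff_of_ideal_eq:
  assumes c: "simplicial_complex V \<Delta>" and e: "sr_ideal k V \<Delta> = monomial_ideal k V W"
    and W: "\<And>g. g \<in> W \<Longrightarrow> keys g \<subseteq> V" and F: "F \<subseteq> V"
  shows "F \<in> \<Delta> \<longleftrightarrow> \<not> (\<exists>g\<in>W. \<exists>h. (\<Sum>v\<in>F. var v) = g + h)"
proof -
  interpret complex k V \<Delta> by unfold_locales (rule c)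
  have fin: "finite F" using finite_subset[OF F finV] .
  let ?p = "single (\<Sum>v\<in>F. var v) 1 :: 'a mpoly"
  have pc: "?p \<in> carrier R" using F fin by (simp add: carrier_poly_ring keys_sum_var)
  have "F \<notin> \<Delta> \<longleftrightarrow> ?p \<in> I" using pc fin by (simp add: sr_ideal_iff_keys keys_sum_var)
  also have "\<dots> \<longleftrightarrow> (\<exists>g\<in>W. \<exists>h. (\<Sum>v\<in>F. var v) = g + h)"
    unfolding e using monomial_ideal_iff[of W V ?p k] W pc by simp
  finally show ?thesis by blast
qed

lemma pair_le_face_iff:
  assumes "finite F" "a < b"
  shows "(\<exists>h. (\<Sum>v\<in>F. var v) = var a + var b + h) \<longleftrightarrow> a \<in> F \<and> b \<in> F"
proof -
  have "(\<exists>h. (\<Sum>v\<in>F. var v) = (var a + var b) + h) \<longleftrightarrow>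
    (\<forall>c. (if c = a \<or> c = b then 1 else 0) \<le> (if c \<in> F then 1 else (0::nat)))"
    unfolding monomial_le_iff using assms by (simp add: lookup_pair lookup_sum_var)
  also have "\<dots> \<longleftrightarrow> a \<in> F \<and> b \<in> F" by auto
  finally show ?thesis .
qed

section \<open>Classification of the pure complexes\<close>

lemma star_connected:
  assumes "finite A" "A \<noteq> {}" "c \<notin> A"
  shows "connected_edges ((\<lambda>a. {c, a}) ` A)"
  using assms
proof (induction A rule: finite_ne_induct)
  case (singleton a)
  thus ?case using connected_edges.one[of "{c, a}"] by (simp add: card_2_iff doubleton_eq_iff)
next
  case (insert a A)
  obtain a' where "a' \<in> A" using insert by auto
  have "card {c, a} = 2" using insert.prems by auto
  moreover have "c \<in> {c, a} \<inter> \<Union>((\<lambda>a. {c, a}) ` A)" using \<open>a' \<in> A\<close> by blast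
  moreover have "connected_edges ((\<lambda>a. {c, a}) ` A)" using insert by auto
  ultimately show ?case using connected_edges.add[of "(\<lambda>a. {c, a}) ` A" "{c, a}"] by auto
qed

text \<open>
  The clique complex on \<open>{i..n}\<close> whose non-edges are the pairs from \<open>(i, j)\<close> down to \<open>(p, q)\<close> in the
  lexicographic order of monomials.  Non-edges are ordered pairs, named \<open>N\<close> below, so that the order
  conditions can be used as they stand.
\<close>

locale lex_segment_complex =
  fixes i j p q n :: nat and \<Gamma> :: "nat set set"
  assumes ij: "i < j" "j \<le> n" and pq: "p < q" "q \<le> n" and uv: "i < p \<or> i = p \<and> j < q"
    and faces: "\<And>F. F \<in> \<Gamma> \<longleftrightarrow> F \<subseteq> {i..n} \<and> (\<forall>a\<in>F. \<forall>b\<in>F.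
      \<not> (a < b \<and> (i < a \<or> i = a \<and> j \<le> b) \<and> (a < p \<or> a = p \<and> b \<le> q)))"
begin

definition N where "N a b \<longleftrightarrow> a < b \<and> (i < a \<or> i = a \<and> j \<le> b) \<and> (a < p \<or> a = p \<and> b \<le> q)"

lemma face_iff: "F \<in> \<Gamma> \<longleftrightarrow> F \<subseteq> {i..n} \<and> (\<forall>a\<in>F. \<forall>b\<in>F. \<not> N a b)"
  unfolding faces N_def ..

lemma down_closed: "down_closed \<Gamma>"
  unfolding down_closed_def by (auto simp: face_iff subset_iff)

lemma finite_face: "F \<in> \<Gamma> \<Longrightarrow> finite F"
  unfolding face_iff using finite_subset[OF _ finite_atLeastAtMost] by blast

lemma facetI:
  assumes "F \<in> \<Gamma>" "\<And>x. i \<le> x \<Longrightarrow> x \<le> n \<Longrightarrow> x \<notin> F \<Longrightarrow> \<exists>y\<in>F. N x y \<or> N y x"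
  shows "F \<in> facets \<Gamma>"
  unfolding facets_def
proof (intro CollectI conjI ballI impI assms(1))
  fix G assume G: "G \<in> \<Gamma>" "F \<subseteq> G"
  show "G = F"
  proof (rule ccontr)
    assume "G \<noteq> F"
    then obtain x where "x \<in> G" "x \<notin> F" using G(2) by auto
    moreover from this have "i \<le> x" "x \<le> n" using G(1) unfolding face_iff by auto
    ultimately obtain y where "y \<in> F" "N x y \<or> N y x" using assms(2) by blast
    thus False using G \<open>x \<in> G\<close> unfolding face_iff by blast
  qed
qed

lemma pureD: "pure \<Gamma> \<Longrightarrow> F \<in> facets \<Gamma> \<Longrightarrow> G \<in> facets \<Gamma> \<Longrightarrow> card F = card G"
  unfolding pure_def by blast

text \<open>
  A clique complex without triangles and isolated vertices is one-dimensional: it consists of the edges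
  and their subsets.
\<close>

lemma edges_eq_graph:
  assumes tri: "\<And>a b c. i \<le> a \<Longrightarrow> a < b \<Longrightarrow> b < c \<Longrightarrow> c \<le> n \<Longrightarrow> N a b \<or> N b c \<or> N a c"
    and E: "\<And>e. e \<in> E \<longleftrightarrow> (\<exists>a b. e = {a, b} \<and> i \<le> a \<and> a < b \<and> b \<le> n \<and> \<not> N a b)"
    and cov: "{i..n} \<subseteq> \<Union>E"
  shows "\<Gamma> = graph E"
proof (intro equalityI subsetI)
  fix F assume F: "F \<in> \<Gamma>"
  have FV: "F \<subseteq> {i..n}" and ne: "\<And>a b. a \<in> F \<Longrightarrow> b \<in> F \<Longrightarrow> \<not> N a b" using F unfolding face_iff by auto
  have fin: "finite F" by (rule finite_face[OF F])
  show "F \<in> graph E"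
  proof (cases "F = {}")
    case True
    have "i \<in> {i..n}" using ij by simp
    then obtain e where "e \<in> E" using cov by blast
    thus ?thesis using True by (auto simp: graph_def)
  next
    case False
    define a where "a = Min F"
    have a: "a \<in> F" "\<And>x. x \<in> F \<Longrightarrow> a \<le> x" using fin False by (auto simp: a_def)
    show ?thesis
    proof (cases "F - {a} = {}")
      case True
      then have "F = {a}" using a by auto
      thus ?thesis using a FV cov by (auto simp: graph_def)
    next
      case ne2: False
      define b where "b = Min (F - {a})"
      have "b \<in> F - {a}" unfolding b_def using fin ne2 by (intro Min_in) auto
      then have b: "b \<in> F" "a < b" "\<And>x. x \<in> F \<Longrightarrow> x \<noteq> a \<Longrightarrow> b \<le> x"
        using a(2)[of b] fin by (auto simp: b_def)
      have "x \<in> {a, b}" if x: "x \<in> F" for x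
      proof (rule ccontr)
        assume "x \<notin> {a, b}"
        then have "b < x" using b(3)[OF x] by auto
        then have "N a b \<or> N b x \<or> N a x"
          using tri[of a b x] b(2) subsetD[OF FV a(1)] subsetD[OF FV x] by auto
        thus False using ne a b x by blast
      qed
      then have "F = {a, b}" using a b by auto
      moreover have "i \<le> a" "b \<le> n" "\<not> N a b"
        using subsetD[OF FV a(1)] subsetD[OF FV b(1)] ne[OF a(1) b(1)] by auto
      ultimately have "F \<in> E" unfolding E using b(2) by blast
      thus ?thesis by (auto simp: graph_def)
    qed
  qed
next
  fix F assume "F \<in> graph E"
  then obtain e where "e \<in> E" "F \<subseteq> e" by (auto simp: graph_def)
  then obtain a b where "F \<subseteq> {a, b}" "i \<le> a" "a < b" "b \<le> n" "\<not> N a b" using E[of e] by blast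
  then have "{a, b} \<in> \<Gamma>" unfolding face_iff N_def by auto
  thus "F \<in> \<Gamma>" using \<open>F \<subseteq> {a, b}\<close> down_closed by (auto simp: down_closed_def)
qed

lemma top_facet: assumes "i < p" shows "{p+1..n} \<in> facets \<Gamma>"
proof (rule facetI)
  show "{p+1..n} \<in> \<Gamma>" using assms unfolding face_iff N_def by auto
  fix x assume x: "i \<le> x" "x \<le> n" "x \<notin> {p+1..n}"
  show "\<exists>y\<in>{p+1..n}. N x y \<or> N y x"
  proof (cases "x = p")
    case True thus ?thesis using assms pq unfolding N_def by (intro bexI[of _ q]) auto
  next
    case False thus ?thesis using assms x pq ij unfolding N_def by (intro bexI[of _ n]) auto
  qed
qed

text \<open>
  The shapes (a) and (b): in these two cases the complex is pure without being Cohen-Macaulay.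
\<close>

definition exceptional :: bool where
  "exceptional \<longleftrightarrow> (p + 2 = n \<and> q + 1 = n \<and> j = p \<and> i + 2 \<le> p) \<or>
     (p + 2 = n \<and> q = n \<and> j = p + 1 \<and> i + 1 \<le> p)"

text \<open>
  If \<open>i = p\<close>, all non-edges contain \<open>i\<close>: the facets are \<open>{i+1..n}\<close> and the one obtained by exchanging the
  at least two vertices \<open>{j..q}\<close> for \<open>i\<close>.
\<close>

lemma pure_imp_i_less_p: assumes "pure \<Gamma>" shows "i < p"
proof (rule ccontr)
  assume "\<not> i < p"
  then have e: "i = p" "j < q" using uv by auto
  have "{i+1..n} \<in> facets \<Gamma>"
  proof (rule facetI)
    show "{i+1..n} \<in> \<Gamma>" using e unfolding face_iff N_def by auto
    fix x assume "i \<le> x" "x \<le> n" "x \<notin> {i+1..n}"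
    thus "\<exists>y\<in>{i+1..n}. N x y \<or> N y x" using e pq ij unfolding N_def by (intro bexI[of _ q]) auto
  qed
  moreover have "{i..n} - {j..q} \<in> facets \<Gamma>"
  proof (rule facetI)
    show "{i..n} - {j..q} \<in> \<Gamma>" using e unfolding face_iff N_def by auto
    fix x assume "i \<le> x" "x \<le> n" "x \<notin> {i..n} - {j..q}"
    thus "\<exists>y\<in>{i..n} - {j..q}. N x y \<or> N y x" using e pq ij unfolding N_def by (intro bexI[of _ i]) auto
  qed
  ultimately have "card {i+1..n} = card ({i..n} - {j..q})" using pureD[OF assms] by blast
  moreover have "card ({i..n} - {j..q}) = card {i..n} - card {j..q}"
    using ij pq by (intro card_Diff_subset) auto
  ultimately show False using e ij pq by simp
qed

text \<open>
  All facets have the \<open>n - p\<close> vertices of \<open>{p+1..n}\<close>.  This size is compared with the other facets that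
  can be named, depending on the parameters: those containing \<open>p\<close>, and those containing \<open>i\<close>.  The last
  alternative of the conclusion is a simplex joined with a cycle of length four.
\<close>

lemma pure_sizes:
  assumes "pure \<Gamma>"
  shows "(j = i + 1 \<and> n = p + 1) \<or> n = p + 2 \<or> (p = i + 1 \<and> q = i + 2 \<and> j = n \<and> i + 2 < n)"
proof -
  have ip: "i < p" by (rule pure_imp_i_less_p[OF assms])
  have card: "card F = n - p" if "F \<in> facets \<Gamma>" for F
    using pureD[OF assms that top_facet[OF ip]] by simp
  have S1: "q = p + 1" if "q < n \<or> j \<le> p"
  proof -
    have "insert p {q+1..n} \<in> facets \<Gamma>"
    proof (rule facetI)
      show "insert p {q+1..n} \<in> \<Gamma>" using ip pq unfolding face_iff N_def by auto
      fix x assume x: "i \<le> x" "x \<le> n" "x \<notin> insert p {q+1..n}"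
      show "\<exists>y\<in>insert p {q+1..n}. N x y \<or> N y x"
      proof (cases "x = i \<and> q < n")
        case True thus ?thesis using ip ij unfolding N_def by (intro bexI[of _ n]) auto
      next
        case False thus ?thesis using that ip x unfolding N_def by (intro bexI[of _ p]) auto
      qed
    qed
    from card[OF this] show ?thesis using pq by simp
  qed
  have S2: "n = p + 2" if "q = n" "p < j"
  proof -
    have "{i, p} \<in> facets \<Gamma>"
    proof (rule facetI)
      show "{i, p} \<in> \<Gamma>" using ip pq that unfolding face_iff N_def by auto
      fix x assume x: "i \<le> x" "x \<le> n" "x \<notin> {i, p}"
      thus "\<exists>y\<in>{i, p}. N x y \<or> N y x" using that ip unfolding N_def by (intro bexI[of _ p]) auto
    qed
    from card[OF this] show ?thesis using ip pq by simp
  qed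
  have single: "n = p + 1" if "j = i + 1"
  proof -
    have "{i} \<in> facets \<Gamma>"
    proof (rule facetI)
      show "{i} \<in> \<Gamma>" using ip pq unfolding face_iff N_def by auto
      fix x assume "i \<le> x" "x \<le> n" "x \<notin> {i}"
      thus "\<exists>y\<in>{i}. N x y \<or> N y x" using that ip unfolding N_def by auto
    qed
    from card[OF this] show ?thesis using pq by simp
  qed
  have pair: "n = p + 2" if "i + 2 \<le> j" "i + 2 \<le> p \<or> j = i + 2"
  proof -
    have "{i, i + 1} \<in> facets \<Gamma>"
    proof (rule facetI)
      show "{i, i + 1} \<in> \<Gamma>" using ip pq that unfolding face_iff N_def by auto
      fix x assume x: "i \<le> x" "x \<le> n" "x \<notin> {i, i + 1}"
      show "\<exists>y\<in>{i, i + 1}. N x y \<or> N y x"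
      proof (cases "i + 2 \<le> p")
        case True thus ?thesis using x unfolding N_def by (intro bexI[of _ "i + 1"]) auto
      next
        case False thus ?thesis using that x ip unfolding N_def by (intro bexI[of _ i]) auto
      qed
    qed
    from card[OF this] show ?thesis using pq by simp
  qed
  have far: "j = n" if "p = i + 1" "i + 2 < j"
  proof -
    have "insert i {i+2..j-1} \<in> facets \<Gamma>"
    proof (rule facetI)
      show "insert i {i+2..j-1} \<in> \<Gamma>" using ip ij pq that unfolding face_iff N_def by auto
      fix x assume x: "i \<le> x" "x \<le> n" "x \<notin> insert i {i+2..j-1}"
      show "\<exists>y\<in>insert i {i+2..j-1}. N x y \<or> N y x"
      proof (cases "x = i + 1")
        case True thus ?thesis using that pq unfolding N_def by (intro bexI[of _ "i + 2"]) auto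
      next
        case False thus ?thesis using that x ip unfolding N_def by (intro bexI[of _ i]) auto
      qed
    qed
    from card[OF this] show ?thesis using that ij by simp
  qed
  show ?thesis
  proof (cases "j = i + 1")
    case True thus ?thesis using single by auto
  next
    case False
    then have j: "i + 2 \<le> j" using ij by auto
    show ?thesis
    proof (cases "i + 2 \<le> p \<or> j = i + 2")
      case True thus ?thesis using pair j by auto
    next
      case False
      then have "p = i + 1" "i + 2 < j" using j ip by auto
      moreover from this have "j = n" using far by auto
      ultimately show ?thesis using S1 S2 pq by (cases "q < n") auto
    qed
  qed
qed

lemma isolated_free:
  assumes "pure \<Gamma>" "n = p + 2" "i \<le> x" "x \<le> n"
  shows "\<exists>y. i \<le> y \<and> y \<le> n \<and> y \<noteq> x \<and> \<not> N x y \<and> \<not> N y x"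
proof (rule ccontr)
  assume h: "\<not> (\<exists>y. i \<le> y \<and> y \<le> n \<and> y \<noteq> x \<and> \<not> N x y \<and> \<not> N y x)"
  have "{x} \<in> facets \<Gamma>"
  proof (rule facetI)
    show "{x} \<in> \<Gamma>" using assms unfolding face_iff N_def by auto
  qed (use h in blast)
  then have "card {x} = card {p+1..n}"
    using pureD[OF assms(1) _ top_facet[OF pure_imp_i_less_p[OF assms(1)]]] by blast
  thus False using assms(2) by simp
qed

lemma no_triangles:
  assumes "n = p + 2" "i < p" "i \<le> a" "a < b" "b < c" "c \<le> n"
  shows "N a b \<or> N b c \<or> N a c"
  using assms ij pq unfolding N_def by auto

text \<open>
  The three alternatives of \<open>pure_sizes\<close> are treated in turn.  In the first there are no edges at all.
  In the second the complex is a graph, formed by a star with centre \<open>i\<close> and one with centre \<open>n\<close>;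
  the exceptional cases are those in which the two stars do not meet.  In the third only \<open>{i, n}\<close> and
  \<open>{i+1, i+2}\<close> are non-edges, so the vertices \<open>i\<close>, \<open>i+1\<close>, \<open>n\<close>, \<open>i+2\<close> form a cycle and all others
  are cone points.
\<close>

theorem pure_classification:
  assumes "pure \<Gamma>"
  shows "\<Gamma> = points {i..n} \<or>
    (\<exists>Y E. \<Gamma> = join Y (graph E) \<and> connected_edges E \<and> Y \<inter> \<Union>E = {} \<and> Y \<subseteq> {i..n} \<and> \<Union>E \<subseteq> {i..n}) \<or>
    exceptional"
proof -
  have ip: "i < p" by (rule pure_imp_i_less_p[OF assms])
  consider "j = i + 1" "n = p + 1" | "n = p + 2" | "p = i + 1" "q = i + 2" "j = n" "i + 2 < n"
    using pure_sizes[OF assms] by auto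
  thus ?thesis
  proof cases
    case 1
    then have "N a b" if "i \<le> a" "a < b" "b \<le> n" for a b
      using that ip pq unfolding N_def by auto
    then have "\<Gamma> = points {i..n}"
      unfolding set_eq_iff face_iff points_def
    proof (intro allI iffI)
      fix F assume N: "\<And>a b. i \<le> a \<Longrightarrow> a < b \<Longrightarrow> b \<le> n \<Longrightarrow> N a b"
        and F: "F \<subseteq> {i..n} \<and> (\<forall>a\<in>F. \<forall>b\<in>F. \<not> N a b)"
      have "a = b" if "a \<in> F" "b \<in> F" for a b
        using that F N[of a b] N[of b a] by (meson atLeastAtMost_iff linorder_neqE_nat subsetD)
      then have "F = {} \<or> (\<exists>a\<in>F. F = {a})" by blast
      thus "F \<in> insert {} ((\<lambda>w. {w}) ` {i..n})" using F by auto
    next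
      fix F assume "F \<in> insert {} ((\<lambda>w. {w}) ` {i..n})"
      thus "F \<subseteq> {i..n} \<and> (\<forall>a\<in>F. \<forall>b\<in>F. \<not> N a b)" unfolding N_def by auto
    qed
    thus ?thesis by simp
  next
    case 2
    note iso = isolated_free[OF assms 2]
    obtain y where y: "i \<le> y" "y \<le> n" "y \<noteq> i" "\<not> N i y" "\<not> N y i" using iso[of i] ij by auto
    then have j2: "i + 2 \<le> j" using ip ij unfolding N_def by auto
    have jp: "p \<le> j"
    proof (rule ccontr)
      assume "\<not> p \<le> j"
      then have "\<exists>y. i \<le> y \<and> y \<le> n \<and> y \<noteq> p - 1 \<and> \<not> N (p - 1) y \<and> \<not> N y (p - 1)"
        using iso[of "p - 1"] ip 2 by auto
      thus False using \<open>\<not> p \<le> j\<close> j2 ip unfolding N_def by auto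
    qed
    have q: "q = n \<or> q + 1 = n" using pq 2 by auto
    have qj: "q = n \<Longrightarrow> p < j"
    proof (rule ccontr)
      assume qn: "q = n" "\<not> p < j"
      have "\<exists>y. i \<le> y \<and> y \<le> n \<and> y \<noteq> p \<and> \<not> N p y \<and> \<not> N y p" using iso[of p] ip 2 by auto
      thus False using qn ip ij unfolding N_def by auto
    qed
    show ?thesis
    proof (cases "exceptional")
      case False
      have conn: "p < j \<and> (q = n \<longrightarrow> j = n)"
      proof (cases "q = n")
        case True
        then have "p < j" by (rule qj)
        thus ?thesis using False 2 ip ij True unfolding exceptional_def by auto
      next
        case False
        then have "q + 1 = n" using q by simp
        moreover have "p \<noteq> j" using \<open>\<not> exceptional\<close> 2 j2 \<open>q + 1 = n\<close> unfolding exceptional_def by auto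
        ultimately show ?thesis using jp False by auto
      qed
      let ?S = "(\<lambda>a. {i, a}) ` {i+1..j-1}"
      let ?E = "insert {p+1, n} ((if q = n then {} else {{p, n}}) \<union> ?S)"
      have E: "e \<in> ?E \<longleftrightarrow> (\<exists>a b. e = {a, b} \<and> i \<le> a \<and> a < b \<and> b \<le> n \<and> \<not> N a b)" for e
      proof
        assume "e \<in> ?E"
        then consider "e = {p+1, n}" | "e = {p, n}" "q \<noteq> n" | "e \<in> ?S" by (auto split: if_splits)
        thus "\<exists>a b. e = {a, b} \<and> i \<le> a \<and> a < b \<and> b \<le> n \<and> \<not> N a b"
        proof cases
          case 1 thus ?thesis using ip 2 unfolding N_def by (intro exI[of _ "p+1"] exI[of _ n]) auto
        next
          case 2 thus ?thesis using ip q pq \<open>n = p + 2\<close> unfolding N_def by (intro exI[of _ p] exI[of _ n]) auto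
        next
          case 3
          then obtain a where "a \<in> {i+1..j-1}" "e = {i, a}" by blast
          then have "i < a" "a < j" "e = {i, a}" by auto
          thus ?thesis using ij unfolding N_def by (intro exI[of _ i] exI[of _ a]) auto
        qed
      next
        assume "\<exists>a b. e = {a, b} \<and> i \<le> a \<and> a < b \<and> b \<le> n \<and> \<not> N a b"
        then obtain a b where ab: "e = {a, b}" "i \<le> a" "a < b" "b \<le> n" "\<not> N a b" by blast
        then have "(a = i \<and> b < j) \<or> (a = p + 1 \<and> b = n) \<or> (a = p \<and> b = n \<and> q \<noteq> n)"
          using ip 2 pq unfolding N_def by auto
        moreover have "e \<in> ?S" if "a = i" "b < j"
        proof -
          have "b \<in> {i+1..j-1}" using that ab(3) by auto
          thus ?thesis using ab(1) that(1) by blast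
        qed
        ultimately show "e \<in> ?E" using ab(1) by auto
      qed
      have S: "connected_edges ?S" using j2 by (intro star_connected) auto
      have pS: "p \<in> \<Union>?S" using conn ip by auto
      have C: "connected_edges ?E"
      proof (cases "q = n")
        case True
        then have "p + 1 \<in> \<Union>?S" using conn 2 ip by auto
        thus ?thesis using True connected_edges.add[OF S, of "{p+1, n}"] 2 by auto
      next
        case False
        have "connected_edges (insert {p, n} ?S)"
          using connected_edges.add[OF S, of "{p, n}"] pS 2 by auto
        from connected_edges.add[OF this, of "{p+1, n}"] show ?thesis using False 2 by auto
      qed
      have cov: "{i..n} \<subseteq> \<Union>?E"
      proof
        fix x assume x: "x \<in> {i..n}"
        then obtain y where y: "i \<le> y" "y \<le> n" "y \<noteq> x" "\<not> N x y" "\<not> N y x" using iso[of x] by auto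
        then have "{x, y} \<in> ?E"
        proof (cases "x < y")
          case True thus ?thesis unfolding E using x y by (intro exI[of _ x] exI[of _ y]) auto
        next
          case False thus ?thesis unfolding E using x y by (intro exI[of _ y] exI[of _ x]) auto
        qed
        thus "x \<in> \<Union>?E" by blast
      qed
      have "\<Gamma> = graph ?E"
        by (rule edges_eq_graph) (fact no_triangles[OF 2 ip], fact E, fact cov)
      moreover have "join {} (graph ?E) = graph ?E" by (auto simp: join_def)
      moreover have "\<Union>?E \<subseteq> {i..n}" using 2 ip ij by auto
      ultimately show ?thesis using C by (intro disjI2 disjI1 exI[of _ "{}"] exI[of _ ?E]) auto
    qed simp
  next
    case 3
    let ?E = "insert {n, i+1} (insert {n, i+2} ((\<lambda>a. {i, a}) ` {i+1..i+2}))"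
    let ?Y = "{i+3..n-1}"
    have S: "connected_edges ((\<lambda>a. {i, a}) ` {i+1..i+2})" by (intro star_connected) auto
    have "connected_edges (insert {n, i+2} ((\<lambda>a. {i, a}) ` {i+1..i+2}))"
      using 3 by (intro connected_edges.add[OF S]) auto
    then have C: "connected_edges ?E" using 3 by (rule_tac connected_edges.add) auto
    have e12: "{i+1..i+2} = {i+1, i+2}" by auto
    have N3: "N a b \<longleftrightarrow> a = i \<and> b = n \<or> a = i + 1 \<and> b = i + 2" if "a \<le> n" "b \<le> n" for a b
      using that 3 unfolding N_def by auto
    have "\<Gamma> = join ?Y (graph ?E)"
    proof (intro equalityI subsetI)
      fix F assume "F \<in> \<Gamma>"
      then have F: "F \<subseteq> {i..n}" "\<not> (i \<in> F \<and> n \<in> F)" "\<not> (i + 1 \<in> F \<and> i + 2 \<in> F)"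
        using N3[of i n] N3[of "i+1" "i+2"] \<open>i + 2 < n\<close> unfolding face_iff by (simp_all, blast+)
      define x where "x = (if i \<in> F then i else n)"
      define y where "y = (if i + 1 \<in> F then i + 1 else i + 2)"
      have "F - ?Y \<subseteq> {x, y}"
      proof
        fix z assume z: "z \<in> F - ?Y"
        then have "z \<in> {i..n}" "z \<notin> ?Y" using F(1) by blast+
        then have "z = i \<or> z = i + 1 \<or> z = i + 2 \<or> z = n" by auto
        thus "z \<in> {x, y}" using F z by (auto simp: x_def y_def)
      qed
      moreover have "{x, y} \<in> ?E" unfolding e12 by (auto simp: x_def y_def)
      ultimately have "F - ?Y \<in> graph ?E" by (auto simp: graph_def)
      moreover have "F = (F \<inter> ?Y) \<union> (F - ?Y)" by auto
      ultimately show "F \<in> join ?Y (graph ?E)" unfolding join_def by blast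
    next
      fix F assume "F \<in> join ?Y (graph ?E)"
      then obtain S H where SH: "F = S \<union> H" "S \<subseteq> ?Y" "H \<in> graph ?E" unfolding join_def by blast
      then obtain e where e: "e \<in> ?E" "H \<subseteq> e" unfolding graph_def by blast
      have h: "F \<subseteq> S \<union> e" "S \<subseteq> ?Y" "e \<in> ?E" using SH e by auto
      have "e = {n, i+1} \<or> e = {n, i+2} \<or> e = {i, i+1} \<or> e = {i, i+2}"
        using e(1) unfolding e12 by simp
      then have e': "e \<subseteq> {i, i+1, i+2, n}" "\<not> (i \<in> e \<and> n \<in> e)" "\<not> (i + 1 \<in> e \<and> i + 2 \<in> e)"
        using 3(4) by (elim disjE; simp)+
      have "x \<notin> S" if "x \<in> {i, i+1, i+2, n}" for x
      proof -
        have "x \<notin> ?Y" using that 3(4) by auto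
        thus ?thesis using h(2) by blast
      qed
      then have "\<not> (i \<in> S \<union> e \<and> n \<in> S \<union> e)" "\<not> (i + 1 \<in> S \<union> e \<and> i + 2 \<in> S \<union> e)"
        using e' by simp_all
      moreover have "{i, i+1, i+2, n} \<subseteq> {i..n}" "?Y \<subseteq> {i..n}" using 3(4) by auto
      then have "S \<union> e \<subseteq> {i..n}" using h(2) e'(1) by blast
      ultimately have "S \<union> e \<in> \<Gamma>" unfolding face_iff using N3 by (metis atLeastAtMost_iff subsetD)
      thus "F \<in> \<Gamma>" using h(1) down_closed by (auto simp: down_closed_def)
    qed
    moreover have "?Y \<inter> \<Union>?E = {}" "?Y \<subseteq> {i..n}" "\<Union>?E \<subseteq> {i..n}" using 3 by auto
    ultimately show ?thesis using C by (intro disjI2 disjI1 exI[of _ ?Y] exI[of _ ?E]) simp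
  qed
qed

text \<open>
  In both cases the star \<open>{i..<j}\<close> with centre \<open>i\<close> and the star \<open>{j..n}\<close> with centre \<open>n\<close> are the two
  components.
\<close>

lemma exceptional_graph:
  assumes "exceptional"
  obtains E x y U where "\<Gamma> = graph E" "\<forall>e\<in>E. card e = 2" "\<Union>E = {i..n}"
    "x \<in> {i..n}" "y \<in> {i..n}" "x \<in> U" "y \<notin> U" "\<forall>F\<in>\<Gamma>. F \<subseteq> U \<or> F \<inter> U = {}"
proof -
  let ?E = "{e. \<exists>a b. e = {a, b} \<and> i \<le> a \<and> a < b \<and> b \<le> n \<and> \<not> N a b}"
  have np: "n = p + 2" and ip: "i < p" using assms unfolding exceptional_def by auto
  have edge: "\<not> N a b \<longleftrightarrow> (a = i \<and> b < j) \<or> (j \<le> a \<and> b = n)"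
    if "i \<le> a" "a < b" "b \<le> n" for a b
    using that assms unfolding N_def exceptional_def by auto
  have cov: "x \<in> \<Union>?E" if xin: "x \<in> {i..n}" for x
  proof -
    consider "x = i" | "i < x" "x < j" | "j \<le> x" "x < n" | "x = n"
    proof -
      have "x = i \<or> (i < x \<and> x < j) \<or> (j \<le> x \<and> x < n) \<or> x = n" using xin by auto
      thus ?thesis using that by blast
    qed
    thus ?thesis
    proof cases
      case 1
      have "i + 1 < j" "j < n" using assms unfolding exceptional_def by auto
      then have "{i, i+1} \<in> ?E" 
        using edge[of i "i+1"] by (intro CollectI exI[of _ i] exI[of _ "i+1"]) auto
      thus ?thesis using 1 by blast
    next
      case 2
      then have "{i, x} \<in> ?E" using edge[of i x] xin by (intro CollectI exI[of _ i] exI[of _ x]) auto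
      thus ?thesis by blast
    next
      case 3
      then have "{x, n} \<in> ?E" using edge[of x n] xin by (intro CollectI exI[of _ x] exI[of _ n]) auto
      thus ?thesis by blast
    next
      case 4
      have "j \<le> n - 1" "n - 1 < n" "i \<le> n - 1" using assms unfolding exceptional_def by auto
      then have "{n - 1, n} \<in> ?E"
        using edge[of "n-1" n] by (intro CollectI exI[of _ "n-1"] exI[of _ n]) auto
      thus ?thesis using 4 by blast
    qed
  qed
  have g: "\<Gamma> = graph ?E"
  proof (rule edges_eq_graph)
    show "{i..n} \<subseteq> \<Union>?E" using cov by blast
  qed (fact no_triangles[OF np ip], simp)
  show thesis
  proof (rule that[of ?E i n "{i..<j}"])
    show "\<Gamma> = graph ?E" by (rule g)
    show "\<Union>?E = {i..n}" using cov by auto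
    show "i \<in> {i..n}" "n \<in> {i..n}" "i \<in> {i..<j}" "n \<notin> {i..<j}" using ij by auto
    show "\<forall>e\<in>?E. card e = 2" by auto
    show "\<forall>F\<in>\<Gamma>. F \<subseteq> {i..<j} \<or> F \<inter> {i..<j} = {}"
    proof
      fix F assume "F \<in> \<Gamma>"
      then obtain a b where ab: "F \<subseteq> {a, b}" "i \<le> a" "a < b" "b \<le> n" "\<not> N a b"
        unfolding g graph_def by blast
      then have "(a = i \<and> b < j) \<or> (j \<le> a \<and> b = n)" using edge by blast
      thus "F \<subseteq> {i..<j} \<or> F \<inter> {i..<j} = {}" using ab by auto
    qed
  qed
qed

end

section \<open>Cohen-Macaulayness in codimension\<close>

theorem theorem3p9:
  fixes k :: "'k::field itself"
    and n t i j :: nat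
    and u v :: monomial
    and \<Delta> \<Delta>\<^sub>1 \<Delta>\<^sub>2 :: "nat set set"
  assumes "u \<in> M2 n" and "v \<in> M2 n" and "u > v"
    and "u = var i + var j" and "i < j"
    and "simplicial_complex {1..n} \<Delta>"
    and "sr_ideal k {1..n} \<Delta> = monomial_ideal k {1..n} (L n u v)"
    and "\<Delta>\<^sub>1 = Pow {1..i - 1}"
    and "simplicial_complex {i..n} \<Delta>\<^sub>2"
    and "sr_ideal k {i..n} \<Delta>\<^sub>2 = monomial_ideal k {i..n} (L n u v)"
    and "t \<ge> 2"
    and "\<not> CM k {1..n} (t - 1) \<Delta>"
  shows
    "(CM k {1..n} t \<Delta> \<longleftrightarrow>
        (u = var t + var (n - 2) \<and> v = var (n - 2) + var (n - 1) \<and> n > 4 \<and> n > t + 3) \<or>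
        (u = var t + var (n - 1) \<and> v = var (n - 2) + var n \<and> n > 3 \<and> n > t + 2)) \<and>
     (CM k {1..n} t \<Delta> \<longleftrightarrow> cdim \<Delta>\<^sub>1 = int t - 2 \<and> pure \<Delta>\<^sub>2) \<and>
     (CM k {1..n} t \<Delta> \<longleftrightarrow> cdim \<Delta>\<^sub>1 = int t - 2 \<and> buchsbaum k {i..n} \<Delta>\<^sub>2)"
proof -
  obtain p q where pq: "1 \<le> p" "p < q" "q \<le> n" and v: "v = var p + var q"
    using assms(2) unfolding M2_iff by blast
  note u = assms(4) and ij = assms(5)
  have ijn: "1 \<le> i" "j \<le> n"
    using assms(1) pair_eq_iff[OF ij] unfolding M2_iff u by blast+
  have uv: "i < p \<or> i = p \<and> j < q"
    using assms(3) pair_le_iff[OF ij pq(2)] unfolding u v by (auto simp: not_le[symmetric])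
  let ?P = "\<lambda>a b. a < b \<and> (i < a \<or> i = a \<and> j \<le> b) \<and> (a < p \<or> a = p \<and> b \<le> q)"
  have L: "g \<in> L n u v \<longleftrightarrow> (\<exists>a b. g = var a + var b \<and> 1 \<le> a \<and> b \<le> n \<and> ?P a b)" for g
  proof -
    have "v \<le> var a + var b \<and> var a + var b \<le> u \<longleftrightarrow> ?P a b" if "a < b" for a b
      unfolding u v pair_le_iff[OF that ij] pair_le_iff[OF pq(2) that] using that by blast
    thus ?thesis unfolding L_def M2_iff by blast
  qed
  have keysL: "keys g \<subseteq> {i..n}" if "g \<in> L n u v" for g
    using that unfolding L by (auto simp: keys_pair)
  have face: "F \<in> \<Gamma> \<longleftrightarrow> F \<subseteq> V \<and> (\<forall>a\<in>F. \<forall>b\<in>F. \<not> ?P a b)"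
    if c: "simplicial_complex V \<Gamma>" and e: "sr_ideal k V \<Gamma> = monomial_ideal k V (L n u v)"
      and V: "{i..n} \<subseteq> V" "V \<subseteq> {1..n}" for V \<Gamma> F
  proof (cases "F \<subseteq> V")
    case True
    have fin: "finite F" using True V finite_subset finite_atLeastAtMost by (metis subset_trans)
    have "F \<in> \<Gamma> \<longleftrightarrow> \<not> (\<exists>g\<in>L n u v. \<exists>h. (\<Sum>v\<in>F. var v) = g + h)"
      using keysL V(1) by (intro face_iff_of_ideal_eq[OF c e _ True]) blast
    also have "\<dots> \<longleftrightarrow> \<not> (\<exists>a b. 1 \<le> a \<and> b \<le> n \<and> ?P a b \<and> (\<exists>h. (\<Sum>v\<in>F. var v) = var a + var b + h))"
      unfolding Bex_def L by blast
    also have "\<dots> \<longleftrightarrow> \<not> (\<exists>a b. 1 \<le> a \<and> b \<le> n \<and> ?P a b \<and> a \<in> F \<and> b \<in> F)"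
      by (intro arg_cong[of _ _ Not] ex_cong1 conj_cong refl) (simp add: pair_le_face_iff[OF fin])
    also have "\<dots> \<longleftrightarrow> (\<forall>a\<in>F. \<forall>b\<in>F. \<not> ?P a b)" 
    proof -
      have "1 \<le> a \<and> a \<le> n" if "a \<in> F" for a using that True V(2) by auto
      thus ?thesis by blast
    qed
    finally show ?thesis using True by simp
  next
    case False
    thus ?thesis using c by (auto simp: simplicial_complex_def)
  qed
  have face1: "F \<in> \<Delta> \<longleftrightarrow> F \<subseteq> {1..n} \<and> (\<forall>a\<in>F. \<forall>b\<in>F. \<not> ?P a b)" for F
    using ijn by (intro face[OF assms(6,7)]) auto
  have face2: "F \<in> \<Delta>\<^sub>2 \<longleftrightarrow> F \<subseteq> {i..n} \<and> (\<forall>a\<in>F. \<forall>b\<in>F. \<not> ?P a b)" for F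
    using ijn by (intro face[OF assms(9,10)]) auto
  interpret G: lex_segment_complex i j p q n \<Delta>\<^sub>2
    by (rule lex_segment_complex.intro[OF ij ijn(2) pq(2,3) uv face2])
  interpret G: complex k "{i..n}" \<Delta>\<^sub>2 by unfold_locales (rule assms(9))
  let ?Z = "{1..i - 1}"
  have join: "\<Delta> = join ?Z \<Delta>\<^sub>2"
  proof (intro equalityI subsetI)
    fix F assume F: "F \<in> \<Delta>"
    have "F \<inter> {i..n} \<in> \<Delta>\<^sub>2" using F unfolding face1 face2 by blast
    moreover have "F = (F \<inter> ?Z) \<union> (F \<inter> {i..n})" using F unfolding face1 by auto
    ultimately show "F \<in> join ?Z \<Delta>\<^sub>2" unfolding join_def by blast
  next
    fix F assume "F \<in> join ?Z \<Delta>\<^sub>2"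
    then obtain S H where h: "F = S \<union> H" "S \<subseteq> ?Z" "H \<in> \<Delta>\<^sub>2" unfolding join_def by blast
    have "F \<subseteq> {1..n}" using h ij ijn unfolding face2 by fastforce
    moreover have "\<not> ?P a b" if "a \<in> F" "b \<in> F" for a b
    proof (cases "a \<in> H \<and> b \<in> H")
      case True
      thus ?thesis using h(3) unfolding face2 by blast
    next
      case False
      have "x < i" if "x \<in> S" for x
      proof -
        have "x \<in> ?Z" using that h(2) by blast
        then have "1 \<le> x" "x \<le> i - 1" by auto
        thus ?thesis by linarith
      qed
      moreover have "i \<le> x" if "x \<in> H" for x using that h(3) unfolding face2 by auto
      ultimately have "a < i \<or> b \<le> a" using False that h(1) by (metis Un_iff leD le_less_linear less_le_trans order.strict_implies_order)
      thus ?thesis by auto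
    qed
    ultimately show "F \<in> \<Delta>" unfolding face1 by blast
  qed
  have Z: "?Z \<inter> \<Union>\<Delta>\<^sub>2 = {}" "?Z \<subseteq> {1..n}" using face2 ij ijn by fastforce+
  have V2: "{i..n} \<subseteq> {1..n}" using ijn by auto
  have pure: "pure \<Delta> \<longleftrightarrow> pure \<Delta>\<^sub>2"
    unfolding join using Z(1) G.finite_face by (intro pure_join_iff) auto
  have pure_exc: "G.exceptional" if pu: "pure \<Delta>\<^sub>2"
  proof (rule ccontr)
    assume ne: "\<not> G.exceptional"
    have "\<forall>F\<in>\<Delta>. cohen_macaulay k ({1..n} - F) (link \<Delta> F)"
    proof (cases "\<Delta>\<^sub>2 = points {i..n}")
      case True
      show ?thesis unfolding join True
        using Z ij ijn V2 by (intro ballI cohen_macaulay_link_points) auto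
    next
      case False
      then obtain Y E where E: "\<Delta>\<^sub>2 = join Y (graph E)" "connected_edges E" "Y \<inter> \<Union>E = {}"
        "Y \<subseteq> {i..n}" "\<Union>E \<subseteq> {i..n}" using G.pure_classification[OF pu] ne by blast
      have jj: "\<Delta> = join (?Z \<union> Y) (graph E)"
        unfolding join E(1)
      proof (intro equalityI subsetI)
        fix F assume "F \<in> join ?Z (join Y (graph E))"
        then obtain S T H where "F = S \<union> (T \<union> H)" "S \<subseteq> ?Z" "T \<subseteq> Y" "H \<in> graph E"
          unfolding join_def by blast
        then have "F = (S \<union> T) \<union> H" "S \<union> T \<subseteq> ?Z \<union> Y" "H \<in> graph E" by auto
        thus "F \<in> join (?Z \<union> Y) (graph E)" unfolding join_def by blast
      next
        fix F assume "F \<in> join (?Z \<union> Y) (graph E)"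
        then obtain S H where "F = S \<union> H" "S \<subseteq> ?Z \<union> Y" "H \<in> graph E" unfolding join_def by blast
        then have "F = (S \<inter> ?Z) \<union> ((S \<inter> Y) \<union> H)" "(S \<inter> Y) \<union> H \<in> join Y (graph E)"
          unfolding join_def by blast+
        thus "F \<in> join ?Z (join Y (graph E))" unfolding join_def[of ?Z] by blast
      qed
      show ?thesis unfolding jj
      proof (intro ballI cohen_macaulay_link_graph)
        show "(?Z \<union> Y) \<inter> \<Union>E = {}" using E by fastforce
        show "?Z \<union> Y \<subseteq> {1..n}" "\<Union>E \<subseteq> {1..n}" using Z E V2 by blast+
      qed (use E(2) connected_edges_finite in auto)
    qed
    then have "CM k {1..n} (t - 1) \<Delta>" using pu pure by (simp add: CM_def)
    thus False using assms(12) by simp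
  qed
  have exc: "pure \<Delta>\<^sub>2 \<and> buchsbaum k {i..n} \<Delta>\<^sub>2 \<and> (CM k {1..n} t \<Delta> \<longleftrightarrow> i = t)" if ex: "G.exceptional"
  proof -
    obtain E x y U where E: "\<Delta>\<^sub>2 = graph E" "\<forall>e\<in>E. card e = 2" "\<Union>E = {i..n}"
      and xy: "x \<in> {i..n}" "y \<in> {i..n}" "x \<in> U" "y \<notin> U"
      and U: "\<forall>F\<in>\<Delta>\<^sub>2. F \<subseteq> U \<or> F \<inter> U = {}"
      by (rule G.exceptional_graph[OF ex])
    have cov: "\<exists>e\<in>\<Delta>\<^sub>2. F \<subseteq> e \<and> card e = 2" if "F \<in> \<Delta>\<^sub>2" for F
      using that E(2) unfolding E(1) graph_def by blast
    have bb: "buchsbaum k {i..n} \<Delta>\<^sub>2" by (rule G.pure_graph_buchsbaum[OF cov])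
    then have pu: "pure \<Delta>\<^sub>2" by (rule G.buchsbaum_imp_pure)
    have CM_iff: "CM k {1..n} s \<Delta> \<longleftrightarrow> i \<le> s" for s
    proof
      assume cm: "CM k {1..n} s \<Delta>"
      show "i \<le> s"
      proof (rule ccontr)
        assume "\<not> i \<le> s"
        then have "s \<le> card ?Z" by simp
        moreover have ZD: "?Z \<in> \<Delta>" unfolding join join_def using G.empty_face by blast
        ultimately have "cohen_macaulay k ({1..n} - ?Z) (link \<Delta> ?Z)"
          using cm unfolding CM_def by blast
        moreover have "{1..n} - ?Z = {i..n}" using ijn by auto
        moreover have "link \<Delta> ?Z = \<Delta>\<^sub>2"
        proof -
          have "link \<Delta> ?Z = join (?Z - ?Z) (link \<Delta>\<^sub>2 (?Z \<inter> \<Union>\<Delta>\<^sub>2))"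
            unfolding join by (rule link_join[OF Z(1) G.down_closed]) (use ZD join in simp)
          also have "\<dots> = \<Delta>\<^sub>2" unfolding Z(1) link_empty[OF G.down_closed] by (auto simp: join_def)
          finally show ?thesis .
        qed
        ultimately have cm2: "cohen_macaulay k {i..n} \<Delta>\<^sub>2" by simp
        have vert: "{z} \<in> \<Delta>\<^sub>2" if "z \<in> {i..n}" for z using that unfolding face2 by auto
        obtain e where e: "e \<in> \<Delta>\<^sub>2" "card e = 2" using cov[OF G.empty_face] by blast
        have "\<not> cohen_macaulay k {i..n} \<Delta>\<^sub>2"
          using xy e by (intro G.disconnected_not_cohen_macaulay[of x y U e] vert bspec[OF U]) auto
        thus False using cm2 by simp
      qed
    next
      assume s: "i \<le> s"
      have "cohen_macaulay k ({1..n} - F) (link \<Delta> F)" if F: "F \<in> \<Delta>" "s \<le> card F" for F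
      proof -
        have "\<not> F \<subseteq> ?Z"
        proof
          assume "F \<subseteq> ?Z"
          then have "card F \<le> card ?Z" by (intro card_mono) auto
          thus False using F(2) s ijn by simp
        qed
        then have "F \<inter> \<Union>E \<noteq> {}" using F(1) unfolding face1 E(3) by fastforce
        moreover have "?Z \<inter> \<Union>E = {}" "\<Union>E \<subseteq> {1..n}" unfolding E(3) using ijn by auto
        ultimately show ?thesis using F(1) Z(2) E(2) unfolding join E(1)
          by (intro cohen_macaulay_link_graph) auto
      qed
      thus "CM k {1..n} s \<Delta>" using pu pure by (simp add: CM_def)
    qed
    have "t - 1 < i" using assms(12) CM_iff[of "t - 1"] by simp
    then have "CM k {1..n} t \<Delta> \<longleftrightarrow> i = t" unfolding CM_iff by auto
    thus ?thesis using pu bb by blast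
  qed
  have CM_t: "CM k {1..n} t \<Delta> \<longleftrightarrow> G.exceptional \<and> i = t"
    using exc pure_exc pure by (auto simp: CM_def)
  have dim1: "cdim \<Delta>\<^sub>1 = int t - 2 \<longleftrightarrow> i = t"
  proof -
    have "Max (card ` \<Delta>\<^sub>1) = i - 1"
    proof (rule Max_eqI)
      show "finite (card ` \<Delta>\<^sub>1)" unfolding assms(8) by simp
      show "i - 1 \<in> card ` \<Delta>\<^sub>1" unfolding assms(8) by (rule image_eqI[of _ _ ?Z]) auto
      fix c assume "c \<in> card ` \<Delta>\<^sub>1"
      then obtain S where "S \<subseteq> ?Z" "c = card S" unfolding assms(8) by auto
      thus "c \<le> i - 1" using card_mono[of ?Z S] by simp
    qed
    thus ?thesis unfolding cdim_def using ijn by auto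
  qed
  have "(u = var t + var (n - 2) \<and> v = var (n - 2) + var (n - 1) \<and> n > 4 \<and> n > t + 3) \<longleftrightarrow>
      i = t \<and> p + 2 = n \<and> q + 1 = n \<and> j = p \<and> i + 2 \<le> p"
  proof (cases "n > t + 3")
    case True
    then have "t < n - 2" "n - 2 < n - 1" by auto
    thus ?thesis unfolding u v pair_eq_iff[OF ij \<open>t < n - 2\<close>] pair_eq_iff[OF pq(2) \<open>n - 2 < n - 1\<close>]
      using True assms(11) by auto
  qed auto
  moreover have "(u = var t + var (n - 1) \<and> v = var (n - 2) + var n \<and> n > 3 \<and> n > t + 2) \<longleftrightarrow>
      i = t \<and> p + 2 = n \<and> q = n \<and> j = p + 1 \<and> i + 1 \<le> p"
  proof (cases "n > t + 2")
    case True
    then have "t < n - 1" "n - 2 < n" by auto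
    thus ?thesis unfolding u v pair_eq_iff[OF ij \<open>t < n - 1\<close>] pair_eq_iff[OF pq(2) \<open>n - 2 < n\<close>]
      using True assms(11) by auto
  qed auto
  ultimately have ii: "(u = var t + var (n - 2) \<and> v = var (n - 2) + var (n - 1) \<and> n > 4 \<and> n > t + 3) \<or>
        (u = var t + var (n - 1) \<and> v = var (n - 2) + var n \<and> n > 3 \<and> n > t + 2)
      \<longleftrightarrow> G.exceptional \<and> i = t"
    unfolding G.exceptional_def by blast
  have "pure \<Delta>\<^sub>2 \<longleftrightarrow> G.exceptional" "buchsbaum k {i..n} \<Delta>\<^sub>2 \<longleftrightarrow> G.exceptional"
    using exc pure_exc G.buchsbaum_imp_pure by blast+
  thus ?thesis using CM_t dim1 ii by auto
qed

end
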